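(* 1. Suppose that $\mathrm{Re}\,b\geq\mathrm{Re}\,a>0$ and $\mathrm{Re}\,\alpha>-1/2$. Then $$\int_0^\infty I_\alpha^2(a x) K_\alpha^2(b x) \,\mathrm{d}x=\frac{\pi}{4b}\bigg(\frac{a}{2b}\bigg)^{2\alpha}\frac{\Gamma(\alpha+\frac{1}{2})\Gamma(2\alpha+\frac{1}{2})}{\Gamma^3(\alpha+1)}\,{}_4F_3\bigg({\alpha+\frac{1}{2},2\alpha+\frac{1}{2},\alpha+\frac{1}{2},\frac{1}{2} \atop \alpha+1,2\alpha+1,\alpha+1}\;\bigg|\;\frac{a^2}{b^2}\bigg).$$ 2. Suppose that $\mathrm{Re}\,b>\mathrm{Re}\,a>0$ and $\mathrm{Re}\,\alpha>-1$. Then $$\int_0^\infty x I_\alpha^2(a x) K_\alpha^2(b x) \,\mathrm{d}x=\frac{(a/b)^{2\alpha}}{2b^2(1+2\alpha)}\,{}_2F_1\bigg({\alpha+\frac{1}{2},1 \atop \alpha+\frac{3}{2}}\;\bigg| \;\frac{a^2}{b^2}\bigg).$$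
   Context: The parameters $a,b,\alpha$ are complex numbers. $I_\nu$ and $K_\nu$ denote the modified Bessel functions of the first and second kind: $I_\nu(z)=\sum_{k=0}^\infty \frac{1}{k!\,\Gamma(k+\nu+1)}(z/2)^{2k+\nu}$ and, for $\mathrm{Re}\,z>0$, $K_\nu(z)=\int_0^\infty \mathrm{e}^{-z\cosh t}\cosh(\nu t)\,\mathrm{d}t$. The generalized hypergeometric function is ${}_pF_q\big({a_1,\ldots,a_p\atop b_1,\ldots,b_q}\,\big|\,z\big)=\sum_{k=0}^\infty\frac{(a_1)_k\cdots(a_p)_k}{(b_1)_k\cdots(b_q)_k}\frac{z^k}{k!}$ for $|z|<1$ and by analytic continuation elsewhere, with $(v)_k=v(v+1)\cdots(v+k-1)$.
   Formalization: The ranges of α are corrected to Re α > -1/4 in part 1 and Re α > -1/2 in part 2, since for smaller Re α the integrands behave like x^{4α} and x^{1+4α} near 0 and the integrals diverge. *)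

theory Defs
  imports "HOL-Complex_Analysis.Complex_Analysis"
begin

(* rGamma is the entire reciprocal Gamma function, so terms at poles of Gamma vanish.
   The power is the principal branch; the value at z = 0 is not meaningful in general. *)
definition bessel_I :: "complex \<Rightarrow> complex \<Rightarrow> complex" where
  "bessel_I \<nu> z =
     (\<Sum>k. rGamma (of_nat k + \<nu> + 1) / fact k * (z / 2) powr (2 * of_nat k + \<nu>))"

(* Meaningful for Re z > 0 only. *)
definition bessel_K :: "complex \<Rightarrow> complex \<Rightarrow> complex" where
  "bessel_K \<nu> z =
     (LINT t:{0<..}|lborel. exp (- z * of_real (cosh t)) * cosh (\<nu> * of_real t))"

definition cut_plane :: "complex set" where
  "cut_plane = - (complex_of_real ` {1..})"

(* pFq with upper parameters as and lower parameters bs: the principal branch, i.e. the analytic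
   continuation of the hypergeometric series from the unit disc to the plane cut along [1,\<infinity>).
   At z = 1 the value is the sum of the series (where it converges).  For 1 < z on the cut and
   length as = length bs + 1 the series diverges and the value is not meaningful. *)
definition hypergeom :: "complex list \<Rightarrow> complex list \<Rightarrow> complex \<Rightarrow> complex" where
  "hypergeom as bs z =
     (if z \<in> cut_plane
      then (THE v. \<exists>F. F holomorphic_on cut_plane \<and>
                       (\<forall>w\<in>ball 0 1. F w = eval_fps (fps_hypergeo as bs 1) w) \<and> v = F z)
      else eval_fps (fps_hypergeo as bs 1) z)"

lemma open_cut_plane: "open cut_plane"
proof -
  have "closed (complex_of_real ` {1..})"
    by (intro closed_injective_linear_image)
       (auto simp: inj_on_def linear_iff scaleR_conv_of_real)
  thus ?thesis by (simp add: cut_plane_def open_Compl)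
qed

lemma ball_subset_cut_plane: "ball 0 1 \<subseteq> cut_plane"
  by (auto simp: cut_plane_def)

lemma connected_cut_plane: "connected cut_plane"
proof -
  have "closed_segment 0 z \<subseteq> cut_plane" if z: "z \<in> cut_plane" for z
  proof
    fix w assume "w \<in> closed_segment 0 z"
    then obtain u where u: "0 \<le> u" "u \<le> 1" "w = of_real u * z"
      by (auto simp: closed_segment_def scaleR_conv_of_real)
    show "w \<in> cut_plane"
    proof (rule ccontr)
      assume "w \<notin> cut_plane"
      then obtain r where r: "r \<ge> 1" "w = of_real r" by (auto simp: cut_plane_def)
      have "u \<noteq> 0" using u r by auto
      hence "z = of_real (r / u)" using u r by (simp add: field_simps)
      moreover have "r / u \<ge> 1" using u r \<open>u \<noteq> 0\<close> by (simp add: field_simps)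
      ultimately have "z \<in> complex_of_real ` {1..}" by (intro image_eqI[of _ _ "r / u"]) auto
      with z show False by (simp add: cut_plane_def)
    qed
  qed
  hence "starlike cut_plane"
    unfolding starlike_def using ball_subset_cut_plane by (intro bexI[of _ 0]) auto
  thus ?thesis by (rule starlike_imp_connected)
qed

lemma hypergeom_eqI:
  assumes F: "F holomorphic_on cut_plane"
    and F_eq: "\<And>w. norm w < 1 \<Longrightarrow> F w = eval_fps (fps_hypergeo as bs 1) w"
    and z: "z \<in> cut_plane"
  shows "hypergeom as bs z = F z"
proof -
  have "(THE v. \<exists>F. F holomorphic_on cut_plane \<and>
          (\<forall>w\<in>ball 0 1. F w = eval_fps (fps_hypergeo as bs 1) w) \<and> v = F z) = F z"
  proof (rule the_equality)
    show "\<exists>G. G holomorphic_on cut_plane \<and>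
            (\<forall>w\<in>ball 0 1. G w = eval_fps (fps_hypergeo as bs 1) w) \<and> F z = G z"
      using F F_eq by (intro exI[of _ F]) auto
  next
    fix v
    assume "\<exists>G. G holomorphic_on cut_plane \<and>
            (\<forall>w\<in>ball 0 1. G w = eval_fps (fps_hypergeo as bs 1) w) \<and> v = G z"
    then obtain G where G: "G holomorphic_on cut_plane"
      "\<forall>w\<in>ball 0 1. G w = eval_fps (fps_hypergeo as bs 1) w" "v = G z" by blast
    have "G z = F z"
      by (rule analytic_continuation_open[of "ball 0 1" cut_plane])
         (use G F F_eq z open_cut_plane connected_cut_plane ball_subset_cut_plane in auto)
    thus "v = F z" using G by simp
  qed
  thus ?thesis using z by (simp add: hypergeom_def)
qed

end

theory Submission
  imports Defs
begin

text \<open>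
  Both formulas come from integrating a series term by term. The Cauchy product and Vandermonde's
  convolution give
  \<open>I_\<alpha>(z)^2 = \<Sum>_k c_k (z/2)^{2\<alpha>+2k}\<close> with
  \<open>c_k = \<Gamma>(2\<alpha>+2k+1) / (k! \<Gamma>(\<alpha>+k+1)^2 \<Gamma>(2\<alpha>+k+1))\<close>
  (\<open>bessel_phi_square\<close>), and the Mellin transform of \<open>K_\<alpha>^2\<close> is explicit (\<open>mellin_bessel_K_square\<close>):
  \<open>\<integral> x^{s-1} K_\<alpha>(bx)^2 dx = 2^{s-3} b^{-s} \<Gamma>(s/2+\<alpha>) \<Gamma>(s/2-\<alpha>) \<Gamma>(s/2)^2 / \<Gamma>(s)\<close>.
  For the weight \<open>x^m\<close> the term of index \<open>k\<close> contributes the value at \<open>s = 2\<alpha>+2k+m+1\<close>. For \<open>m = 0\<close> the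
  factor \<open>\<Gamma>(2\<alpha>+2k+1)\<close> cancels and Legendre's duplication formula normalises the constant, which gives
  the 4F3 (\<open>mellin_term_4F3\<close>); for \<open>m = 1\<close> all Gamma factors collapse to \<open>1/(2\<alpha>+2k+1)\<close>, which is the
  2F1 (\<open>mellin_term_2F1\<close>).

  The interchange of sum and integral is dominated for \<open>|a| < Re b\<close> (\<open>termwise_integration\<close>). Both
  sides are holomorphic in \<open>a\<close> on the strip \<open>0 < Re a < Re b\<close>, because \<open>a^2/b^2\<close> stays off the cut there, so
  the identity extends to the strip (\<open>continuation_in_strip\<close>). The line \<open>Re a = Re b\<close> of the first formula
  is reached as the limit of \<open>r a\<close> for \<open>r \<rightarrow> 1\<close> (\<open>integral_4F3\<close>); at \<open>a = b\<close> the right-hand side converges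
  because the coefficients of the 4F3 are \<open>O(k^{-2})\<close>.

  Domination rests on two comparisons with real parameters, where \<open>\<sigma> = Re \<alpha>\<close>. Poisson's integral bounds
  \<open>|I_\<alpha>(z)|\<close> by a constant times \<open>|z|^\<sigma> M_\<sigma>(Re z)\<close> with \<open>M_\<sigma>\<close> increasing, and
  \<open>|K_\<alpha>(z)| \<le> K_\<sigma>(Re z)\<close>. On the open strip \<open>M_\<sigma>(Ax)\<close> is \<open>O(e^{Ax})\<close> and
  \<open>e^{Ax} K_\<sigma>(Bx) \<le> K_\<sigma>((B-A)x)\<close>, so the Mellin transform itself supplies the integrable majorant. On the
  boundary the majorant is, up to a constant, \<open>I_\<sigma>(Ax)^2 K_\<sigma>(Ax)^2\<close>, a series of nonnegative
  functions whose integrals are proportional to the summable coefficients of the 4F3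
  (\<open>integrand_majorant_integrable_eq\<close>).

  The Beta integral is used on the whole real line, in the logistic variable \<open>u = e^p/(1+e^p)\<close>. The same
  kernel then produces Euler's integral, which continues the hypergeometric series to the cut plane,
  Poisson's integral for \<open>I_\<alpha>\<close>, and the powers of \<open>cosh\<close> in the Mellin transform of \<open>K_\<alpha>^2\<close>.
\<close>

section \<open>Integrals that depend holomorphically on a parameter\<close>

text \<open>
  A local integrable majorant \<open>g\<close> of the integrand also controls its difference quotients: Cauchy's
  estimate bounds the derivative by a multiple of \<open>g\<close> on a smaller disc. Dominated convergence then
  differentiates under the integral sign.
\<close>
lemma holomorphic_on_parameter_integral:
  fixes f :: "complex \<Rightarrow> 'x \<Rightarrow> complex"
  assumes S: "open S"
    and hol: "\<And>x. x \<in> space M \<Longrightarrow> (\<lambda>z. f z x) holomorphic_on S"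
    and meas: "\<And>z. z \<in> S \<Longrightarrow> f z \<in> borel_measurable M"
    and dom: "\<And>z. z \<in> S \<Longrightarrow> \<exists>r>0. ball z r \<subseteq> S \<and> (\<exists>g. integrable M g \<and>
                (\<forall>w\<in>ball z r. \<forall>x\<in>space M. norm (f w x) \<le> g x))"
  shows "(\<lambda>z. \<integral>x. f z x \<partial>M) holomorphic_on S"
proof -
  have int: "integrable M (f z)" if z: "z \<in> S" for z
  proof -
    obtain r g where r: "r > 0" and g: "integrable M g"
      "\<And>w x. w \<in> ball z r \<Longrightarrow> x \<in> space M \<Longrightarrow> norm (f w x) \<le> g x"
      using dom[OF z] by blast
    show ?thesis
    proof (rule Bochner_Integration.integrable_bound[OF g(1) meas[OF z] AE_I2])
      fix x assume "x \<in> space M"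
      thus "norm (f z x) \<le> norm (g x)" using g(2)[of z x] r by (simp add: abs_le_iff)
    qed
  qed
  have "(\<lambda>z. \<integral>x. f z x \<partial>M) field_differentiable at z" if z: "z \<in> S" for z
  proof -
    obtain r g where r: "r > 0" "ball z r \<subseteq> S" and g: "integrable M g"
      "\<And>w x. w \<in> ball z r \<Longrightarrow> x \<in> space M \<Longrightarrow> norm (f w x) \<le> g x"
      using dom[OF z] by blast
    define D where "D x = deriv (\<lambda>z. f z x) z" for x
    have der: "((\<lambda>w. f w x) has_field_derivative deriv (\<lambda>z. f z x) w) (at w)"
      if "x \<in> space M" "w \<in> S" for x w
      using holomorphic_derivI[OF hol[OF that(1)] S that(2)] .
    (* Cauchy's estimate on the disc of radius r/2 about w, which stays inside the disc about z. *)
    have dbound: "norm (deriv (\<lambda>z. f z x) w) \<le> g x / (r / 2)"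
      if x: "x \<in> space M" and w: "w \<in> ball z (r / 2)" for x w
    proof -
      have sub: "ball w (r/2) \<subseteq> ball z r" "cball w (r/2) \<subseteq> ball z r"
      proof -
        have "cball w (r/2) \<subseteq> ball z r"
        proof
          fix u assume "u \<in> cball w (r/2)"
          thus "u \<in> ball z r" using w dist_triangle[of z u w] by simp
        qed
        thus "ball w (r/2) \<subseteq> ball z r" "cball w (r/2) \<subseteq> ball z r" by auto
      qed
      have "(\<lambda>z. f z x) holomorphic_on ball z r" using hol[OF x] r(2) by (rule holomorphic_on_subset)
      hence "norm ((deriv ^^ 1) (\<lambda>z. f z x) w) \<le> fact 1 * g x / (r/2) ^ 1"
        using sub r g(2)[OF _ x]
        by (intro Cauchy_inequality holomorphic_on_subset[OF _ sub(1)]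
              holomorphic_on_imp_continuous_on[OF holomorphic_on_subset[OF _ sub(2)]])
           (auto simp: dist_norm norm_minus_commute subset_iff)
      thus ?thesis by simp
    qed
    have lip: "norm ((f w x - f z x) / (w - z)) \<le> 2 * g x / r"
      if x: "x \<in> space M" and w: "w \<in> ball z (r / 2)" "w \<noteq> z" for x w
    proof -
      have sub: "ball z (r/2) \<subseteq> S" by (rule order_trans[OF subset_ball r(2)]) (use r(1) in simp)
      have "norm (f w x - f z x) \<le> (g x / (r/2)) * norm (w - z)"
      proof (rule field_differentiable_bound[of "ball z (r/2)" "\<lambda>z. f z x" "deriv (\<lambda>z. f z x)"])
        show "((\<lambda>z. f z x) has_field_derivative deriv (\<lambda>z. f z x) u) (at u within ball z (r/2))"
          if "u \<in> ball z (r/2)" for u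
          using that sub by (intro has_field_derivative_at_within[OF der[OF x]]) auto
        show "cmod (deriv (\<lambda>z. f z x) u) \<le> g x / (r/2)" if "u \<in> ball z (r/2)" for u
          by (rule dbound[OF x that])
        show "w \<in> ball z (r/2)" by (rule w(1))
        show "z \<in> ball z (r/2)" using r by simp
      qed (rule convex_ball)
      thus ?thesis using w(2) r(1) by (simp add: norm_divide divide_le_eq mult_ac)
    qed
    have "((\<lambda>w. ((\<integral>x. f w x \<partial>M) - (\<integral>x. f z x \<partial>M)) / (w - z)) \<longlongrightarrow> (\<integral>x. D x \<partial>M)) (at z)"
      unfolding tendsto_at_iff_sequentially
    proof (intro allI impI)
      fix X :: "nat \<Rightarrow> complex"
      assume X: "\<forall>i. X i \<in> UNIV - {z}" "X \<longlonglongrightarrow> z"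
      have "\<forall>\<^sub>F n in sequentially. X n \<in> ball z (r/2)"
        using X(2) r by (intro topological_tendstoD) auto
      then obtain N where N: "\<And>n. n \<ge> N \<Longrightarrow> X n \<in> ball z (r/2)"
        by (auto simp: eventually_sequentially)
      define Y where "Y n = X (n + N)" for n
      have Y: "Y n \<in> ball z (r/2)" "Y n \<noteq> z" "Y n \<in> S" for n
        using N[of "n + N"] X(1) r by (auto simp: Y_def)
      have Ylim: "Y \<longlonglongrightarrow> z" unfolding Y_def using X(2) by (rule LIMSEQ_ignore_initial_segment)
      have quot: "(\<lambda>n. (f (Y n) x - f z x) / (Y n - z)) \<longlonglongrightarrow> D x" if x: "x \<in> space M" for x
      proof -
        have "((\<lambda>w. (f w x - f z x) / (w - z)) \<longlongrightarrow> D x) (at z)"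
          using der[OF x z] by (simp add: has_field_derivative_iff D_def)
        thus ?thesis using Y Ylim unfolding tendsto_at_iff_sequentially by (auto simp: o_def)
      qed
      have "(\<lambda>n. \<integral>x. (f (Y n) x - f z x) / (Y n - z) \<partial>M) \<longlonglongrightarrow> (\<integral>x. D x \<partial>M)"
      proof (rule integral_dominated_convergence[where w = "\<lambda>x. 2 * g x / r"])
        show qm: "(\<lambda>x. (f (Y n) x - f z x) / (Y n - z)) \<in> borel_measurable M" for n
          using meas[OF Y(3)] meas[OF z] by measurable
        show "D \<in> borel_measurable M"
          by (rule borel_measurable_LIMSEQ_metric[OF qm]) (rule quot)
        show "integrable M (\<lambda>x. 2 * g x / r)" using g(1) by simp
      qed (use quot lip Y in auto)
      also have "(\<lambda>n. \<integral>x. (f (Y n) x - f z x) / (Y n - z) \<partial>M) =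
          (\<lambda>n. ((\<integral>x. f (Y n) x \<partial>M) - (\<integral>x. f z x \<partial>M)) / (Y n - z))"
        using int[OF Y(3)] int[OF z] by (auto simp: fun_eq_iff)
      finally show "((\<lambda>w. ((\<integral>x. f w x \<partial>M) - (\<integral>x. f z x \<partial>M)) / (w - z)) \<circ> X) \<longlonglongrightarrow> (\<integral>x. D x \<partial>M)"
        unfolding o_def Y_def by (rule LIMSEQ_offset)
    qed
    thus ?thesis by (auto simp: field_differentiable_def has_field_derivative_iff)
  qed
  thus ?thesis by (auto simp: holomorphic_on_def field_differentiable_at_within)
qed

section \<open>Laplace integrals of powers\<close>

text \<open>
  The real change of variables, applied to real and imaginary parts separately.
\<close>
lemma exp_substitution:
  fixes f :: "real \<Rightarrow> complex"
  assumes f: "set_integrable lborel {0<..} f" and m: "f \<in> borel_measurable borel"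
  shows "integrable lborel (\<lambda>p. of_real (exp p) * f (exp p))"
    and "(LINT p|lborel. of_real (exp p) * f (exp p)) = (LINT x:{0<..}|lborel. f x)"
proof -
  have real: "integrable lborel (\<lambda>p. exp p * h (exp p)) \<and>
      (LINT p|lborel. exp p * h (exp p)) = (LINT x:{0<..}|lborel. h x)"
    if h: "set_integrable lborel {0<..} h" and hm: "h \<in> borel_measurable borel"
    for h :: "real \<Rightarrow> real"
  proof -
    have img: "range (exp :: real \<Rightarrow> real) = {0<..}" by (auto simp: image_iff) (metis exp_ln)
    have ai: "h absolutely_integrable_on {0<..}"
      using h hm unfolding set_integrable_def by (subst integrable_completion) auto
    have eq: "(LINT x:{0<..}|lborel. h x) = integral {0<..} h"
      using set_borel_integral_eq_integral(2)[OF h] .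
    have "(\<lambda>p. \<bar>exp p\<bar> * h (exp p)) absolutely_integrable_on UNIV \<and>
        integral UNIV (\<lambda>p. \<bar>exp p\<bar> * h (exp p)) = integral {0<..} h"
      by (subst has_absolute_integral_change_of_variables_1')
         (auto simp: img ai intro!: derivative_eq_intros inj_onI)
    hence ai': "(\<lambda>p. exp p * h (exp p)) absolutely_integrable_on UNIV"
      and eq': "integral UNIV (\<lambda>p. exp p * h (exp p)) = integral {0<..} h" by auto
    have i: "integrable lborel (\<lambda>p. exp p * h (exp p))"
      using ai' hm unfolding set_integrable_def by (subst (asm) integrable_completion) auto
    have "(LINT p|lborel. exp p * h (exp p)) = integral UNIV (\<lambda>p. exp p * h (exp p))"
      using integral_lborel[OF i] by simp
    with i eq eq' show ?thesis by simp
  qed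
  have "set_integrable lborel {0<..} (\<lambda>x. Re (f x))" "set_integrable lborel {0<..} (\<lambda>x. Im (f x))"
    using integrable_Re[OF f[unfolded set_integrable_def]] integrable_Im[OF f[unfolded set_integrable_def]]
    by (simp_all add: set_integrable_def)
  from real[OF this(1)] real[OF this(2)] m
  have R: "integrable lborel (\<lambda>p. exp p * Re (f (exp p)))"
      "(LINT p|lborel. exp p * Re (f (exp p))) = (LINT x:{0<..}|lborel. Re (f x))"
    and I: "integrable lborel (\<lambda>p. exp p * Im (f (exp p)))"
      "(LINT p|lborel. exp p * Im (f (exp p))) = (LINT x:{0<..}|lborel. Im (f x))"
    by auto
  have split: "(\<lambda>p. of_real (exp p) * f (exp p)) =
      (\<lambda>p. of_real (exp p * Re (f (exp p))) + \<i> * of_real (exp p * Im (f (exp p))))"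
    by (auto simp: fun_eq_iff complex_eq_iff)
  show *: "integrable lborel (\<lambda>p. of_real (exp p) * f (exp p))"
    unfolding split by (intro Bochner_Integration.integrable_add integrable_of_real R(1) I(1) integrable_mult_right)
  have "(LINT x:{0<..}|lborel. f x) =
      of_real (LINT x:{0<..}|lborel. Re (f x)) + \<i> * of_real (LINT x:{0<..}|lborel. Im (f x))"
    using integral_Re[OF f[unfolded set_integrable_def]] integral_Im[OF f[unfolded set_integrable_def]]
    by (simp add: set_lebesgue_integral_def complex_eq_iff)
  moreover have "(LINT p|lborel. of_real (exp p) * f (exp p)) =
      of_real (LINT p|lborel. exp p * Re (f (exp p))) + \<i> * of_real (LINT p|lborel. exp p * Im (f (exp p)))"
    using integral_Re[OF *] integral_Im[OF *] by (simp add: complex_eq_iff)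
  ultimately show "(LINT p|lborel. of_real (exp p) * f (exp p)) = (LINT x:{0<..}|lborel. f x)"
    using R(2) I(2) by simp
qed

lemma powr_of_real_exp: "x > 0 \<Longrightarrow> of_real x powr s = exp (s * of_real (ln x))" for s :: complex
  by (simp add: powr_def Ln_of_real)

lemma norm_powr_of_real: "x > 0 \<Longrightarrow> norm (of_real x powr s :: complex) = x powr Re s" for s :: complex
  by (simp add: powr_of_real_exp powr_def)

lemma Gamma_laplace_norm_integrable:
  fixes c y :: real
  assumes "c > 0" "y > 0"
  shows "integrable lborel (\<lambda>x. indicator {0<..} x * (x powr (c - 1) * exp (- (y * x))))"
proof -
  have "(\<lambda>t. complex_of_real t powr (of_real c - 1) / of_real (exp (y * t))) absolutely_integrable_on {0<..}"
    using assms by (intro absolutely_integrable_Gamma_integral) auto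
  hence "set_integrable lborel {0<..} (\<lambda>t. complex_of_real t powr (of_real c - 1) / of_real (exp (y * t)))"
    unfolding set_integrable_def
    by (subst (asm) integrable_completion)
       (auto intro!: borel_measurable_continuous_on_indicator continuous_intros)
  hence "integrable lborel (\<lambda>x. norm (indicator {0<..} x *\<^sub>R
            (complex_of_real x powr (of_real c - 1) / of_real (exp (y * x)))))"
    unfolding set_integrable_def by (rule integrable_norm)
  also have "(\<lambda>x. norm (indicator {0<..} x *\<^sub>R (complex_of_real x powr (of_real c - 1) / of_real (exp (y * x))))) =
      (\<lambda>x. indicator {0<..} x * (x powr (c - 1) * exp (- (y * x))))"
    by (auto simp: fun_eq_iff indicator_def norm_divide norm_powr_of_real exp_minus field_simps)
  finally show ?thesis .
qed

lemma Gamma_laplace_integrable: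
  fixes s z :: complex
  assumes "Re s > 0" "Re z > 0"
  shows "set_integrable lborel {0<..} (\<lambda>x. of_real x powr (s - 1) * exp (- z * of_real x))"
  unfolding set_integrable_def
proof (rule Bochner_Integration.integrable_bound[OF Gamma_laplace_norm_integrable[OF assms]])
  show "(\<lambda>x. indicator {0<..} x *\<^sub>R (of_real x powr (s - 1) * exp (- z * of_real x))) \<in> borel_measurable lborel"
    by measurable
qed (auto simp: norm_mult norm_powr_of_real indicator_def)

lemma Gamma_laplace_pos:
  assumes s: "Re s > 0" and y: "y > 0"
  shows "(LINT x:{0<..}|lborel. of_real x powr (s - 1) * exp (- of_real y * of_real x)) = Gamma s * of_real y powr (-s)"
proof -
  have one: "(LINT x:{0<..}|lborel. of_real x powr (s - 1) * exp (- of_real x)) = Gamma s"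
  proof -
    have i: "set_integrable lborel {0<..} (\<lambda>x. of_real x powr (s - 1) * exp (- complex_of_real x))"
      using Gamma_laplace_integrable[OF s, of 1] by simp
    have "((\<lambda>t. of_real t powr (s - 1) * exp (- complex_of_real t)) has_integral Gamma s) {0<..}"
      using Gamma_integral_complex'[OF s] by (simp add: exp_minus field_simps flip: exp_of_real)
    thus ?thesis using set_borel_integral_eq_integral(2)[OF i] by (simp add: integral_unique)
  qed
  have "(LINT x:{0<..}|lborel. of_real x powr (s - 1) * exp (- of_real y * of_real x)) =
      \<bar>1 / y\<bar> *\<^sub>R (LINT x|lborel. indicator {0<..} (0 + 1 / y * x) *\<^sub>R
         (of_real (0 + 1 / y * x) powr (s - 1) * exp (- of_real y * of_real (0 + 1 / y * x))))"
    unfolding set_lebesgue_integral_def using y by (intro lborel_integral_real_affine) auto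
  also have "(\<lambda>x. indicator {0<..} (0 + 1 / y * x) *\<^sub>R
         (complex_of_real (0 + 1 / y * x) powr (s - 1) * exp (- of_real y * of_real (0 + 1 / y * x)))) =
      (\<lambda>x. of_real y powr (1 - s) * (indicator {0<..} x *\<^sub>R (of_real x powr (s - 1) * exp (- of_real x))))"
  proof (rule ext)
    fix x :: real
    have "complex_of_real (x / y) powr (s - 1) = of_real y powr (1 - s) * of_real x powr (s - 1)" if "x > 0"
      using that y by (simp only: powr_of_real_exp divide_pos_pos ln_div flip: exp_add)
                      (simp add: algebra_simps)
    thus "indicator {0<..} (0 + 1 / y * x) *\<^sub>R
         (complex_of_real (0 + 1 / y * x) powr (s - 1) * exp (- of_real y * of_real (0 + 1 / y * x))) =
       of_real y powr (1 - s) * (indicator {0<..} x *\<^sub>R (of_real x powr (s - 1) * exp (- of_real x)))"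
      using y by (auto simp: indicator_def zero_less_divide_iff)
  qed
  also have "\<bar>1 / y\<bar> *\<^sub>R (LINT x|lborel. of_real y powr (1 - s) * (indicator {0<..} x *\<^sub>R (of_real x powr (s - 1) * exp (- complex_of_real x)))) =
      of_real y powr (1 - s) / of_real y * Gamma s"
    using y one by (simp add: set_lebesgue_integral_def scaleR_conv_of_real)
  also have "of_real y powr (1 - s) / of_real y = of_real y powr (- s)"
    using y by (simp add: powr_diff powr_minus field_simps)
  finally show ?thesis by (simp add: mult_ac)
qed

text \<open>
  For complex \<open>z\<close> the substitution \<open>x \<mapsto> x/z\<close> would rotate the path of integration. Instead, both sides are
  holomorphic on the right half-plane and agree on the positive real axis.
\<close>
lemma Gamma_laplace:
  fixes s z :: complex
  assumes s: "Re s > 0" and z: "Re z > 0"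
  shows "(LINT x:{0<..}|lborel. of_real x powr (s - 1) * exp (- z * of_real x)) = Gamma s * z powr (-s)"
proof -
  define S where "S = {z. Re z > 0}"
  define L where "L z = (LINT x:{0<..}|lborel. of_real x powr (s - 1) * exp (- z * of_real x))" for z
  have op: "open S" unfolding S_def by (rule open_halfspace_Re_gt)
  have conn: "connected S" unfolding S_def by (intro convex_connected convex_halfspace_Re_gt)
  have "L holomorphic_on S" unfolding L_def set_lebesgue_integral_def
  proof (rule holomorphic_on_parameter_integral[OF op])
    show "(\<lambda>z. indicat_real {0<..} x *\<^sub>R (of_real x powr (s - 1) * exp (- z * of_real x))) holomorphic_on S" for x
      unfolding scaleR_conv_of_real by (intro holomorphic_intros)
    show "(\<lambda>x. indicat_real {0<..} x *\<^sub>R (of_real x powr (s - 1) * exp (- z * of_real x))) \<in> borel_measurable lborel" for z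
      by measurable
    fix z0 assume z0: "z0 \<in> S"
    (* On the disc of half the distance to the imaginary axis the decay rate is at least r. *)
    define r where "r = Re z0 / 2"
    have r: "r > 0" using z0 by (simp add: r_def S_def)
    have Re: "Re w > r" if "w \<in> ball z0 r" for w
      using that abs_Re_le_cmod[of "z0 - w"] by (auto simp: r_def dist_norm)
    have "ball z0 r \<subseteq> S" using Re r by (force simp: S_def)
    moreover have "\<forall>w\<in>ball z0 r. \<forall>x\<in>space lborel. norm (indicat_real {0<..} x *\<^sub>R (of_real x powr (s - 1) * exp (- w * of_real x)))
        \<le> indicator {0<..} x * (x powr (Re s - 1) * exp (- (r * x)))"
      using Re by (auto simp: indicator_def norm_mult norm_powr_of_real intro!: mult_left_mono less_imp_le)
    ultimately show "\<exists>r>0. ball z0 r \<subseteq> S \<and> (\<exists>g. integrable lborel g \<and> (\<forall>w\<in>ball z0 r. \<forall>x\<in>space lborel.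
        norm (indicat_real {0<..} x *\<^sub>R (of_real x powr (s - 1) * exp (- w * of_real x))) \<le> g x))"
      using r Gamma_laplace_norm_integrable[OF s r] by blast
  qed
  moreover have "(\<lambda>z. Gamma s * z powr (-s)) holomorphic_on S"
    unfolding S_def by (intro holomorphic_intros) (auto elim!: nonpos_Reals_cases)
  ultimately have hol: "(\<lambda>z. L z - Gamma s * z powr (-s)) holomorphic_on S" by (rule holomorphic_on_diff)
  have lim: "(1::complex) islimpt complex_of_real ` {0<..}"
    unfolding islimpt_approachable
  proof (intro allI impI)
    fix e :: real assume "e > 0"
    hence "complex_of_real (1 + e / 2) \<noteq> 1" "dist (complex_of_real (1 + e / 2)) 1 < e"
      by (auto simp: dist_norm norm_divide)
    moreover have "complex_of_real (1 + e / 2) \<in> complex_of_real ` {0<..}"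
      using \<open>e > 0\<close> by (intro imageI) simp
    ultimately show "\<exists>x'\<in>complex_of_real ` {0<..}. x' \<noteq> 1 \<and> dist x' 1 < e" by blast
  qed
  have "L z - Gamma s * z powr (-s) = 0"
  proof (rule analytic_continuation[OF hol op conn _ _ lim])
    show "complex_of_real ` {0<..} \<subseteq> S" by (auto simp: S_def)
    show "1 \<in> S" "z \<in> S" using z by (auto simp: S_def)
    show "L w - Gamma s * w powr - s = 0" if "w \<in> complex_of_real ` {0<..}" for w
      using that Gamma_laplace_pos[OF s] by (auto simp: L_def)
  qed
  thus ?thesis by (simp add: L_def)
qed

text \<open>
  The Laplace integral of a power after \<open>x = e^p\<close>, the form in which it enters the Beta integral.
\<close>
lemma Gamma_exp_integral:
  fixes s :: complex and y :: real
  assumes s: "Re s > 0" and y: "y > 0"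
  shows "integrable lborel (\<lambda>p. exp (s * of_real p) * of_real (exp (- (y * exp p))))"
    and "(LINT p|lborel. exp (s * of_real p) * of_real (exp (- (y * exp p)))) = Gamma s * of_real y powr (-s)"
proof -
  have eq: "complex_of_real (exp p) * (of_real (exp p) powr (s - 1) * exp (- of_real y * of_real (exp p))) =
      exp (s * of_real p) * of_real (exp (- (y * exp p)))" for p
  proof -
    have "complex_of_real (exp p) powr (s - 1) = exp ((s - 1) * of_real p)"
      by (subst powr_of_real_exp) simp_all
    hence "complex_of_real (exp p) * of_real (exp p) powr (s - 1) = exp (s * of_real p)"
      by (simp add: algebra_simps exp_of_real[symmetric] flip: exp_add)
    thus ?thesis by (simp add: exp_of_real[symmetric])
  qed
  have i: "set_integrable lborel {0<..} (\<lambda>x. of_real x powr (s - 1) * exp (- of_real y * of_real x))"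
    using s y by (intro Gamma_laplace_integrable) auto
  have m: "(\<lambda>x. of_real x powr (s - 1) * exp (- of_real y * complex_of_real x)) \<in> borel_measurable borel"
    by measurable
  show "integrable lborel (\<lambda>p. exp (s * of_real p) * of_real (exp (- (y * exp p))))"
    using exp_substitution(1)[OF i m] unfolding eq .
  show "(LINT p|lborel. exp (s * of_real p) * of_real (exp (- (y * exp p)))) = Gamma s * of_real y powr (-s)"
    using exp_substitution(2)[OF i m] Gamma_laplace_pos[OF s y] unfolding eq by simp
qed

section \<open>The Beta kernel and Euler transforms of power series\<close>

lemma Re_pos_not_nonpos_Int: "Re z > 0 \<Longrightarrow> z \<notin> \<int>\<^sub>\<le>\<^sub>0"
  by (auto elim!: nonpos_Ints_cases)

lemma Gamma_nonzero_Re_pos: "Re z > 0 \<Longrightarrow> Gamma z \<noteq> (0 :: complex)"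
  by (simp add: Gamma_eq_zero_iff Re_pos_not_nonpos_Int)

definition logistic :: "real \<Rightarrow> real" where
  "logistic p = exp p / (1 + exp p)"

text \<open>
  With \<open>u = logistic p\<close> this is \<open>u^{a-1} (1-u)^{b-1} du/dp\<close>, the integrand of the Beta function pulled back
  to the real line. Writing it as one exponential makes the absolute value and the shift \<open>a \<mapsto> a + k\<close>
  immediate.
\<close>
definition beta_kernel :: "complex \<Rightarrow> complex \<Rightarrow> real \<Rightarrow> complex" where
  "beta_kernel a b p = exp (a * of_real p - (a + b) * of_real (ln (1 + exp p)))"

lemma logistic_bounds: "0 < logistic p" "logistic p < 1"
  by (auto simp: logistic_def field_simps add_pos_pos)

lemma beta_kernel_measurable [measurable]: "beta_kernel a b \<in> borel_measurable borel"
  unfolding beta_kernel_def by measurable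

lemma beta_kernel_logistic: "of_real (logistic p) ^ k * beta_kernel a b p = beta_kernel (a + of_nat k) b p"
proof -
  have "logistic p = exp (p - ln (1 + exp p))" by (simp add: logistic_def exp_diff add_pos_pos)
  hence "complex_of_real (logistic p) ^ k = exp (of_nat k * (of_real p - of_real (ln (1 + exp p))))"
    by (simp add: exp_of_nat_mult exp_of_real[symmetric])
  thus ?thesis by (simp add: beta_kernel_def algebra_simps flip: exp_add)
qed

lemma norm_beta_kernel: "norm (beta_kernel a b p) = Re (beta_kernel (of_real (Re a)) (of_real (Re b)) p)"
  by (simp add: beta_kernel_def Re_exp)

lemma beta_kernel_of_real: "beta_kernel (of_real a) (of_real b) p = of_real (exp (a * p - (a + b) * ln (1 + exp p)))"
  by (simp add: beta_kernel_def exp_of_real[symmetric])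

text \<open>
  The classical argument for \<open>\<Gamma>(a) \<Gamma>(b) = \<Gamma>(a+b) B(a,b)\<close>: the power \<open>(1+e^p)^{-(a+b)}\<close> is a Laplace
  integral in \<open>y\<close>, and after exchanging the order of integration the integral over \<open>p\<close> is again a Gamma
  integral. Integrating over \<open>p\<close> first also proves absolute integrability, which in turn yields the
  integrability of the kernel.
\<close>
lemma beta_kernel_integral:
  assumes a: "Re a > 0" and b: "Re b > 0"
  shows "integrable lborel (beta_kernel a b)"
    and "(LINT p|lborel. beta_kernel a b p) = Beta a b"
proof -
  (* Gamma (a + b) times the kernel at p is the integral of F over y. *)
  define F where "F = (\<lambda>(y, p). exp (a * of_real p) * of_real (exp (- (y * exp p))) *
      (indicator {0<..} y *\<^sub>R (of_real y powr (a + b - 1) * exp (- complex_of_real y))))"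
  have Fm[measurable]: "F \<in> borel_measurable (lborel \<Otimes>\<^sub>M lborel)" unfolding F_def by measurable
  have inner_p: "(LINT p|lborel. F (y, p)) = Gamma a * (indicator {0<..} y *\<^sub>R (of_real y powr (b - 1) * exp (- 1 * complex_of_real y)))"
    if "Re a > 0" for y
  proof (cases "y > 0")
    case True
    have "complex_of_real y powr (- a) * complex_of_real y powr (a + b - 1) = complex_of_real y powr (b - 1)"
      using True by (simp add: powr_of_real_exp algebra_simps flip: exp_add)
    moreover have "(LINT p|lborel. F (y, p)) = (Gamma a * of_real y powr (- a)) *
        (indicator {0<..} y *\<^sub>R (of_real y powr (a + b - 1) * exp (- complex_of_real y)))"
      by (simp only: F_def prod.case integral_mult_left_zero Gamma_exp_integral(2)[OF that True])
    ultimately show ?thesis using True by simp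
  qed (simp add: F_def)
  have norm_F: "norm (F (y, p)) = norm (exp (complex_of_real (Re a) * of_real p) * of_real (exp (- (y * exp p)))) *
      (indicator {0<..} y *\<^sub>R (y powr (Re a + Re b - 1) * exp (- y)))" for y p
    by (auto simp: F_def norm_mult norm_powr_of_real indicator_def)
  have integ: "integrable (lborel \<Otimes>\<^sub>M lborel) F"
  proof (rule lborel_pair.Fubini_integrable[OF Fm])
    have "(\<lambda>y. LINT p|lborel. norm (F (y, p))) = (\<lambda>y. Gamma (Re a) * (indicator {0<..} y * (y powr (Re b - 1) * exp (- (1 * y)))))"
    proof
      fix y :: real
      show "(LINT p|lborel. norm (F (y, p))) = Gamma (Re a) * (indicator {0<..} y * (y powr (Re b - 1) * exp (- (1 * y))))"
      proof (cases "y > 0")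
        case True
        have "complex_of_real (LINT p|lborel. exp (Re a * p) * exp (- (y * exp p))) =
            (LINT p|lborel. exp (of_real (Re a) * of_real p) * of_real (exp (- (y * exp p))))"
          by (simp add: exp_of_real[symmetric] flip: integral_complex_of_real)
        also have "\<dots> = of_real (Gamma (Re a) * y powr (- Re a))"
          using Gamma_exp_integral(2)[of "of_real (Re a)" y] a True powr_of_real[of y "- Re a"]
            by (simp add: Gamma_complex_of_real)
        finally have "(LINT p|lborel. exp (Re a * p) * exp (- (y * exp p))) = Gamma (Re a) * y powr (- Re a)"
          by (simp only: of_real_eq_iff)
        moreover have "y powr (- Re a) * y powr (Re a + Re b - 1) = y powr (Re b - 1)"
          using True by (simp flip: powr_add)
        moreover have "norm (F (y, p)) = (exp (Re a * p) * exp (- (y * exp p))) * (y powr (Re a + Re b - 1) * exp (- y))" for p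
          unfolding norm_F using True by (simp add: norm_mult)
        ultimately show ?thesis using True
          by (simp only: integral_mult_left_zero) simp
      qed (simp add: norm_F)
    qed
    thus "integrable lborel (\<lambda>y. LINT p|lborel. norm (F (y, p)))"
      using Gamma_laplace_norm_integrable[OF b, of 1] by simp
    show "AE y in lborel. integrable lborel (\<lambda>p. F (y, p))"
    proof (rule AE_I2)
      fix y :: real
      show "integrable lborel (\<lambda>p. F (y, p))"
        by (cases "y > 0") (use Gamma_exp_integral(1)[OF a] in \<open>auto simp: F_def\<close>)
    qed
  qed
  have inner_y: "(LINT y|lborel. F (y, p)) = Gamma (a + b) * beta_kernel a b p" for p
  proof -
    have pos: "1 + exp p > 0" by (simp add: add_pos_pos)
    have "(LINT y|lborel. F (y, p)) =
        (LINT y|lborel. exp (a * of_real p) * (indicator {0<..} y *\<^sub>R (of_real y powr ((a + b) - 1) * exp (- of_real (1 + exp p) * complex_of_real y))))"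
      by (intro Bochner_Integration.integral_cong refl)
         (auto simp: F_def indicator_def algebra_simps exp_of_real[symmetric] simp flip: exp_add)
    also have "\<dots> = exp (a * of_real p) * (Gamma (a + b) * of_real (1 + exp p) powr (- (a + b)))"
      unfolding integral_mult_right_zero set_lebesgue_integral_def[symmetric]
      using Gamma_laplace_pos[of "a + b" "1 + exp p"] a b pos by simp
    also have "of_real (1 + exp p) powr (- (a + b)) = exp (- (a + b) * of_real (ln (1 + exp p)))"
      using pos by (rule powr_of_real_exp)
    also have "exp (a * of_real p) * (Gamma (a + b) * exp (- (a + b) * of_real (ln (1 + exp p)))) = Gamma (a + b) * beta_kernel a b p"
      unfolding beta_kernel_def diff_conv_add_uminus exp_add minus_mult_left by (simp only: mult_ac)
    finally show ?thesis .
  qed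
  have nz: "Gamma (a + b) \<noteq> 0" using a b by (intro Gamma_nonzero_Re_pos) simp
  have "integrable lborel (\<lambda>p. LINT y|lborel. F (y, p))"
    using lborel_pair.integrable_snd[of "\<lambda>x y. F (x, y)"] integ by simp
  hence "integrable lborel (\<lambda>p. Gamma (a + b) * beta_kernel a b p / Gamma (a + b))"
    unfolding inner_y by (rule integrable_divide_zero) 
  thus *: "integrable lborel (beta_kernel a b)" using nz by simp
  have "(LINT p|lborel. LINT y|lborel. F (y, p)) = (LINT y|lborel. LINT p|lborel. F (y, p))"
    using lborel_pair.Fubini_integral[of "\<lambda>x y. F (x, y)"] integ by simp
  hence "Gamma (a + b) * (LINT p|lborel. beta_kernel a b p) = Gamma a * Gamma b"
    unfolding inner_y inner_p[OF a] integral_mult_right_zero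
    using Gamma_laplace_pos[OF b, of 1] by (simp add: set_lebesgue_integral_def)
  thus "(LINT p|lborel. beta_kernel a b p) = Beta a b" using nz by (simp add: Beta_def field_simps)
qed

lemma Beta_shift_pochhammer:
  fixes a b :: complex
  assumes a: "Re a > 0" and b: "Re b > 0"
  shows "Beta (a + of_nat k) b = Beta a b * (pochhammer a k / pochhammer (a + b) k)"
proof -
  have "a \<notin> \<int>\<^sub>\<le>\<^sub>0" "a + b \<notin> \<int>\<^sub>\<le>\<^sub>0" "a + b + of_nat k \<notin> \<int>\<^sub>\<le>\<^sub>0" using a b by (auto intro!: Re_pos_not_nonpos_Int)
  thus ?thesis by (simp add: Beta_def pochhammer_Gamma Gamma_eq_zero_iff field_simps)
qed

text \<open>
  Since \<open>u^k\<close> shifts the first parameter of the kernel, integrating a power series in \<open>u\<close> against it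
  multiplies the \<open>k\<close>-th coefficient by \<open>(a)_k/(a+b)_k\<close>, up to the constant \<open>B(a,b)\<close>.
\<close>
lemma euler_transform_series:
  assumes a: "Re a > 0" and b: "Re b > 0" and c: "summable (\<lambda>k. norm (c k))"
  shows "integrable lborel (\<lambda>p. (\<Sum>k. c k * of_real (logistic p) ^ k) * beta_kernel a b p)"
    and "(\<lambda>k. c k * (pochhammer a k / pochhammer (a + b) k) * Beta a b) sums
           (LINT p|lborel. (\<Sum>k. c k * of_real (logistic p) ^ k) * beta_kernel a b p)"
proof -
  define f where "f k p = c k * beta_kernel (a + of_nat k) b p" for k p
  have f: "f k p = c k * of_real (logistic p) ^ k * beta_kernel a b p" for k p
    by (simp add: f_def beta_kernel_logistic[symmetric] mult_ac)
  have lk: "logistic p ^ k \<le> 1" for p k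
    using logistic_bounds[of p] by (intro power_le_one) auto
  have nf: "norm (f k p) \<le> norm (c k) * norm (beta_kernel a b p)" for k p
    using logistic_bounds[of p] lk[of p k] unfolding f
    by (auto simp: norm_mult norm_power intro!: mult_right_mono mult_left_le)
  have sumf: "summable (\<lambda>k. norm (f k p))" for p
    by (rule summable_comparison_test'[OF summable_mult2[OF c, of "norm (beta_kernel a b p)"]]) (use nf in auto)
  have sumc: "summable (\<lambda>k. c k * of_real (logistic p) ^ k)" for p
  proof (rule summable_norm_cancel, rule summable_comparison_test'[OF c])
    fix k show "norm (norm (c k * of_real (logistic p) ^ k)) \<le> norm (c k)"
      using logistic_bounds[of p] lk[of p k] by (auto simp: norm_mult norm_power intro!: mult_left_le)
  qed
  have eq: "(\<Sum>k. f k p) = (\<Sum>k. c k * of_real (logistic p) ^ k) * beta_kernel a b p" for p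
    unfolding f using sumc by (rule suminf_mult2[symmetric])
  have fi: "integrable lborel (f k)" for k
    unfolding f_def using a b by (intro integrable_mult_right beta_kernel_integral) auto
  have "summable (\<lambda>k. LINT p|lborel. norm (f k p))"
  proof (rule summable_comparison_test'[OF summable_mult2[OF c, of "LINT p|lborel. norm (beta_kernel a b p)"]])
    fix k
    have "(LINT p|lborel. norm (f k p)) \<le> (LINT p|lborel. norm (c k) * norm (beta_kernel a b p))"
      using fi beta_kernel_integral(1)[OF a b] nf by (intro integral_mono) auto
    thus "norm (LINT p|lborel. norm (f k p)) \<le> norm (c k) * (LINT p|lborel. norm (beta_kernel a b p))"
      by simp
  qed
  note * = integrable_suminf[OF fi _ this] sums_integral[OF fi _ this]
  show "integrable lborel (\<lambda>p. (\<Sum>k. c k * of_real (logistic p) ^ k) * beta_kernel a b p)"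
    using *(1) sumf by (simp add: eq)
  have "(LINT p|lborel. f k p) = c k * (pochhammer a k / pochhammer (a + b) k) * Beta a b" for k
    using a b by (simp add: f_def beta_kernel_integral Beta_shift_pochhammer)
  thus "(\<lambda>k. c k * (pochhammer a k / pochhammer (a + b) k) * Beta a b) sums
           (LINT p|lborel. (\<Sum>k. c k * of_real (logistic p) ^ k) * beta_kernel a b p)"
    using *(2) sumf by (simp add: eq)
qed

lemma beta_nonzero: "Re a > 0 \<Longrightarrow> Re b > 0 \<Longrightarrow> Beta a b \<noteq> (0::complex)"
  by (simp add: Beta_def Gamma_nonzero_Re_pos)

lemma cut_plane_scale: "z \<in> cut_plane \<Longrightarrow> 0 \<le> u \<Longrightarrow> u \<le> 1 \<Longrightarrow> z * of_real u \<in> cut_plane"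
proof (rule ccontr)
  assume z: "z \<in> cut_plane" and u: "0 \<le> u" "u \<le> 1" and "z * of_real u \<notin> cut_plane"
  then obtain r where r: "r \<ge> 1" "z * of_real u = of_real r" by (auto simp: cut_plane_def)
  have "u \<noteq> 0" using r by auto
  hence "z = of_real (r / u)" and "r / u \<in> {1..}" using u r by (auto simp: field_simps)
  thus False using z unfolding cut_plane_def by blast
qed

text \<open>
  The cut plane is star-shaped about \<open>0\<close>, so \<open>F(z u)\<close> makes sense for all \<open>z\<close> in it and \<open>0 < u < 1\<close>. Each
  application therefore adds one pair of hypergeometric parameters \<open>a; a+b\<close> while preserving
  holomorphy on the whole cut plane.
\<close>
lemma euler_transform_continuation:
  assumes F: "F holomorphic_on cut_plane" and series: "\<And>z. norm z < 1 \<Longrightarrow> (\<lambda>k. c k * z ^ k) sums F z"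
    and a: "Re a > 0" and b: "Re b > 0"
  shows "\<exists>G. G holomorphic_on cut_plane \<and>
           (\<forall>z. norm z < 1 \<longrightarrow> (\<lambda>k. c k * (pochhammer a k / pochhammer (a + b) k) * z ^ k) sums G z)"
proof (intro exI conjI allI impI)
  define G where "G z = (LINT p|lborel. F (z * of_real (logistic p)) * beta_kernel a b p) / Beta a b" for z
  have contF: "continuous_on cut_plane F" using F by (rule holomorphic_on_imp_continuous_on)
  have "(\<lambda>z. LINT p|lborel. F (z * of_real (logistic p)) * beta_kernel a b p) holomorphic_on cut_plane"
  proof (rule holomorphic_on_parameter_integral[OF open_cut_plane])
    show "(\<lambda>z. F (z * of_real (logistic p)) * beta_kernel a b p) holomorphic_on cut_plane" for p
      using logistic_bounds[of p]
      by (intro holomorphic_intros holomorphic_on_compose_gen[OF _ F, unfolded o_def])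
         (auto intro!: cut_plane_scale)
    show "(\<lambda>p. F (z * of_real (logistic p)) * beta_kernel a b p) \<in> borel_measurable lborel" if z: "z \<in> cut_plane" for z
    proof -
      have "continuous_on UNIV (\<lambda>p. F (z * of_real (logistic p)))"
      proof (rule continuous_on_compose2[OF contF])
        have nz: "1 + exp p \<noteq> (0::real)" for p using exp_gt_zero[of p] by linarith
        show "continuous_on UNIV (\<lambda>p. z * of_real (logistic p))"
          unfolding logistic_def by (intro continuous_intros ballI nz)
        show "(\<lambda>p. z * of_real (logistic p)) ` UNIV \<subseteq> cut_plane"
          using cut_plane_scale[OF z] logistic_bounds by (auto simp: less_imp_le)
      qed
      hence "(\<lambda>p. F (z * of_real (logistic p))) \<in> borel_measurable lborel"
        using borel_measurable_continuous_onI by simp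
      thus ?thesis by measurable
    qed
    fix z assume z: "z \<in> cut_plane"
    obtain r where r: "r > 0" "cball z r \<subseteq> cut_plane" using open_cut_plane z open_contains_cball by blast
    (* The values w u for w near z fill a compact subset of the cut plane, on which F is bounded. *)
    define T where "T = (\<lambda>(w, u). w * complex_of_real u) ` (cball z r \<times> {0..1})"
    have "compact T" unfolding T_def
      by (intro compact_continuous_image compact_Times) (auto intro!: continuous_intros simp: case_prod_unfold)
    moreover have "T \<subseteq> cut_plane" using r(2) by (auto simp: T_def intro!: cut_plane_scale)
    ultimately have "compact (F ` T)" by (intro compact_continuous_image continuous_on_subset[OF contF])
    then obtain C where C: "\<And>w. w \<in> T \<Longrightarrow> norm (F w) \<le> C"
      by (meson bounded_iff compact_imp_bounded imageI)
    have "norm (F (w * of_real (logistic p)) * beta_kernel a b p) \<le> C * norm (beta_kernel a b p)"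
      if "w \<in> ball z r" for w p
    proof -
      have "w * of_real (logistic p) \<in> T"
        using that logistic_bounds[of p] unfolding T_def by (intro image_eqI[of _ _ "(w, logistic p)"]) auto
      thus ?thesis by (auto simp: norm_mult intro!: mult_right_mono C)
    qed
    moreover have "integrable lborel (\<lambda>p. C * norm (beta_kernel a b p))"
      using beta_kernel_integral(1)[OF a b] by auto
    moreover have "ball z r \<subseteq> cut_plane" using r(2) by auto
    ultimately show "\<exists>r>0. ball z r \<subseteq> cut_plane \<and> (\<exists>g. integrable lborel g \<and>
        (\<forall>w\<in>ball z r. \<forall>p\<in>space lborel. norm (F (w * of_real (logistic p)) * beta_kernel a b p) \<le> g p))"
      using r(1) by blast
  qed
  thus "G holomorphic_on cut_plane"
    unfolding G_def using beta_nonzero[OF a b] by (intro holomorphic_intros) auto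
  fix z :: complex assume z: "norm z < 1"
  have sm: "summable (\<lambda>k. norm (c k * z ^ k))"
  proof -
    (* Convergence at a point of larger modulus gives absolute convergence at z. *)
    obtain r where r: "norm z < r" "r < 1" using z dense by blast
    have "0 < r" using r(1) norm_ge_zero[of z] by linarith
    hence "summable (\<lambda>k. c k * of_real r ^ k)" using series[of "of_real r"] r by (auto simp: sums_iff)
    thus ?thesis using r \<open>0 < r\<close> by (intro powser_insidea) auto
  qed
  have "(\<Sum>k. c k * z ^ k * of_real (logistic p) ^ k) = F (z * of_real (logistic p))" for p
  proof -
    have "norm z * logistic p \<le> norm z" using logistic_bounds[of p] by (intro mult_left_le) auto
    hence "norm (z * of_real (logistic p)) < 1"
      using z logistic_bounds[of p] by (simp add: norm_mult)
    from series[OF this] show ?thesis by (simp add: sums_iff power_mult_distrib mult_ac)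
  qed
  with euler_transform_series(2)[OF a b sm]
  have "(\<lambda>k. c k * z ^ k * (pochhammer a k / pochhammer (a + b) k) * Beta a b) sums (G z * Beta a b)"
    using beta_nonzero[OF a b] by (simp add: G_def)
  from sums_divide[OF this, of "Beta a b"]
  show "(\<lambda>k. c k * (pochhammer a k / pochhammer (a + b) k) * z ^ k) sums G z"
    using beta_nonzero[OF a b] by (simp add: mult_ac)
qed

section \<open>Continuation of the two hypergeometric series to the cut plane\<close>

lemma one_minus_powr_continuation:
  "\<exists>F. F holomorphic_on cut_plane \<and>
     (\<forall>z. norm z < 1 \<longrightarrow> (\<lambda>k. pochhammer c k / fact k * z ^ k) sums F z)"
proof (intro exI conjI allI impI)
  show "(\<lambda>z. (1 - z) powr (- c)) holomorphic_on cut_plane"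
  proof (intro holomorphic_intros)
    fix z assume "z \<in> cut_plane"
    show "1 - z \<notin> \<real>\<^sub>\<le>\<^sub>0"
    proof
      assume "1 - z \<in> \<real>\<^sub>\<le>\<^sub>0"
      then obtain r where r: "1 - z = of_real r" "r \<le> 0" by (auto elim!: nonpos_Reals_cases)
      hence "z = of_real (1 - r)" by (simp add: algebra_simps)
      with r(2) have "z \<in> complex_of_real ` {1..}" by (intro image_eqI[of _ _ "1 - r"]) auto
      with \<open>z \<in> cut_plane\<close> show False by (simp add: cut_plane_def)
    qed
  qed
  fix z :: complex assume "norm z < 1"
  hence "(\<lambda>k. (- c gchoose k) * (- z) ^ k) sums (1 + - z) powr (- c)"
    by (intro gen_binomial_complex) simp
  moreover have "(- c gchoose k) * (- z) ^ k = pochhammer c k / fact k * z ^ k" for k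
  proof -
    have "(- c gchoose k) * (- z) ^ k = ((-1) ^ k * (-1) ^ k) * (pochhammer c k / fact k * z ^ k)"
      by (subst power_minus) (simp add: gbinomial_pochhammer)
    also have "(-1) ^ k * (-1) ^ k = (1 :: complex)" by (simp flip: power_mult_distrib)
    finally show ?thesis by simp
  qed
  ultimately show "(\<lambda>k. pochhammer c k / fact k * z ^ k) sums (1 - z) powr (- c)" by simp
qed

text \<open>
  The function \<open>hypergeom\<close> selects the continuation by a definite description, so an explicit continuation
  has to be exhibited before anything can be said about its values.
\<close>
lemma hypergeom_of_continuation:
  assumes "\<exists>F. F holomorphic_on cut_plane \<and> (\<forall>z. norm z < 1 \<longrightarrow> (\<lambda>k. c k * z ^ k) sums F z)"
    and c: "\<And>k. fps_nth (fps_hypergeo as bs 1) k = c k"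
  shows "hypergeom as bs holomorphic_on cut_plane"
    and "\<And>z. norm z < 1 \<Longrightarrow> (\<lambda>k. c k * z ^ k) sums hypergeom as bs z"
proof -
  obtain F where F: "F holomorphic_on cut_plane" "\<And>z. norm z < 1 \<Longrightarrow> (\<lambda>k. c k * z ^ k) sums F z"
    using assms(1) by blast
  have eq: "hypergeom as bs z = F z" if "z \<in> cut_plane" for z
  proof (rule hypergeom_eqI[OF F(1) _ that])
    fix w :: complex assume "norm w < 1"
    from F(2)[OF this] show "F w = eval_fps (fps_hypergeo as bs 1) w"
      unfolding eval_fps_def c by (simp add: sums_iff)
  qed
  show "hypergeom as bs holomorphic_on cut_plane"
    using F(1) eq by (simp cong: holomorphic_cong)
  show "(\<lambda>k. c k * z ^ k) sums hypergeom as bs z" if "norm z < 1" for z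
    using F(2)[OF that] eq[of z] that ball_subset_cut_plane by auto
qed

definition coeff_4F3 :: "complex \<Rightarrow> nat \<Rightarrow> complex" where
  "coeff_4F3 \<alpha> k = pochhammer (\<alpha> + 1/2) k * pochhammer (2 * \<alpha> + 1/2) k * pochhammer (\<alpha> + 1/2) k * pochhammer (1/2) k
     / (pochhammer (\<alpha> + 1) k * pochhammer (2 * \<alpha> + 1) k * pochhammer (\<alpha> + 1) k * fact k)"

abbreviation (input) hypergeom_4F3 :: "complex \<Rightarrow> complex \<Rightarrow> complex" where
  "hypergeom_4F3 \<alpha> \<equiv> hypergeom [\<alpha> + 1/2, 2 * \<alpha> + 1/2, \<alpha> + 1/2, 1/2] [\<alpha> + 1, 2 * \<alpha> + 1, \<alpha> + 1]"

abbreviation (input) hypergeom_2F1 :: "complex \<Rightarrow> complex \<Rightarrow> complex" where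
  "hypergeom_2F1 \<alpha> \<equiv> hypergeom [\<alpha> + 1/2, 1] [\<alpha> + 3/2]"

lemma nth_4F3: "fps_nth (fps_hypergeo [\<alpha> + 1/2, 2 * \<alpha> + 1/2, \<alpha> + 1/2, 1/2] [\<alpha> + 1, 2 * \<alpha> + 1, \<alpha> + 1] 1) k = coeff_4F3 \<alpha> k"
  by (simp add: coeff_4F3_def)

text \<open>
  The upper and lower parameters pair up with difference \<open>1/2\<close>: the 4F3 is obtained from
  \<open>(1-z)^{-1/2}\<close> by three Euler transforms. The condition on \<open>\<alpha>\<close> makes \<open>Re (2\<alpha> + 1/2)\<close> positive.
\<close>
lemma hypergeom_4F3:
  assumes \<alpha>: "Re \<alpha> > -1/4"
  shows "hypergeom_4F3 \<alpha> holomorphic_on cut_plane"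
    and "\<And>z. norm z < 1 \<Longrightarrow> (\<lambda>k. coeff_4F3 \<alpha> k * z ^ k) sums hypergeom_4F3 \<alpha> z"
proof -
  let ?P = "\<lambda>c. \<exists>F. F holomorphic_on cut_plane \<and> (\<forall>z. norm z < 1 \<longrightarrow> (\<lambda>k. c k * z ^ k) sums F z)"
  have step: "?P (\<lambda>k. c k * (pochhammer u k / pochhammer (u + 1/2) k))" if "?P c" "Re u > 0" for c u
    using that euler_transform_continuation[of _ c u "1/2"] by fastforce
  have "?P (\<lambda>k. pochhammer (1/2) k / fact k)"
    by (rule one_minus_powr_continuation)
  from step[OF step[OF step[OF this, of "\<alpha> + 1/2"], of "2 * \<alpha> + 1/2"], of "\<alpha> + 1/2"] \<alpha>
  have "?P (\<lambda>k. pochhammer (1/2) k / fact k * (pochhammer (\<alpha> + 1/2) k / pochhammer (\<alpha> + 1/2 + 1/2) k) *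
     (pochhammer (2 * \<alpha> + 1/2) k / pochhammer (2 * \<alpha> + 1/2 + 1/2) k) * (pochhammer (\<alpha> + 1/2) k / pochhammer (\<alpha> + 1/2 + 1/2) k))"
    by simp
  also have "(\<lambda>k. pochhammer (1/2) k / fact k * (pochhammer (\<alpha> + 1/2) k / pochhammer (\<alpha> + 1/2 + 1/2) k) *
     (pochhammer (2 * \<alpha> + 1/2) k / pochhammer (2 * \<alpha> + 1/2 + 1/2) k) * (pochhammer (\<alpha> + 1/2) k / pochhammer (\<alpha> + 1/2 + 1/2) k)) = coeff_4F3 \<alpha>"
    by (simp add: fun_eq_iff coeff_4F3_def add.assoc mult_ac)
  finally have P: "?P (coeff_4F3 \<alpha>)" .
  show "hypergeom_4F3 \<alpha> holomorphic_on cut_plane"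
    by (rule hypergeom_of_continuation(1)[OF P nth_4F3])
  show "(\<lambda>k. coeff_4F3 \<alpha> k * z ^ k) sums hypergeom_4F3 \<alpha> z" if "norm z < 1" for z
    by (rule hypergeom_of_continuation(2)[OF P nth_4F3 that])
qed

lemma pochhammer_shift_ratio:
  fixes u :: complex
  assumes u: "Re u > 0"
  shows "pochhammer u k / pochhammer (u + 1) k = u / (u + of_nat k)"
proof -
  have "pochhammer (u + 1) k \<noteq> 0"
  proof
    assume "pochhammer (u + 1) k = 0"
    then obtain j where "u + 1 = - of_nat j" unfolding pochhammer_eq_0_iff by blast
    hence "Re (u + 1) = Re (- of_nat j)" by (rule arg_cong)
    thus False using u by simp
  qed
  moreover have "Re (u + of_nat k) \<noteq> 0" using u by simp
  hence "u + of_nat k \<noteq> 0" by fastforce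
  moreover have "u * pochhammer (u + 1) k = (u + of_nat k) * pochhammer u k"
    using pochhammer_rec[of u k] pochhammer_rec'[of u k] by simp
  ultimately show ?thesis by (simp add: frac_eq_eq mult_ac)
qed

text \<open>
  One Euler transform of the geometric series \<open>1/(1-z)\<close>.
\<close>
lemma hypergeom_2F1:
  assumes \<alpha>: "Re \<alpha> > -1/2"
  shows "hypergeom_2F1 \<alpha> holomorphic_on cut_plane"
    and "\<And>z. norm z < 1 \<Longrightarrow> (\<lambda>k. (\<alpha> + 1/2) / (\<alpha> + 1/2 + of_nat k) * z ^ k) sums hypergeom_2F1 \<alpha> z"
proof -
  let ?P = "\<lambda>c. \<exists>F. F holomorphic_on cut_plane \<and> (\<forall>z. norm z < 1 \<longrightarrow> (\<lambda>k. c k * z ^ k) sums F z)"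
  obtain F where F: "F holomorphic_on cut_plane" "\<And>z. norm z < 1 \<Longrightarrow> (\<lambda>k. pochhammer 1 k / fact k * z ^ k) sums F z"
    using one_minus_powr_continuation by blast
  have P: "?P (\<lambda>k. pochhammer 1 k / fact k * (pochhammer (\<alpha> + 1/2) k / pochhammer (\<alpha> + 1/2 + 1) k))"
    by (rule euler_transform_continuation[OF F]) (use \<alpha> in auto)
  have nth: "fps_nth (fps_hypergeo [\<alpha> + 1/2, 1] [\<alpha> + 3/2] 1) k =
      pochhammer 1 k / fact k * (pochhammer (\<alpha> + 1/2) k / pochhammer (\<alpha> + 1/2 + 1) k)" for k
    by (simp add: add.assoc mult_ac)
  show "hypergeom_2F1 \<alpha> holomorphic_on cut_plane"
    by (rule hypergeom_of_continuation(1)[OF P nth])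
  have eq: "pochhammer 1 k / fact k * (pochhammer (\<alpha> + 1/2) k / pochhammer (\<alpha> + 1/2 + 1) k) = (\<alpha> + 1/2) / (\<alpha> + 1/2 + of_nat k)" for k
    using pochhammer_shift_ratio[of "\<alpha> + 1/2" k] \<alpha> by (simp flip: pochhammer_fact)
  show "(\<lambda>k. (\<alpha> + 1/2) / (\<alpha> + 1/2 + of_nat k) * z ^ k) sums hypergeom_2F1 \<alpha> z" if "norm z < 1" for z
    using hypergeom_of_continuation(2)[OF P nth that] unfolding eq .
qed

text \<open>
  Gauss's product for \<open>1/\<Gamma>\<close> says that \<open>(u)_{n+1}\<close> grows like \<open>n! n^u / \<Gamma>(u)\<close>; in the quotient only
  \<open>n^{-1/2}\<close> survives.
\<close>
lemma pochhammer_ratio_asymptotics: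
  fixes u :: complex
  assumes "Re u > 0"
  shows "(\<lambda>n. of_real (sqrt n) * (pochhammer u (n + 1) / pochhammer (u + 1/2) (n + 1)))
           \<longlonglongrightarrow> rGamma u / rGamma (u + 1/2)"
proof -
  have "rGamma (u + 1/2) \<noteq> 0" using assms by (simp add: rGamma_eq_zero_iff Re_pos_not_nonpos_Int)
  hence "(\<lambda>n. rGamma_series u n / rGamma_series (u + 1/2) n) \<longlonglongrightarrow> rGamma u / rGamma (u + 1/2)"
    by (intro tendsto_divide rGamma_series_LIMSEQ)
  moreover have "\<forall>\<^sub>F n in sequentially. rGamma_series u n / rGamma_series (u + 1/2) n =
      of_real (sqrt n) * (pochhammer u (n + 1) / pochhammer (u + 1/2) (n + 1))"
    using eventually_gt_at_top[of 0]
  proof eventually_elim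
    case (elim n)
    have "exp ((u + 1/2) * of_real (ln n)) = exp (u * of_real (ln n)) * of_real (exp (ln n / 2))"
      by (simp add: algebra_simps exp_of_real[symmetric] flip: exp_add)
    also have "exp (ln n / 2) = sqrt n" using elim by (simp add: powr_half_sqrt[symmetric] powr_def)
    finally show ?case by (simp add: rGamma_series_def)
  qed
  ultimately show ?thesis by (rule Lim_transform_eventually)
qed

text \<open>
  A coefficient is a product of four Pochhammer quotients, each of order \<open>k^{-1/2}\<close>, hence is \<open>O(k^{-2})\<close>.
\<close>
lemma summable_coeff_4F3:
  assumes \<alpha>: "Re \<alpha> > -1/4"
  shows "summable (\<lambda>k. norm (coeff_4F3 \<alpha> k))"
proof -
  (* Scaled by sqrt n, each of the four quotients converges; the fourth is the one with u = 1/2. *)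
  define q where "q u n = of_real (sqrt n) * (pochhammer u (n + 1) / pochhammer (u + 1/2) (n + 1))" for u :: complex and n
  have lim: "convergent (q u)" if "Re u > 0" for u
    using pochhammer_ratio_asymptotics[OF that] unfolding q_def convergent_def by blast
  have "convergent (\<lambda>n. q (\<alpha> + 1/2) n * q (2 * \<alpha> + 1/2) n * q (\<alpha> + 1/2) n * q (1/2) n)"
    by (intro convergent_mult lim) (use \<alpha> in auto)
  hence "Bseq (\<lambda>n. q (\<alpha> + 1/2) n * q (2 * \<alpha> + 1/2) n * q (\<alpha> + 1/2) n * q (1/2) n)"
    by (rule convergent_imp_Bseq)
  moreover have "q (\<alpha> + 1/2) n * q (2 * \<alpha> + 1/2) n * q (\<alpha> + 1/2) n * q (1/2) n = of_nat n ^ 2 * coeff_4F3 \<alpha> (n + 1)" for n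
  proof -
    have "complex_of_real (sqrt n) ^ 4 = of_nat n ^ 2"
      by (simp add: power4_eq_xxxx power2_eq_square flip: of_real_mult)
    thus ?thesis
      by (simp add: q_def coeff_4F3_def add.assoc pochhammer_fact[symmetric] power4_eq_xxxx mult_ac)
  qed
  ultimately obtain C where C: "\<And>n. norm (of_nat n ^ 2 * coeff_4F3 \<alpha> (n + 1)) \<le> C"
    by (auto simp: Bseq_def)
  have "summable (\<lambda>n. norm (coeff_4F3 \<alpha> (n + 1)))"
  proof (rule summable_comparison_test_ev)
    show "summable (\<lambda>n. C * inverse (real n ^ 2))"
      by (intro summable_mult inverse_power_summable) simp
    show "\<forall>\<^sub>F n in sequentially. norm (norm (coeff_4F3 \<alpha> (n + 1))) \<le> C * inverse (real n ^ 2)"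
      using eventually_gt_at_top[of 0]
    proof eventually_elim
      case (elim n)
      show ?case using C[of n] elim by (simp add: norm_mult norm_power field_simps)
    qed
  qed
  thus ?thesis by (subst summable_iff_shift[symmetric, of _ 1])
qed

lemma hypergeom_4F3_at_1:
  "hypergeom_4F3 \<alpha> 1 = (\<Sum>k. coeff_4F3 \<alpha> k)"
proof -
  have "1 \<notin> cut_plane" unfolding cut_plane_def by (auto intro!: image_eqI[of _ _ 1])
  thus ?thesis by (simp only: hypergeom_def if_False eval_fps_def nth_4F3) simp
qed

text \<open>
  The point \<open>1\<close> lies on the cut, so continuity there is not part of holomorphy. It holds radially since
  the series converges uniformly on the closed unit interval.
\<close>
lemma hypergeom_4F3_tendsto_1:
  assumes \<alpha>: "Re \<alpha> > -1/4" and r: "\<And>n. 0 \<le> r n" "\<And>n. r n < 1" "r \<longlonglongrightarrow> (1 :: real)"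
  shows "(\<lambda>n. hypergeom_4F3 \<alpha> (of_real (r n))) \<longlonglongrightarrow> hypergeom_4F3 \<alpha> 1"
proof -
  have eq: "hypergeom_4F3 \<alpha> (of_real (r n)) = (\<Sum>k. coeff_4F3 \<alpha> k * of_real (r n) ^ k)" for n
    using hypergeom_4F3(2)[OF \<alpha>, of "of_real (r n)"] r(1,2)[of n] by (simp add: sums_iff)
  have "uniform_limit {0..1} (\<lambda>n x. \<Sum>k<n. coeff_4F3 \<alpha> k * of_real x ^ k) (\<lambda>x. \<Sum>k. coeff_4F3 \<alpha> k * of_real x ^ k) sequentially"
  proof (rule Weierstrass_m_test[OF _ summable_coeff_4F3[OF \<alpha>]])
    fix k and x :: real assume "x \<in> {0..1}"
    thus "norm (coeff_4F3 \<alpha> k * of_real x ^ k) \<le> norm (coeff_4F3 \<alpha> k)"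
      by (auto simp: norm_mult norm_power intro!: mult_left_le power_le_one)
  qed
  hence "continuous_on {0..1} (\<lambda>x. \<Sum>k. coeff_4F3 \<alpha> k * complex_of_real x ^ k)"
    by (rule uniform_limit_theorem[rotated]) (auto intro!: always_eventually continuous_intros)
  from continuous_on_tendsto_compose[OF this r(3)] r(1,2)
  show ?thesis unfolding eq hypergeom_4F3_at_1 by (simp add: less_imp_le)
qed

section \<open>The modified Bessel function of the first kind\<close>

text \<open>
  The entire part of the Bessel function: \<open>I_\<alpha>(z) = (z/2)^\<alpha> \<Phi>_\<alpha>((z/2)^2)\<close>.
\<close>
definition bessel_phi :: "complex \<Rightarrow> complex \<Rightarrow> complex" where
  "bessel_phi \<alpha> w = (\<Sum>k. rGamma (of_nat k + \<alpha> + 1) / fact k * w ^ k)"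

text \<open>
  Every factor of \<open>(\<alpha>+1)_k\<close> has real part at least that of the corresponding factor of \<open>(1/2)_k\<close>, and
  \<open>(1/2)_k k! 4^k = (2k)!\<close>. This compares \<open>\<Phi>_\<alpha>\<close> with the series of \<open>cosh\<close>.
\<close>
lemma bessel_coeff_bound:
  assumes \<alpha>: "Re \<alpha> > -1/2"
  shows "norm (rGamma (of_nat k + \<alpha> + 1) / fact k) \<le> norm (rGamma (\<alpha> + 1)) * 4 ^ k / fact (2 * k)"
proof -
  have half: "pochhammer (1/2) k \<le> norm (pochhammer (\<alpha> + 1) k)"
    unfolding pochhammer_prod prod_norm[symmetric]
  proof (rule prod_mono)
    fix j assume "j \<in> {0..<k}"
    have "1/2 + real j \<le> Re (\<alpha> + 1 + of_nat j)" using \<alpha> by simp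
    also have "\<dots> \<le> norm (\<alpha> + 1 + of_nat j)" by (rule complex_Re_le_cmod)
    finally show "0 \<le> 1/2 + real j \<and> 1/2 + real j \<le> norm (\<alpha> + 1 + of_nat j)" by simp
  qed
  have pos: "pochhammer (1/2 :: real) k > 0" by (rule pochhammer_pos) simp
  have "rGamma (\<alpha> + 1) = pochhammer (\<alpha> + 1) k * rGamma (of_nat k + \<alpha> + 1)"
    using pochhammer_rGamma[of "\<alpha> + 1" k] by (simp add: add_ac)
  hence "norm (rGamma (\<alpha> + 1)) = norm (pochhammer (\<alpha> + 1) k) * norm (rGamma (of_nat k + \<alpha> + 1))"
    by (simp add: norm_mult)
  also have "\<dots> \<ge> pochhammer (1/2) k * norm (rGamma (of_nat k + \<alpha> + 1))"
    using half by (intro mult_right_mono) auto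
  finally have "norm (rGamma (of_nat k + \<alpha> + 1)) \<le> norm (rGamma (\<alpha> + 1)) / pochhammer (1/2) k"
    using pos by (simp add: field_simps)
  hence "norm (rGamma (of_nat k + \<alpha> + 1)) / fact k \<le> norm (rGamma (\<alpha> + 1)) / pochhammer (1/2) k / fact k"
    by (intro divide_right_mono) auto
  also have "\<dots> = norm (rGamma (\<alpha> + 1)) * 4 ^ k / fact (2 * k)"
  proof -
    have "fact (2 * k) = (4 ^ k * pochhammer (1/2) k * fact k :: real)"
      unfolding fact_double by (simp add: power_mult)
    thus ?thesis using pos by simp
  qed
  finally show ?thesis by (simp add: norm_divide)
qed

lemma cosh_series: "(\<lambda>k. x ^ (2 * k) / fact (2 * k)) sums cosh x" for x :: "'a :: {real_normed_field, banach}"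
proof -
  have "(\<lambda>k. if even (2 * k) then x ^ (2 * k) /\<^sub>R fact (2 * k) else 0) sums cosh x"
    using sums_mono_reindex[of "\<lambda>k. 2 * k" "\<lambda>n. if even n then x ^ n /\<^sub>R fact n else 0" "cosh x"] cosh_converges[of x]
    by (fastforce simp: strict_mono_def elim!: evenE)
  thus ?thesis by (simp add: scaleR_conv_of_real field_simps)
qed

text \<open>
  The sum of absolute values is bounded, rather than the function itself, since the partial sums of the
  squared series have to be dominated in the termwise integration.
\<close>
lemma bessel_phi_abs_bound:
  fixes \<alpha> z :: complex
  assumes \<alpha>: "Re \<alpha> > -1/2"
  defines "e \<equiv> \<lambda>k. norm (rGamma (of_nat k + \<alpha> + 1) / fact k * ((z / 2)\<^sup>2) ^ k)"
  shows "summable e" and "(\<Sum>k. e k) \<le> norm (rGamma (\<alpha> + 1)) * exp (norm z)"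
proof -
  define C where "C = norm (rGamma (\<alpha> + 1))"
  have sums: "(\<lambda>k. C * (norm z ^ (2 * k) / fact (2 * k))) sums (C * cosh (norm z))"
    by (intro sums_mult cosh_series)
  have le: "e k \<le> C * (norm z ^ (2 * k) / fact (2 * k))" for k
  proof -
    have "e k = norm (rGamma (of_nat k + \<alpha> + 1) / fact k) * (norm z / 2) ^ (2 * k)"
      by (simp add: e_def norm_mult norm_divide norm_power power_mult)
    also have "\<dots> \<le> (C * 4 ^ k / fact (2 * k)) * (norm z / 2) ^ (2 * k)"
      unfolding C_def by (intro mult_right_mono bessel_coeff_bound[OF \<alpha>]) simp
    also have "\<dots> = C * (norm z ^ (2 * k) / fact (2 * k))"
      by (simp add: power_divide power_mult)
    finally show ?thesis .
  qed
  show s: "summable e"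
    by (rule summable_comparison_test'[OF sums_summable[OF sums]]) (use le in \<open>auto simp: e_def\<close>)
  have "(\<Sum>k. e k) \<le> C * cosh (norm z)"
    using suminf_le[OF le s sums_summable[OF sums]] sums_unique[OF sums] by simp
  also have "cosh (norm z) \<le> exp (norm z)" by (simp add: cosh_def)
  hence "C * cosh (norm z) \<le> C * exp (norm z)" by (intro mult_left_mono) (auto simp: C_def)
  finally show "(\<Sum>k. e k) \<le> norm (rGamma (\<alpha> + 1)) * exp (norm z)" by (simp add: C_def)
qed

lemma bessel_I_phi:
  assumes \<alpha>: "Re \<alpha> > -1/2" and z: "z \<noteq> 0"
  shows "bessel_I \<alpha> z = (z / 2) powr \<alpha> * bessel_phi \<alpha> ((z / 2)\<^sup>2)"
proof -
  have "(z / 2) powr (2 * of_nat k + \<alpha>) = (z / 2) powr \<alpha> * ((z / 2)\<^sup>2) ^ k" for k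
  proof -
    have "(z / 2) powr (2 * of_nat k) = (z / 2) ^ (2 * k)"
      using z powr_nat'[of "z / 2" "2 * k"] by simp
    thus ?thesis by (simp add: powr_add power_mult)
  qed
  hence "bessel_I \<alpha> z = (\<Sum>k. (z / 2) powr \<alpha> * (rGamma (of_nat k + \<alpha> + 1) / fact k * ((z / 2)\<^sup>2) ^ k))"
    by (simp add: bessel_I_def mult_ac)
  thus ?thesis
    using suminf_mult[OF summable_norm_cancel[OF bessel_phi_abs_bound(1)[OF \<alpha>, of z]], of "(z / 2) powr \<alpha>"]
    by (simp add: bessel_phi_def)
qed

definition bessel_sq_coeff :: "complex \<Rightarrow> nat \<Rightarrow> complex" where
  "bessel_sq_coeff \<alpha> k = Gamma (2 * \<alpha> + 2 * of_nat k + 1) / (fact k * Gamma (\<alpha> + of_nat k + 1) ^ 2 * Gamma (2 * \<alpha> + of_nat k + 1))"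

lemma gbinomial_eq_Gamma:
  fixes z :: complex
  assumes "Re z + 1 > real n"
  shows "z gchoose n = Gamma (z + 1) / (fact n * Gamma (z - of_nat n + 1))"
proof -
  have p: "z - of_nat n + 1 \<notin> \<int>\<^sub>\<le>\<^sub>0" using assms by (intro Re_pos_not_nonpos_Int) simp
  show ?thesis by (simp add: gbinomial_pochhammer' pochhammer_Gamma[OF p])
qed

text \<open>
  Each summand is the product of the binomial coefficients of \<open>\<alpha> + k\<close> over \<open>j\<close> and over \<open>k - j\<close>, divided
  by \<open>\<Gamma>(\<alpha>+k+1)^2\<close>. Vandermonde's convolution sums these products to \<open>2\<alpha> + 2k\<close> over \<open>k\<close>.
\<close>
lemma bessel_sq_coeff_conv:
  assumes \<alpha>: "Re \<alpha> > -1/2"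
  shows "(\<Sum>j\<le>k. (rGamma (of_nat j + \<alpha> + 1) / fact j) * (rGamma (of_nat (k - j) + \<alpha> + 1) / fact (k - j)))
           = bessel_sq_coeff \<alpha> k"
proof -
  let ?z = "\<alpha> + of_nat k"
  have Gz: "Gamma (?z + 1) \<noteq> 0" using \<alpha> by (intro Gamma_nonzero_Re_pos) simp
  have "(\<Sum>j\<le>k. (rGamma (of_nat j + \<alpha> + 1) / fact j) * (rGamma (of_nat (k - j) + \<alpha> + 1) / fact (k - j)))
      = (\<Sum>j\<le>k. (?z gchoose j) * (?z gchoose (k - j)) / Gamma (?z + 1) ^ 2)"
  proof (rule sum.cong[OF refl])
    fix j assume "j \<in> {..k}"
    hence j: "j \<le> k" by simp
    have 1: "?z gchoose j = Gamma (?z + 1) / (fact j * Gamma (of_nat (k - j) + \<alpha> + 1))"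
      using \<alpha> j by (subst gbinomial_eq_Gamma) (auto simp: of_nat_diff algebra_simps)
    have 2: "?z gchoose (k - j) = Gamma (?z + 1) / (fact (k - j) * Gamma (of_nat j + \<alpha> + 1))"
      using \<alpha> j by (subst gbinomial_eq_Gamma) (auto simp: of_nat_diff algebra_simps)
    show "(rGamma (of_nat j + \<alpha> + 1) / fact j) * (rGamma (of_nat (k - j) + \<alpha> + 1) / fact (k - j)) =
        (?z gchoose j) * (?z gchoose (k - j)) / Gamma (?z + 1) ^ 2"
      unfolding 1 2 using Gz by (simp add: rGamma_inverse_Gamma divide_simps power2_eq_square)
  qed
  also have "\<dots> = (\<Sum>j\<le>k. (?z gchoose j) * (?z gchoose (k - j))) / Gamma (?z + 1) ^ 2"
    by (simp add: sum_divide_distrib)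
  also have "(\<Sum>j\<le>k. (?z gchoose j) * (?z gchoose (k - j))) = (?z + ?z) gchoose k"
    using gbinomial_Vandermonde[of ?z ?z k] by (simp add: atMost_atLeast0)
  also have "\<dots> = Gamma (2 * \<alpha> + 2 * of_nat k + 1) / (fact k * Gamma (2 * \<alpha> + of_nat k + 1))"
    using \<alpha> by (subst gbinomial_eq_Gamma) (auto simp: algebra_simps mult_2)
  finally show ?thesis by (simp add: bessel_sq_coeff_def)
qed

lemma bessel_phi_square:
  assumes \<alpha>: "Re \<alpha> > -1/2"
  shows "(\<lambda>k. bessel_sq_coeff \<alpha> k * ((z / 2)\<^sup>2) ^ k) sums (bessel_phi \<alpha> ((z / 2)\<^sup>2))\<^sup>2"
    and "norm (\<Sum>k<n. bessel_sq_coeff \<alpha> k * ((z / 2)\<^sup>2) ^ k) \<le> (norm (rGamma (\<alpha> + 1)) * exp (norm z))\<^sup>2"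
proof -
  define w where "w = (z / 2)\<^sup>2"
  define a where "a k = rGamma (of_nat k + \<alpha> + 1) / fact k * w ^ k" for k
  have s: "summable (\<lambda>k. norm (a k))" using bessel_phi_abs_bound(1)[OF \<alpha>] unfolding a_def w_def .
  have eq: "(\<Sum>i\<le>k. a i * a (k - i)) = bessel_sq_coeff \<alpha> k * w ^ k" for k
  proof -
    have "(\<Sum>i\<le>k. a i * a (k - i)) = (\<Sum>i\<le>k. (rGamma (of_nat i + \<alpha> + 1) / fact i) * (rGamma (of_nat (k - i) + \<alpha> + 1) / fact (k - i)) * w ^ k)"
    proof (rule sum.cong[OF refl])
      fix i assume "i \<in> {..k}"
      hence "w ^ i * w ^ (k - i) = w ^ k" by (simp flip: power_add)
      thus "a i * a (k - i) = (rGamma (of_nat i + \<alpha> + 1) / fact i) * (rGamma (of_nat (k - i) + \<alpha> + 1) / fact (k - i)) * w ^ k"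
        by (simp add: a_def mult_ac)
    qed
    thus ?thesis unfolding sum_distrib_right[symmetric] bessel_sq_coeff_conv[OF \<alpha>] .
  qed
  have "(\<lambda>k. bessel_sq_coeff \<alpha> k * w ^ k) sums ((\<Sum>k. a k) * (\<Sum>k. a k))"
    using Cauchy_product_sums[OF s s] unfolding eq .
  thus "(\<lambda>k. bessel_sq_coeff \<alpha> k * ((z / 2)\<^sup>2) ^ k) sums (bessel_phi \<alpha> ((z / 2)\<^sup>2))\<^sup>2"
    unfolding w_def[symmetric] by (simp add: bessel_phi_def a_def power2_eq_square)
  have s': "summable (\<lambda>k. norm (norm (a k)))" using s by simp
  have conv: "(\<lambda>k. \<Sum>i\<le>k. norm (a i) * norm (a (k - i))) sums ((\<Sum>k. norm (a k)) * (\<Sum>k. norm (a k)))"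
    using Cauchy_product_sums[OF s' s'] .
  have "norm (\<Sum>k<n. bessel_sq_coeff \<alpha> k * w ^ k) \<le> (\<Sum>k<n. \<Sum>i\<le>k. norm (a i) * norm (a (k - i)))"
    unfolding eq[symmetric] by (intro sum_norm_le) (simp add: norm_mult[symmetric] sum_norm_le)
  also have "\<dots> \<le> (\<Sum>k. norm (a k)) * (\<Sum>k. norm (a k))"
    using sum_le_suminf[OF sums_summable[OF conv], of "{..<n}"] sums_unique[OF conv] by (auto simp: sum_nonneg)
  also have "\<dots> \<le> (norm (rGamma (\<alpha> + 1)) * exp (norm z)) * (norm (rGamma (\<alpha> + 1)) * exp (norm z))"
    using bessel_phi_abs_bound(2)[OF \<alpha>, of z] suminf_nonneg[OF s]
    unfolding a_def w_def by (intro mult_mono) auto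
  finally show "norm (\<Sum>k<n. bessel_sq_coeff \<alpha> k * ((z / 2)\<^sup>2) ^ k) \<le> (norm (rGamma (\<alpha> + 1)) * exp (norm z))\<^sup>2"
    by (simp add: w_def power2_eq_square)
qed

lemma cosh_of_real: "cosh (complex_of_real x) = of_real (cosh x)"
  by (simp add: cosh_def scaleR_conv_of_real exp_of_real[symmetric])

text \<open>
  Poisson's integral for \<open>I_\<alpha>\<close>, as the Euler transform of \<open>cosh(z \<surd>u)\<close> with parameters \<open>1/2\<close> and
  \<open>\<alpha> + 1/2\<close>. Replacing \<open>z\<close> and \<open>\<alpha>\<close> by their real parts does not decrease the absolute value of
  the integrand, so the integral bounds \<open>I_\<alpha>\<close> in terms of \<open>Re z\<close>, whereas the power series only
  bounds it in terms of \<open>|z|\<close>.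
\<close>
lemma bessel_phi_poisson:
  assumes \<alpha>: "Re \<alpha> > -1/2"
  shows "integrable lborel (\<lambda>p. cosh (z * of_real (sqrt (logistic p))) * beta_kernel (1/2) (\<alpha> + 1/2) p)"
    and "(LINT p|lborel. cosh (z * of_real (sqrt (logistic p))) * beta_kernel (1/2) (\<alpha> + 1/2) p)
           = Gamma (1/2) * Gamma (\<alpha> + 1/2) * bessel_phi \<alpha> ((z / 2)\<^sup>2)"
proof -
  define c where "c k = z ^ (2 * k) / fact (2 * k)" for k
  have c: "summable (\<lambda>k. norm (c k))"
    using sums_summable[OF cosh_series[of "norm z"]] by (simp add: c_def norm_divide norm_power)
  have a': "Re (1/2) > 0" "Re (\<alpha> + 1/2) > 0" using \<alpha> by auto
  have cosh: "(\<Sum>k. c k * of_real (logistic p) ^ k) = cosh (z * of_real (sqrt (logistic p)))" for p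
  proof -
    have "complex_of_real (sqrt (logistic p)) ^ (2 * k) = of_real (logistic p) ^ k" for k
      using logistic_bounds[of p] by (simp add: power_mult flip: of_real_power)
    thus ?thesis using cosh_series[of "z * of_real (sqrt (logistic p))"]
      by (simp add: sums_iff c_def power_mult_distrib)
  qed
  note E = euler_transform_series[OF a' c, unfolded cosh]
  show "integrable lborel (\<lambda>p. cosh (z * of_real (sqrt (logistic p))) * beta_kernel (1/2) (\<alpha> + 1/2) p)"
    by (rule E(1))
  have "c k * (pochhammer (1/2) k / pochhammer (1/2 + (\<alpha> + 1/2)) k) * Beta (1/2) (\<alpha> + 1/2) =
      Gamma (1/2) * Gamma (\<alpha> + 1/2) * (rGamma (of_nat k + \<alpha> + 1) / fact k * ((z / 2)\<^sup>2) ^ k)" for k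
  proof -
    have s: "1/2 + (\<alpha> + 1/2) = \<alpha> + 1" by simp
    have p: "pochhammer (1/2 :: complex) k \<noteq> 0"
      using fact_double[of k, where 'a = complex] fact_nonzero[of "2 * k", where 'a = complex] by auto
    have "rGamma (\<alpha> + 1) = pochhammer (\<alpha> + 1) k * rGamma (of_nat k + \<alpha> + 1)"
      using pochhammer_rGamma[of "\<alpha> + 1" k] by (simp add: add_ac)
    moreover have "rGamma (\<alpha> + 1) \<noteq> 0" using \<alpha> by (simp add: rGamma_eq_zero_iff Re_pos_not_nonpos_Int)
    ultimately have r: "rGamma (\<alpha> + 1) / pochhammer (\<alpha> + 1) k = rGamma (of_nat k + \<alpha> + 1)"
      by auto
    have B: "Beta (1/2) (\<alpha> + 1/2) = Gamma (1/2) * Gamma (\<alpha> + 1/2) * rGamma (\<alpha> + 1)"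
      unfolding Beta_def s by (simp only: rGamma_inverse_Gamma divide_inverse)
    have q: "c k * pochhammer (1/2) k = ((z / 2)\<^sup>2) ^ k / fact k"
    proof -
      have w: "((z / 2)\<^sup>2) ^ k = z ^ (2 * k) / 2 ^ (2 * k)" by (simp only: power_mult power_divide)
      show ?thesis unfolding c_def fact_double w using p by (simp del: power_mult)
    qed
    have "c k * (pochhammer (1/2) k / pochhammer (1/2 + (\<alpha> + 1/2)) k) * Beta (1/2) (\<alpha> + 1/2) =
        (c k * pochhammer (1/2) k) * (Gamma (1/2) * Gamma (\<alpha> + 1/2)) * (rGamma (\<alpha> + 1) / pochhammer (\<alpha> + 1) k)"
      unfolding s B by simp
    thus ?thesis unfolding q r by (simp add: mult_ac)
  qed
  with E(2) have "(\<lambda>k. Gamma (1/2) * Gamma (\<alpha> + 1/2) * (rGamma (of_nat k + \<alpha> + 1) / fact k * ((z / 2)\<^sup>2) ^ k)) sums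
      (LINT p|lborel. cosh (z * of_real (sqrt (logistic p))) * beta_kernel (1/2) (\<alpha> + 1/2) p)"
    by simp
  moreover have "(\<lambda>k. Gamma (1/2) * Gamma (\<alpha> + 1/2) * (rGamma (of_nat k + \<alpha> + 1) / fact k * ((z / 2)\<^sup>2) ^ k)) sums
      (Gamma (1/2) * Gamma (\<alpha> + 1/2) * bessel_phi \<alpha> ((z / 2)\<^sup>2))"
    unfolding bessel_phi_def
    by (intro sums_mult summable_sums summable_norm_cancel[OF bessel_phi_abs_bound(1)[OF \<alpha>]])
  ultimately show "(LINT p|lborel. cosh (z * of_real (sqrt (logistic p))) * beta_kernel (1/2) (\<alpha> + 1/2) p)
           = Gamma (1/2) * Gamma (\<alpha> + 1/2) * bessel_phi \<alpha> ((z / 2)\<^sup>2)"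
    by (rule sums_unique2)
qed

lemma norm_cosh_le: "norm (cosh z) \<le> cosh (Re z)" for z :: complex
proof -
  have "norm (exp z + exp (- z)) \<le> norm (exp z) + norm (exp (- z))" by (rule norm_triangle_ineq)
  thus ?thesis by (simp add: cosh_def norm_divide scaleR_conv_of_real)
qed

text \<open>
  Up to a constant this is \<open>(2/y)^\<sigma> I_\<sigma>(y)\<close>. The integral form makes positivity and monotonicity
  evident.
\<close>
definition bessel_majorant :: "real \<Rightarrow> real \<Rightarrow> real" where
  "bessel_majorant \<sigma> y = (LINT p|lborel. cosh (y * sqrt (logistic p)) * norm (beta_kernel (1/2) (of_real \<sigma> + 1/2) p))"

lemma bessel_majorant_integrable:
  assumes "\<sigma> > -1/2"
  shows "integrable lborel (\<lambda>p. cosh (y * sqrt (logistic p)) * norm (beta_kernel (1/2) (of_real \<sigma> + 1/2) p))"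
proof -
  have "integrable lborel (\<lambda>p. norm (cosh (of_real y * of_real (sqrt (logistic p))) * beta_kernel (1/2) (of_real \<sigma> + 1/2) p))"
    using assms by (intro integrable_norm bessel_phi_poisson) auto
  moreover have "norm (cosh (of_real y * complex_of_real (sqrt (logistic p)))) = cosh (y * sqrt (logistic p))" for p
  proof -
    have "cosh (of_real y * complex_of_real (sqrt (logistic p))) = of_real (cosh (y * sqrt (logistic p)))"
      by (simp flip: cosh_of_real)
    hence "norm (cosh (of_real y * complex_of_real (sqrt (logistic p)))) = \<bar>cosh (y * sqrt (logistic p))\<bar>"
      by (simp only: norm_of_real)
    thus ?thesis by simp
  qed
  ultimately show ?thesis by (simp add: norm_mult)
qed

lemma bessel_majorant_eq:
  assumes "\<sigma> > -1/2"
  shows "of_real (bessel_majorant \<sigma> y) = Gamma (1/2) * Gamma (of_real \<sigma> + 1/2) * bessel_phi (of_real \<sigma>) ((of_real y / 2)\<^sup>2)"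
proof -
  have "of_real (cosh (y * sqrt (logistic p)) * norm (beta_kernel (1/2) (of_real \<sigma> + 1/2) p)) =
      cosh (of_real y * of_real (sqrt (logistic p))) * beta_kernel (1/2) (of_real \<sigma> + 1/2) p" for p
  proof -
    have "beta_kernel (1/2) (of_real \<sigma> + 1/2) p = of_real (norm (beta_kernel (1/2) (of_real \<sigma> + 1/2) p))"
      using beta_kernel_of_real[of "1/2" "\<sigma> + 1/2" p] by simp
    moreover have "cosh (of_real y * of_real (sqrt (logistic p))) = complex_of_real (cosh (y * sqrt (logistic p)))"
      by (simp flip: cosh_of_real)
    ultimately show ?thesis by simp
  qed
  moreover have "complex_of_real (bessel_majorant \<sigma> y) = (LINT p|lborel. of_real (cosh (y * sqrt (logistic p)) * norm (beta_kernel (1/2) (of_real \<sigma> + 1/2) p)))"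
    unfolding bessel_majorant_def by (rule integral_complex_of_real[symmetric])
  ultimately show ?thesis using bessel_phi_poisson(2)[of "of_real \<sigma>" "of_real y"] assms by simp
qed

lemma bessel_majorant_nonneg: "bessel_majorant \<sigma> y \<ge> 0"
  unfolding bessel_majorant_def by (intro integral_nonneg_AE AE_I2) auto

lemma bessel_majorant_mono:
  assumes \<sigma>: "\<sigma> > -1/2" and "0 \<le> x" "x \<le> y"
  shows "bessel_majorant \<sigma> x \<le> bessel_majorant \<sigma> y"
  unfolding bessel_majorant_def
proof (intro integral_mono bessel_majorant_integrable[OF \<sigma>] mult_right_mono)
  fix p
  have "x * sqrt (logistic p) \<le> y * sqrt (logistic p)" "0 \<le> x * sqrt (logistic p)"
    using assms logistic_bounds[of p] by (auto intro!: mult_right_mono)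
  thus "cosh (x * sqrt (logistic p)) \<le> cosh (y * sqrt (logistic p))"
    by (subst cosh_real_nonneg_le_iff) auto
qed auto

lemma bessel_majorant_exp_bound:
  assumes \<sigma>: "\<sigma> > -1/2" and "0 \<le> y"
  shows "bessel_majorant \<sigma> y \<le> bessel_majorant \<sigma> 0 * exp y"
proof -
  have "cosh (y * sqrt (logistic p)) \<le> cosh 0 * exp y" for p
  proof -
    have "y * sqrt (logistic p) \<le> y" using assms logistic_bounds[of p] by (intro mult_left_le) auto
    hence "cosh (y * sqrt (logistic p)) \<le> exp y"
      using assms logistic_bounds[of p] by (auto simp: cosh_def) (smt (verit) exp_le_cancel_iff mult_nonneg_nonneg real_sqrt_ge_zero)
    thus ?thesis by simp
  qed
  hence "bessel_majorant \<sigma> y \<le> (LINT p|lborel. cosh (0 * sqrt (logistic p)) * norm (beta_kernel (1/2) (of_real \<sigma> + 1/2) p) * exp y)"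
    unfolding bessel_majorant_def
    using bessel_majorant_integrable[OF \<sigma>, of y] bessel_majorant_integrable[OF \<sigma>, of 0]
    by (intro integral_mono) (auto intro!: mult_right_mono simp: mult_ac)
  thus ?thesis by (simp add: bessel_majorant_def)
qed

lemma norm_bessel_phi_le:
  assumes \<alpha>: "Re \<alpha> > -1/2"
  shows "norm (bessel_phi \<alpha> ((z / 2)\<^sup>2)) \<le> bessel_majorant (Re \<alpha>) (Re z) / norm (Gamma (1/2) * Gamma (\<alpha> + 1/2))"
proof -
  have nz: "Gamma (1/2) * Gamma (\<alpha> + 1/2) \<noteq> 0" using \<alpha> by (simp add: Gamma_nonzero_Re_pos)
  have "norm (Gamma (1/2) * Gamma (\<alpha> + 1/2) * bessel_phi \<alpha> ((z / 2)\<^sup>2)) \<le>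
      (LINT p|lborel. norm (cosh (z * of_real (sqrt (logistic p))) * beta_kernel (1/2) (\<alpha> + 1/2) p))"
    unfolding bessel_phi_poisson(2)[OF \<alpha>, symmetric] by (rule integral_norm_bound)
  also have "\<dots> \<le> bessel_majorant (Re \<alpha>) (Re z)"
    unfolding bessel_majorant_def
  proof (intro integral_mono)
    fix p
    have "norm (cosh (z * of_real (sqrt (logistic p)))) \<le> cosh (Re z * sqrt (logistic p))"
      using norm_cosh_le[of "z * of_real (sqrt (logistic p))"] by simp
    moreover have "norm (beta_kernel (1/2) (\<alpha> + 1/2) p) = norm (beta_kernel (1/2) (of_real (Re \<alpha>) + 1/2) p)"
      by (simp add: norm_beta_kernel)
    ultimately show "norm (cosh (z * of_real (sqrt (logistic p))) * beta_kernel (1/2) (\<alpha> + 1/2) p) \<le>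
        cosh (Re z * sqrt (logistic p)) * norm (beta_kernel (1/2) (of_real (Re \<alpha>) + 1/2) p)"
      by (simp add: norm_mult mult_right_mono)
  qed (use \<alpha> in \<open>auto intro!: bessel_phi_poisson bessel_majorant_integrable integrable_norm\<close>)
  finally show ?thesis using nz by (simp add: norm_mult field_simps)
qed

section \<open>The modified Bessel function of the second kind\<close>

text \<open>
  Used below to trade the decay of \<open>exp(- c e^{-t})\<close> at \<open>t \<rightarrow> -\<infinity>\<close> for a factor \<open>e^{mt}\<close>.
\<close>
lemma exp_minus_le_power:
  fixes u :: real
  assumes "u > 0" "m > 0"
  shows "exp (- u) \<le> (real m / u) ^ m"
proof -
  have "u / m \<le> exp (u / m)" using exp_ge_add_one_self[of "u / m"] by linarith
  hence "(u / m) ^ m \<le> exp (u / m) ^ m"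
    using assms by (intro power_mono) auto
  also have "exp (u / m) ^ m = exp u" using assms by (simp flip: exp_of_nat_mult)
  finally show ?thesis using assms by (simp add: exp_minus field_simps)
qed

text \<open>
  Since \<open>cosh t = e^t/2 + e^{-t}/2\<close>, the kernel contains the factor \<open>exp(-B e^{-t}/2)\<close>, which is at most
  \<open>C e^{mt}\<close>. What is left is the integrand of a Gamma integral with exponent \<open>\<sigma> + m > 0\<close>.
\<close>
lemma bessel_K_kernel_integrable_real:
  fixes B \<sigma> :: real
  assumes B: "B > 0"
  shows "integrable lborel (\<lambda>t. exp (- (B * cosh t) + \<sigma> * t))"
proof -
  (* Any positive natural number exceeding the absolute value of sigma serves. *)
  define m where "m = nat \<lceil>\<bar>\<sigma>\<bar>\<rceil> + 1"
  have m: "m > 0" "\<sigma> + real m > 0" by (auto simp: m_def) linarith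
  define C where "C = (2 * real m / B) ^ m"
  have i: "integrable lborel (\<lambda>t. C * norm (exp (of_real (\<sigma> + real m) * complex_of_real t) * of_real (exp (- (B / 2 * exp t)))))"
    using m B by (intro integrable_mult_right integrable_norm Gamma_exp_integral(1)) auto
  show ?thesis
  proof (rule Bochner_Integration.integrable_bound[OF i])
    show "AE t in lborel. norm (exp (- (B * cosh t) + \<sigma> * t)) \<le>
        norm (C * norm (exp (of_real (\<sigma> + real m) * complex_of_real t) * of_real (exp (- (B / 2 * exp t)))))"
    proof (rule AE_I2)
      fix t :: real
      have "exp (- (B / 2 * exp (- t))) \<le> (real m / (B / 2 * exp (- t))) ^ m"
        using B m by (intro exp_minus_le_power) auto
      also have "\<dots> = (2 * real m / B * exp t) ^ m" using B by (simp add: exp_minus field_simps)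
      also have "\<dots> = C * exp (real m * t)" by (simp only: C_def power_mult_distrib exp_of_nat_mult)
      finally have le: "exp (- (B / 2 * exp (- t))) \<le> C * exp (real m * t)" .
      have "exp (- (B * cosh t) + \<sigma> * t) = exp (- (B / 2 * exp (- t))) * (exp (\<sigma> * t) * exp (- (B / 2 * exp t)))"
        by (simp add: cosh_def field_simps flip: exp_add)
      also have "\<dots> \<le> C * exp (real m * t) * (exp (\<sigma> * t) * exp (- (B / 2 * exp t)))"
        by (intro mult_right_mono le) simp
      also have "\<dots> = C * (exp ((\<sigma> + real m) * t) * exp (- (B / 2 * exp t)))"
        by (simp add: algebra_simps flip: exp_add)
      finally show "norm (exp (- (B * cosh t) + \<sigma> * t)) \<le>
        norm (C * norm (exp (of_real (\<sigma> + real m) * complex_of_real t) * of_real (exp (- (B / 2 * exp t)))))"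
        using B by (simp add: norm_mult C_def)
    qed
    show "(\<lambda>t. exp (- (B * cosh t) + \<sigma> * t)) \<in> borel_measurable lborel"
      unfolding cosh_def by measurable
  qed
qed

definition bessel_K_real :: "real \<Rightarrow> real \<Rightarrow> real" where
  "bessel_K_real \<sigma> y = (LINT t|lborel. exp (- (y * cosh t) + \<sigma> * t)) / 2"

lemma bessel_K_kernel_norm: "norm (exp (- z * of_real (cosh t) + \<alpha> * of_real t)) = exp (- (Re z * cosh t) + Re \<alpha> * t)"
  for z \<alpha> :: complex by simp

lemma bessel_K_kernel_integrable:
  fixes z \<alpha> :: complex
  assumes "Re z > 0"
  shows "integrable lborel (\<lambda>t. exp (- z * of_real (cosh t) + \<alpha> * of_real t))"
  by (rule Bochner_Integration.integrable_bound[OF bessel_K_kernel_integrable_real[OF assms, of "Re \<alpha>"]])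
     (auto simp: cosh_def)

text \<open>
  Folding \<open>t \<mapsto> -t\<close> turns \<open>cosh(\<alpha>t)\<close> into a pure exponential, which is multiplicative and so makes the
  square tractable.
\<close>
lemma bessel_K_whole_line:
  assumes z: "Re z > 0"
  shows "bessel_K \<alpha> z = (LINT t|lborel. exp (- z * of_real (cosh t) + \<alpha> * of_real t)) / 2"
proof -
  define f where "f t = exp (- z * of_real (cosh t) + \<alpha> * of_real t)" for t
  have fi: "integrable lborel f" unfolding f_def by (rule bessel_K_kernel_integrable[OF z])
  have i1: "integrable lborel (\<lambda>t. indicator {0<..} t *\<^sub>R f t)" and i2: "integrable lborel (\<lambda>t. indicator {..<0} t *\<^sub>R f t)"
    using fi by (auto intro!: integrable_mult_indicator)
  have i3: "integrable lborel (\<lambda>t. indicator {0<..} t *\<^sub>R f (- t))"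
    using lborel_integrable_real_affine[OF i2, of "-1" 0] by (simp add: indicator_def)
  have "(LINT t|lborel. f t) = (LINT t|lborel. indicator {0<..} t *\<^sub>R f t + indicator {..<0} t *\<^sub>R f t)"
  proof (rule integral_cong_AE)
    show "AE t in lborel. f t = indicator {0<..} t *\<^sub>R f t + indicator {..<0} t *\<^sub>R f t"
      using AE_lborel_singleton[of 0] by eventually_elim (auto simp: indicator_def)
  qed (use fi i1 i2 in auto)
  also have "\<dots> = (LINT t|lborel. indicator {0<..} t *\<^sub>R f t) + (LINT t|lborel. indicator {..<0} t *\<^sub>R f t)"
    by (rule Bochner_Integration.integral_add[OF i1 i2])
  also have "(LINT t|lborel. indicator {..<0} t *\<^sub>R f t) = (LINT t|lborel. indicator {0<..} t *\<^sub>R f (- t))"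
    using lborel_integral_real_affine[of "-1" "\<lambda>t. indicator {..<0} t *\<^sub>R f t" 0] by (simp add: indicator_def)
  also have "(LINT t|lborel. indicator {0<..} t *\<^sub>R f t) + (LINT t|lborel. indicator {0<..} t *\<^sub>R f (- t)) =
      (LINT t|lborel. indicator {0<..} t *\<^sub>R f t + indicator {0<..} t *\<^sub>R f (- t))"
    by (rule Bochner_Integration.integral_add[OF i1 i3, symmetric])
  also have "\<dots> = (LINT t|lborel. 2 * (indicator {0<..} t *\<^sub>R (exp (- z * of_real (cosh t)) * cosh (\<alpha> * of_real t))))"
    by (intro Bochner_Integration.integral_cong refl)
       (auto simp: f_def cosh_def[of "\<alpha> * _"] scaleR_conv_of_real exp_add exp_diff exp_minus field_simps indicator_def)
  also have "\<dots> = 2 * bessel_K \<alpha> z"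
    unfolding bessel_K_def set_lebesgue_integral_def by (rule integral_mult_right_zero)
  finally show ?thesis by (simp add: f_def)
qed

lemma bessel_K_of_real:
  assumes "y > 0"
  shows "bessel_K (of_real \<sigma>) (of_real y) = of_real (bessel_K_real \<sigma> y)"
proof -
  have "bessel_K (of_real \<sigma>) (of_real y) = (LINT t|lborel. complex_of_real (exp (- (y * cosh t) + \<sigma> * t))) / 2"
    using assms by (subst bessel_K_whole_line) (simp_all add: exp_of_real[symmetric])
  thus ?thesis by (simp only: integral_complex_of_real) (simp add: bessel_K_real_def)
qed

lemma norm_bessel_K_le:
  assumes "Re z > 0"
  shows "norm (bessel_K \<alpha> z) \<le> bessel_K_real (Re \<alpha>) (Re z)"
proof -
  have "norm (LINT t|lborel. exp (- z * of_real (cosh t) + \<alpha> * of_real t)) \<le>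
      (LINT t|lborel. norm (exp (- z * of_real (cosh t) + \<alpha> * of_real t)))"
    by (rule integral_norm_bound)
  thus ?thesis unfolding bessel_K_kernel_norm bessel_K_whole_line[OF assms] bessel_K_real_def
    by (simp add: norm_divide)
qed

lemma bessel_K_real_nonneg: "bessel_K_real \<sigma> y \<ge> 0"
  unfolding bessel_K_real_def by (intro divide_nonneg_pos integral_nonneg_AE AE_I2) auto

text \<open>
  Because \<open>cosh t \<ge> 1\<close>, an exponential factor can be absorbed into the argument.
\<close>
lemma bessel_K_real_exp_absorb:
  assumes "0 \<le> A" "A < B"
  shows "exp A * bessel_K_real \<sigma> B \<le> bessel_K_real \<sigma> (B - A)"
proof -
  have "(LINT t|lborel. exp A * exp (- (B * cosh t) + \<sigma> * t)) \<le> (LINT t|lborel. exp (- ((B - A) * cosh t) + \<sigma> * t))"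
  proof (intro integral_mono integrable_mult_right bessel_K_kernel_integrable_real)
    fix t :: real
    have "A * 1 \<le> A * cosh t" using assms by (intro mult_left_mono cosh_real_ge_1) auto
    thus "exp A * exp (- (B * cosh t) + \<sigma> * t) \<le> exp (- ((B - A) * cosh t) + \<sigma> * t)"
      by (simp add: algebra_simps flip: exp_add)
  qed (use assms in auto)
  thus ?thesis by (simp add: bessel_K_real_def)
qed

lemma bessel_K_measurable [measurable]: "(\<lambda>x. bessel_K \<alpha> (b * complex_of_real x)) \<in> borel_measurable borel"
  unfolding bessel_K_def set_lebesgue_integral_def cosh_def by measurable

lemma bessel_K_real_measurable [measurable]: "(\<lambda>x. bessel_K_real \<alpha> (b * x)) \<in> borel_measurable borel"
  unfolding bessel_K_real_def cosh_def by measurable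

lemma product_integrable:
  fixes f g :: "real \<Rightarrow> complex"
  assumes f: "integrable lborel f" and g: "integrable lborel g"
  shows "integrable lborel (\<lambda>(x, y). f x * g y)"
    and "(LINT xy|lborel. (case xy of (x, y) \<Rightarrow> f x * g y)) = (LINT x|lborel. f x) * (LINT y|lborel. g y)"
proof -
  have fm[measurable]: "f \<in> borel_measurable borel" and gm[measurable]: "g \<in> borel_measurable borel" using f g by auto
  have i: "integrable (lborel \<Otimes>\<^sub>M lborel) (\<lambda>(x, y). f x * g y)"
  proof (rule lborel_pair.Fubini_integrable)
    show "integrable lborel (\<lambda>x. LINT y|lborel. norm (case (x, y) of (x, y) \<Rightarrow> f x * g y))"
      using f by (simp add: norm_mult)
  qed (use g in auto)
  thus "integrable lborel (\<lambda>(x, y). f x * g y)" by (simp only: lborel_prod)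
  show "(LINT xy|lborel. (case xy of (x, y) \<Rightarrow> f x * g y)) = (LINT x|lborel. f x) * (LINT y|lborel. g y)"
    using lborel_pair.integral_fst[OF i] by (simp add: lborel_prod)
qed

text \<open>
  The linear map has determinant \<open>-2\<close>. It is composed of one-dimensional affine maps, applied in the
  inner integral before and after an exchange of the order of integration.
\<close>
lemma lborel_rotation:
  "(lborel :: (real \<times> real) measure) = density (distr lborel borel (\<lambda>(p, q). (p + q, p - q))) (\<lambda>_. ennreal 2)"
proof (rule measure_eqI)
  fix A :: "(real \<times> real) set" assume "A \<in> sets lborel"
  hence A[measurable]: "A \<in> sets borel" by simp
  have A': "A \<in> sets (borel \<Otimes>\<^sub>M borel)" using A unfolding borel_prod .
  have Am[measurable]: "Measurable.pred (borel \<Otimes>\<^sub>M borel) (\<lambda>x. x \<in> A)"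
    using A by (simp add: borel_prod)
  let ?f = "\<lambda>t u. indicator A (t, u) :: ennreal"
  have "emeasure lborel A = (\<integral>\<^sup>+x. indicator A x \<partial>(lborel \<Otimes>\<^sub>M lborel))"
    by (simp add: lborel_prod)
  also have "\<dots> = (\<integral>\<^sup>+t. \<integral>\<^sup>+u. ?f t u \<partial>lborel \<partial>lborel)"
    by (rule lborel.nn_integral_fst[symmetric]) measurable
  also have "\<dots> = (\<integral>\<^sup>+t. 2 * (\<integral>\<^sup>+p. ?f t (- t + 2 * p) \<partial>lborel) \<partial>lborel)"
  proof (rule nn_integral_cong)
    fix t :: real
    show "(\<integral>\<^sup>+u. ?f t u \<partial>lborel) = 2 * (\<integral>\<^sup>+p. ?f t (- t + 2 * p) \<partial>lborel)"
      by (subst nn_integral_real_affine[where c = 2 and t = "- t"]) auto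
  qed
  also have "\<dots> = 2 * (\<integral>\<^sup>+t. \<integral>\<^sup>+p. ?f t (- t + 2 * p) \<partial>lborel \<partial>lborel)"
    by (rule nn_integral_cmult) measurable
  also have "(\<integral>\<^sup>+t. \<integral>\<^sup>+p. ?f t (- t + 2 * p) \<partial>lborel \<partial>lborel) = (\<integral>\<^sup>+p. \<integral>\<^sup>+t. ?f t (- t + 2 * p) \<partial>lborel \<partial>lborel)"
    by (rule lborel_pair.Fubini'[symmetric]) measurable
  also have "\<dots> = (\<integral>\<^sup>+p. \<integral>\<^sup>+q. ?f (p + q) (p - q) \<partial>lborel \<partial>lborel)"
  proof (rule nn_integral_cong)
    fix p :: real
    show "(\<integral>\<^sup>+t. ?f t (- t + 2 * p) \<partial>lborel) = (\<integral>\<^sup>+q. ?f (p + q) (p - q) \<partial>lborel)"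
      by (subst nn_integral_real_affine[where c = 1 and t = p]) (auto simp: algebra_simps)
  qed
  also have "\<dots> = (\<integral>\<^sup>+x. indicator A (case x of (p, q) \<Rightarrow> (p + q, p - q)) \<partial>(lborel \<Otimes>\<^sub>M lborel))"
    by (subst lborel.nn_integral_fst[symmetric]) (simp_all add: case_prod_unfold)
  also have "2 * \<dots> = emeasure (density (distr lborel borel (\<lambda>(p, q). (p + q, p - q))) (\<lambda>_. ennreal 2)) A"
    unfolding lborel_prod
    by (subst emeasure_density) (auto simp: nn_integral_cmult nn_integral_distr borel_prod[symmetric] A' mult_ac)
  finally show "emeasure lborel A = emeasure (density (distr lborel borel (\<lambda>(p, q). (p + q, p - q))) (\<lambda>_. ennreal 2)) A" .
qed simp

lemma rotation_substitution:
  fixes f :: "real \<times> real \<Rightarrow> complex"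
  assumes f: "integrable lborel f"
  shows "integrable lborel (\<lambda>(p, q). f (p + q, p - q))"
    and "(LINT x|lborel. f x) = 2 * (LINT x|lborel. (case x of (p, q) \<Rightarrow> f (p + q, p - q)))"
proof -
  have fm[measurable]: "f \<in> borel_measurable borel" using f by auto
  have Tm: "(\<lambda>(p, q). (p + q, p - q)) \<in> borel_measurable (borel :: (real \<times> real) measure)"
    unfolding borel_prod[symmetric] by measurable
  have "integrable (density (distr lborel borel (\<lambda>(p, q). (p + q, p - q))) (\<lambda>_. ennreal 2)) f"
    using f lborel_rotation by simp
  hence "integrable (distr lborel borel (\<lambda>(p, q). (p + q, p - q))) (\<lambda>x. 2 *\<^sub>R f x)"
    by (subst (asm) integrable_density) auto
  from integrable_scaleR_right[OF this, of "1/2"]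
  have "integrable (distr lborel borel (\<lambda>(p, q). (p + q, p - q))) f" by simp
  hence "integrable lborel (\<lambda>x. f (case x of (p, q) \<Rightarrow> (p + q, p - q)))"
    using Tm by (subst (asm) integrable_distr_eq) auto
  thus "integrable lborel (\<lambda>(p, q). f (p + q, p - q))" by (simp add: case_prod_unfold)
  have "(LINT x|lborel. f x) = (LINT x|density (distr lborel borel (\<lambda>(p, q). (p + q, p - q))) (\<lambda>_. ennreal 2). f x)"
    using lborel_rotation by simp
  also have "\<dots> = (LINT x|distr lborel borel (\<lambda>(p, q). (p + q, p - q)). 2 *\<^sub>R f x)"
    by (subst integral_density) auto
  also have "\<dots> = (LINT x|lborel. 2 *\<^sub>R f (case x of (p, q) \<Rightarrow> (p + q, p - q)))"
    using Tm by (subst integral_distr) auto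
  finally show "(LINT x|lborel. f x) = 2 * (LINT x|lborel. (case x of (p, q) \<Rightarrow> f (p + q, p - q)))"
    by (simp add: case_prod_unfold scaleR_conv_of_real)
qed

text \<open>
  In the coordinates \<open>t = p + q\<close>, \<open>u = p - q\<close> the exponent separates: \<open>cosh t + cosh u = 2 cosh p cosh q\<close>
  and \<open>t + u = 2p\<close>.
\<close>
lemma bessel_K_square:
  assumes z: "Re z > 0"
  shows "integrable lborel (\<lambda>(p, q). exp (- z * of_real (2 * cosh p * cosh q) + 2 * \<alpha> * of_real p))"
    and "(bessel_K \<alpha> z)\<^sup>2 = (LINT x|lborel. (case x of (p, q) \<Rightarrow> exp (- z * of_real (2 * cosh p * cosh q) + 2 * \<alpha> * of_real p))) / 2"
proof -
  let ?k = "\<lambda>t. exp (- z * of_real (cosh t) + \<alpha> * of_real t)"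
  note P = product_integrable[OF bessel_K_kernel_integrable[OF z, of \<alpha>] bessel_K_kernel_integrable[OF z, of \<alpha>]]
  have eq: "(case (p + q, p - q) of (x, y) \<Rightarrow> ?k x * ?k y) = exp (- z * of_real (2 * cosh p * cosh q) + 2 * \<alpha> * of_real p)" for p q
  proof -
    have "cosh (p + q) + cosh (p - q) = 2 * cosh p * cosh q" by (simp add: cosh_add cosh_diff)
    hence "complex_of_real (cosh (p + q)) + of_real (cosh (p - q)) = of_real (2 * cosh p * cosh q)"
      by (simp only: flip: of_real_add)
    hence "- z * of_real (2 * cosh p * cosh q) = - z * of_real (cosh (p + q)) + - z * of_real (cosh (p - q))"
      by (simp only: flip: distrib_left)
    thus ?thesis by (simp add: algebra_simps flip: exp_add)
  qed
  note R = rotation_substitution[OF P(1), unfolded eq]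
  show "integrable lborel (\<lambda>(p, q). exp (- z * of_real (2 * cosh p * cosh q) + 2 * \<alpha> * of_real p))"
    by (rule R(1))
  show "(bessel_K \<alpha> z)\<^sup>2 = (LINT x|lborel. (case x of (p, q) \<Rightarrow> exp (- z * of_real (2 * cosh p * cosh q) + 2 * \<alpha> * of_real p))) / 2"
    unfolding bessel_K_whole_line[OF z] using trans[OF P(2)[symmetric] R(2)]
    by (simp only: power2_eq_square times_divide_times_eq) simp
qed

section \<open>The Mellin transform of the squared Bessel function of the second kind\<close>

text \<open>
  From \<open>1 + e^{2p} = e^p 2 cosh p\<close>: powers of \<open>cosh\<close> are Beta kernels at the doubled argument.
\<close>
lemma beta_kernel_cosh:
  "beta_kernel (s / 2 + \<nu>) (s / 2 - \<nu>) (2 * p) = exp (2 * \<nu> * of_real p) * of_real (2 * cosh p) powr (- s)"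
proof -
  have "1 + exp (2 * p) = exp p * (2 * cosh p)" 
  proof -
    have "exp p * (2 * cosh p) = exp p * exp p + exp p * exp (- p)" by (simp add: cosh_def algebra_simps)
    thus ?thesis by (simp flip: exp_add)
  qed
  hence "ln (1 + exp (2 * p)) = p + ln (2 * cosh p)" by (simp add: ln_mult)
  hence "beta_kernel (s / 2 + \<nu>) (s / 2 - \<nu>) (2 * p) =
      exp ((s / 2 + \<nu>) * of_real (2 * p) - s * (of_real p + of_real (ln (2 * cosh p))))"
    by (simp only: beta_kernel_def of_real_add) simp
  also have "(s / 2 + \<nu>) * of_real (2 * p) - s * (of_real p + of_real (ln (2 * cosh p))) =
      2 * \<nu> * of_real p + - s * of_real (ln (2 * cosh p))" by (simp add: algebra_simps)
  finally show ?thesis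
    using powr_of_real_exp[of "2 * cosh p" "- s"] by (simp only: exp_add) simp
qed

lemma beta_kernel_double_integral:
  assumes a: "Re a > 0" and b: "Re b > 0"
  shows "integrable lborel (\<lambda>p. beta_kernel a b (2 * p))"
    and "(LINT p|lborel. beta_kernel a b (2 * p)) = Beta a b / 2"
proof -
  show "integrable lborel (\<lambda>p. beta_kernel a b (2 * p))"
    using lborel_integrable_real_affine[OF beta_kernel_integral(1)[OF a b], of 2 0] by simp
  show "(LINT p|lborel. beta_kernel a b (2 * p)) = Beta a b / 2"
    using lborel_integral_real_affine[of 2 "beta_kernel a b" 0] beta_kernel_integral(2)[OF a b]
    by (simp add: scaleR_conv_of_real)
qed

text \<open>
  After inserting the double integral for \<open>K_\<alpha>^2\<close>, the integral over \<open>x\<close> is a Laplace integral equal to a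
  constant times \<open>(cosh p cosh q)^{-s}\<close>. The remaining double integral is the product of two Beta
  integrals.
\<close>
lemma mellin_bessel_K_square:
  fixes s \<alpha> b :: complex
  assumes s: "\<bar>2 * Re \<alpha>\<bar> < Re s" and b: "Re b > 0"
  shows "set_integrable lborel {0<..} (\<lambda>x. of_real x powr (s - 1) * (bessel_K \<alpha> (b * of_real x))\<^sup>2)"
    and "(LINT x:{0<..}|lborel. of_real x powr (s - 1) * (bessel_K \<alpha> (b * of_real x))\<^sup>2) =
           2 powr s * b powr (- s) / 8 * (Gamma (s / 2 + \<alpha>) * Gamma (s / 2 - \<alpha>) * Gamma (s / 2) ^ 2 / Gamma s)"
proof -
  define F where "F s b \<alpha> = (\<lambda>((p, q), x). indicator {0<..} x *\<^sub>R
      (of_real x powr (s - 1) * exp (- (b * of_real x) * of_real (2 * cosh p * cosh q) + 2 * \<alpha> * of_real p)))"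
    for s b \<alpha> :: complex
  have Fm: "F s b \<alpha> \<in> borel_measurable (lborel \<Otimes>\<^sub>M lborel)" for s b \<alpha>
    unfolding F_def case_prod_unfold cosh_def lborel_prod[symmetric] by measurable
  have inner: "integrable lborel (\<lambda>x. F s b \<alpha> ((p, q), x))"
    "(LINT x|lborel. F s b \<alpha> ((p, q), x)) = Gamma s * b powr (- s) * 2 powr s *
       (beta_kernel (s / 2 + \<alpha>) (s / 2 - \<alpha>) (2 * p) * beta_kernel (s / 2) (s / 2) (2 * q))"
    if s: "Re s > 0" and b: "Re b > 0" for s b \<alpha> p q
  proof -
    define c where "c = 2 * cosh p * cosh q"
    have c: "c > 0" by (simp add: c_def)
    have bc: "Re (b * of_real c) > 0" using b c by simp
    have eq: "F s b \<alpha> ((p, q), x) = exp (2 * \<alpha> * of_real p) *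
        (indicator {0<..} x *\<^sub>R (of_real x powr (s - 1) * exp (- (b * of_real c) * of_real x)))" for x
      unfolding F_def prod.case c_def[symmetric] exp_add by (simp add: mult_ac)
    show "integrable lborel (\<lambda>x. F s b \<alpha> ((p, q), x))"
      unfolding eq using Gamma_laplace_integrable[OF s bc] unfolding set_integrable_def
      by (rule integrable_mult_right)
    have "(LINT x|lborel. F s b \<alpha> ((p, q), x)) = exp (2 * \<alpha> * of_real p) * (Gamma s * (b * of_real c) powr (- s))"
      unfolding eq integral_mult_right_zero set_lebesgue_integral_def[symmetric]
      by (simp only: Gamma_laplace[OF s bc])
    also have "(b * of_real c) powr (- s) = b powr (- s) * of_real c powr (- s)"
      using b c Ln_times_of_real[of c b] by (auto simp: powr_def Ln_of_real mult_ac algebra_simps simp flip: exp_add)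
    also have "of_real c powr (- s) = 2 powr s * (of_real (2 * cosh p) powr (- s) * of_real (2 * cosh q) powr (- s))"
    proof -
      have ln_c: "ln c = ln (2 * cosh p) + ln (2 * cosh q) - ln 2"
        by (simp add: c_def ln_mult)
      have "- s * complex_of_real (ln c) = s * of_real (ln 2) + (- s * of_real (ln (2 * cosh p)) + - s * of_real (ln (2 * cosh q)))"
        unfolding ln_c of_real_add of_real_diff by algebra
      moreover have "2 powr s = exp (s * of_real (ln 2))" using powr_of_real_exp[of 2 s] by simp
      ultimately show ?thesis
        using c by (simp only: powr_of_real_exp exp_add) (simp add: powr_of_real_exp del: of_real_mult)
    qed
    finally show "(LINT x|lborel. F s b \<alpha> ((p, q), x)) = Gamma s * b powr (- s) * 2 powr s *
       (beta_kernel (s / 2 + \<alpha>) (s / 2 - \<alpha>) (2 * p) * beta_kernel (s / 2) (s / 2) (2 * q))"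
      using beta_kernel_cosh[of s \<alpha> p] beta_kernel_cosh[of s 0 q] by (simp add: mult_ac)
  qed
  have prod: "integrable lborel (\<lambda>(p, q). beta_kernel (s / 2 + \<alpha>) (s / 2 - \<alpha>) (2 * p) * beta_kernel (s / 2) (s / 2) (2 * q))"
    "(LINT pq|lborel. (case pq of (p, q) \<Rightarrow> beta_kernel (s / 2 + \<alpha>) (s / 2 - \<alpha>) (2 * p) * beta_kernel (s / 2) (s / 2) (2 * q))) =
       (Beta (s / 2 + \<alpha>) (s / 2 - \<alpha>) / 2) * (Beta (s / 2) (s / 2) / 2)"
    if s: "\<bar>2 * Re \<alpha>\<bar> < Re s" for s \<alpha>
  proof -
    have p: "Re (s / 2 + \<alpha>) > 0" "Re (s / 2 - \<alpha>) > 0" "Re (s / 2) > 0" using s by auto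
    note K = beta_kernel_double_integral
    show "integrable lborel (\<lambda>(p, q). beta_kernel (s / 2 + \<alpha>) (s / 2 - \<alpha>) (2 * p) * beta_kernel (s / 2) (s / 2) (2 * q))"
      by (intro product_integrable K p)
    show "(LINT pq|lborel. (case pq of (p, q) \<Rightarrow> beta_kernel (s / 2 + \<alpha>) (s / 2 - \<alpha>) (2 * p) * beta_kernel (s / 2) (s / 2) (2 * q))) =
       (Beta (s / 2 + \<alpha>) (s / 2 - \<alpha>) / 2) * (Beta (s / 2) (s / 2) / 2)"
      by (subst product_integrable(2)) (simp_all only: K p)
  qed
  have s0: "Re s > 0" using s by linarith
  have integ: "integrable (lborel \<Otimes>\<^sub>M lborel) (F s b \<alpha>)"
  proof (rule lborel_pair.Fubini_integrable[OF Fm])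
    let ?s = "complex_of_real (Re s)" and ?b = "complex_of_real (Re b)" and ?a = "complex_of_real (Re \<alpha>)"
    (* The absolute value of F is F itself at the real parts of the parameters, so that the
       evaluation of the inner integral applies to it as well. *)
    have norm: "complex_of_real (norm (F s b \<alpha> ((p, q), x))) = F ?s ?b ?a ((p, q), x)" for p q x
    proof (cases "x > 0")
      case True
      have "norm (F s b \<alpha> ((p, q), x)) = x powr (Re s - 1) * exp (- (Re b * x) * (2 * cosh p * cosh q) + 2 * Re \<alpha> * p)"
        using True by (simp add: F_def norm_mult norm_powr_of_real)
      moreover have "complex_of_real (x powr (Re s - 1)) = of_real x powr (?s - 1)"
        using True powr_of_real[of x "Re s - 1"] by simp
      ultimately show ?thesis using True by (simp add: F_def exp_of_real[symmetric])
    qed (simp add: F_def)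
    have "complex_of_real (LINT x|lborel. norm (F s b \<alpha> ((p, q), x))) = (LINT x|lborel. F ?s ?b ?a ((p, q), x))" for p q
      unfolding norm[symmetric] by (rule integral_complex_of_real[symmetric])
    hence eq: "(LINT x|lborel. norm (F s b \<alpha> ((p, q), x))) = Re (Gamma ?s * ?b powr (- ?s) * 2 powr ?s *
       (beta_kernel (?s / 2 + ?a) (?s / 2 - ?a) (2 * p) * beta_kernel (?s / 2) (?s / 2) (2 * q)))" for p q
      using inner(2)[of ?s ?b ?a p q] s0 b by (metis Re_complex_of_real)
    have "integrable lborel (\<lambda>x. Re (Gamma ?s * ?b powr (- ?s) * 2 powr ?s *
       (case x of (p, q) \<Rightarrow> beta_kernel (?s / 2 + ?a) (?s / 2 - ?a) (2 * p) * beta_kernel (?s / 2) (?s / 2) (2 * q))))"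
      using s by (intro integrable_Re integrable_mult_right prod(1)) simp
    moreover have "(\<lambda>x. Re (Gamma ?s * ?b powr (- ?s) * 2 powr ?s *
       (case x of (p, q) \<Rightarrow> beta_kernel (?s / 2 + ?a) (?s / 2 - ?a) (2 * p) * beta_kernel (?s / 2) (?s / 2) (2 * q)))) =
       (\<lambda>pq. LINT x|lborel. norm (F s b \<alpha> (pq, x)))"
      by (rule ext, clarify) (simp only: eq prod.case)
    ultimately show "integrable lborel (\<lambda>pq. LINT x|lborel. norm (F s b \<alpha> (pq, x)))" by simp
    show "AE pq in lborel. integrable lborel (\<lambda>x. F s b \<alpha> (pq, x))"
      using inner(1)[OF s0 b] by (intro AE_I2) auto
  qed
  have K: "(LINT pq|lborel. F s b \<alpha> (pq, x)) = 2 * (indicator {0<..} x *\<^sub>R (of_real x powr (s - 1) * (bessel_K \<alpha> (b * of_real x))\<^sup>2))" for x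
  proof (cases "x > 0")
    case True
    hence z: "Re (b * of_real x) > 0" using b by simp
    have "(LINT pq|lborel. F s b \<alpha> (pq, x)) = (LINT pq|lborel. of_real x powr (s - 1) *
        (case pq of (p, q) \<Rightarrow> exp (- (b * of_real x) * of_real (2 * cosh p * cosh q) + 2 * \<alpha> * of_real p)))"
      using True by (intro Bochner_Integration.integral_cong refl) (auto simp: F_def)
    also have "\<dots> = of_real x powr (s - 1) * (2 * (bessel_K \<alpha> (b * of_real x))\<^sup>2)"
      unfolding integral_mult_right_zero bessel_K_square(2)[OF z] by simp
    finally show ?thesis using True by simp
  qed (simp add: F_def case_prod_unfold)
  have i: "integrable lborel (\<lambda>x. LINT pq|lborel. F s b \<alpha> (pq, x))"
    using lborel_pair.integrable_snd[of "\<lambda>x y. F s b \<alpha> (x, y)"] integ by simp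
  from integrable_mult_right[OF this, of "1/2"]
  show "set_integrable lborel {0<..} (\<lambda>x. of_real x powr (s - 1) * (bessel_K \<alpha> (b * of_real x))\<^sup>2)"
    unfolding K set_integrable_def by simp
  have "(LINT x|lborel. LINT pq|lborel. F s b \<alpha> (pq, x)) = (LINT pq|lborel. LINT x|lborel. F s b \<alpha> (pq, x))"
    using lborel_pair.Fubini_integral[of "\<lambda>x y. F s b \<alpha> (x, y)"] integ by simp
  also have "(\<lambda>pq. LINT x|lborel. F s b \<alpha> (pq, x)) = (\<lambda>pq. Gamma s * b powr (- s) * 2 powr s *
       (case pq of (p, q) \<Rightarrow> beta_kernel (s / 2 + \<alpha>) (s / 2 - \<alpha>) (2 * p) * beta_kernel (s / 2) (s / 2) (2 * q)))"
    by (rule ext, clarify) (simp only: inner(2)[OF s0 b] prod.case)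
  finally have "2 * (LINT x:{0<..}|lborel. of_real x powr (s - 1) * (bessel_K \<alpha> (b * of_real x))\<^sup>2) =
      Gamma s * b powr (- s) * 2 powr s * ((Beta (s / 2 + \<alpha>) (s / 2 - \<alpha>) / 2) * (Beta (s / 2) (s / 2) / 2))"
    unfolding K integral_mult_right_zero prod(2)[OF s] set_lebesgue_integral_def .
  moreover have "Gamma s \<noteq> 0" using s0 by (rule Gamma_nonzero_Re_pos)
  ultimately show "(LINT x:{0<..}|lborel. of_real x powr (s - 1) * (bessel_K \<alpha> (b * of_real x))\<^sup>2) =
           2 powr s * b powr (- s) / 8 * (Gamma (s / 2 + \<alpha>) * Gamma (s / 2 - \<alpha>) * Gamma (s / 2) ^ 2 / Gamma s)"
    by (simp add: Beta_def power2_eq_square field_simps)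
qed

lemma mellin_bessel_K_real_square:
  fixes c \<sigma> B :: real
  assumes c: "\<bar>2 * \<sigma>\<bar> < c" and B: "B > 0"
  shows "integrable lborel (\<lambda>x. indicator {0<..} x * (x powr (c - 1) * (bessel_K_real \<sigma> (B * x))\<^sup>2))"
proof -
  have "integrable lborel (\<lambda>x. Re (indicator {0<..} x *\<^sub>R (of_real x powr (of_real c - 1) * (bessel_K (of_real \<sigma>) (of_real B * of_real x))\<^sup>2)))"
    using mellin_bessel_K_square(1)[of "of_real \<sigma>" "of_real c" "of_real B"] c B
    unfolding set_integrable_def by (intro integrable_Re) auto
  also have "(\<lambda>x. Re (indicator {0<..} x *\<^sub>R (of_real x powr (of_real c - 1) * (bessel_K (of_real \<sigma>) (of_real B * of_real x))\<^sup>2))) =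
      (\<lambda>x. indicator {0<..} x * (x powr (c - 1) * (bessel_K_real \<sigma> (B * x))\<^sup>2))"
  proof
    fix x :: real
    show "Re (indicator {0<..} x *\<^sub>R (of_real x powr (of_real c - 1) * (bessel_K (of_real \<sigma>) (of_real B * of_real x))\<^sup>2)) =
        indicator {0<..} x * (x powr (c - 1) * (bessel_K_real \<sigma> (B * x))\<^sup>2)"
    proof (cases "x > 0")
      case True
      have "complex_of_real (x powr (c - 1)) = of_real x powr (of_real c - 1)"
        using True powr_of_real[of x "c - 1"] by simp
      moreover have "bessel_K (of_real \<sigma>) (of_real B * of_real x) = of_real (bessel_K_real \<sigma> (B * x))"
        using bessel_K_of_real[of "B * x" \<sigma>] B True by simp
      ultimately have "of_real x powr (of_real c - 1) * (bessel_K (of_real \<sigma>) (of_real B * of_real x))\<^sup>2 =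
          complex_of_real (x powr (c - 1) * (bessel_K_real \<sigma> (B * x))\<^sup>2)" by simp
      thus ?thesis using True by (simp only: Re_complex_of_real scaleR_complex.sel)
    qed simp
  qed
  finally show ?thesis .
qed

section \<open>Domination, termwise integration and holomorphy in the parameter\<close>

lemma Ln_divide_right_half_plane:
  assumes "Re a > 0" "Re b > 0"
  shows "Ln (a / b) = Ln a - Ln b"
proof (rule Ln_unique)
  have nz: "a \<noteq> 0" "b \<noteq> 0" using assms by auto
  thus "exp (Ln a - Ln b) = a / b" by (simp add: exp_diff)
  have "\<bar>Im (Ln a)\<bar> < pi / 2" "\<bar>Im (Ln b)\<bar> < pi / 2" using assms nz Re_Ln_pos_lt by auto
  thus "- pi < Im (Ln a - Ln b)" "Im (Ln a - Ln b) \<le> pi" by auto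
qed

lemma powr_divide_right_half_plane:
  assumes "Re a > 0" "Re b > 0"
  shows "(a / b) powr c = a powr c * b powr (- c)"
proof -
  have "a \<noteq> 0" "b \<noteq> 0" using assms by auto
  thus ?thesis using assms
    by (simp add: powr_def Ln_divide_right_half_plane algebra_simps flip: exp_add)
qed

lemma powr_mult_of_real:
  fixes a c :: complex
  assumes "x > 0" "a \<noteq> 0"
  shows "(a * of_real x) powr c = a powr c * of_real x powr c"
  using assms Ln_times_of_real[of x a]
  by (auto simp: powr_def Ln_of_real algebra_simps simp flip: exp_add)

text \<open>
  The argument of \<open>z\<close> enters only through \<open>Im c\<close> and is at most \<open>\<pi>\<close> in absolute value.
\<close>
lemma norm_powr_le:
  assumes "z \<noteq> 0"
  shows "norm (z powr c) \<le> norm z powr Re c * exp (\<bar>Im c\<bar> * pi)"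
proof -
  have "norm (z powr c) = exp (Re c * ln (norm z) + - (Im c * Im (Ln z)))"
    using assms by (simp add: powr_def)
  also have "\<dots> = norm z powr Re c * exp (- (Im c * Im (Ln z)))"
    using assms by (simp only: exp_add) (simp add: powr_def)
  also have "- (Im c * Im (Ln z)) \<le> \<bar>Im c\<bar> * \<bar>Im (Ln z)\<bar>" by (simp flip: abs_mult)
  also have "\<dots> \<le> \<bar>Im c\<bar> * pi"
    using mpi_less_Im_Ln[OF assms] Im_Ln_le_pi[OF assms] by (intro mult_left_mono) auto
  finally show ?thesis by (simp add: mult_left_mono)
qed

lemma norm_half_powr_le:
  assumes x: "x > 0" and a: "a \<noteq> 0"
  shows "norm ((a * of_real x / 2) powr c) \<le> (norm a / 2) powr Re c * x powr Re c * exp (\<bar>Im c\<bar> * pi)"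
proof -
  have "norm ((a * of_real x / 2) powr c) \<le> norm (a * of_real x / 2) powr Re c * exp (\<bar>Im c\<bar> * pi)"
    using x a by (intro norm_powr_le) simp
  also have "norm (a * of_real x / 2) = norm a / 2 * x" using x by (simp add: norm_mult norm_divide)
  also have "(norm a / 2 * x) powr Re c = (norm a / 2) powr Re c * x powr Re c" by (rule powr_mult)
  finally show ?thesis .
qed

lemma power_mult_powr_square:
  fixes x \<sigma> :: real
  assumes "x > 0"
  shows "x ^ m * (x powr \<sigma>)\<^sup>2 = x powr (2 * \<sigma> + m)"
  unfolding mult_2 powr_add powr_realpow[OF assms] power2_eq_square by (simp only: mult_ac)

lemma bessel_phi_holomorphic:
  assumes \<alpha>: "Re \<alpha> > -1/2"
  shows "bessel_phi \<alpha> holomorphic_on UNIV"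
proof -
  have "bessel_phi \<alpha> holomorphic_on ball 0 r" for r
  proof (rule power_series_holomorphic)
    fix w :: complex
    have "(\<lambda>k. rGamma (of_nat k + \<alpha> + 1) / fact k * ((2 * csqrt w / 2)\<^sup>2) ^ k) sums bessel_phi \<alpha> ((2 * csqrt w / 2)\<^sup>2)"
      unfolding bessel_phi_def
      by (intro summable_sums summable_norm_cancel[OF bessel_phi_abs_bound(1)[OF \<alpha>]])
    thus "(\<lambda>k. rGamma (of_nat k + \<alpha> + 1) / fact k * (w - 0) ^ k) sums bessel_phi \<alpha> w" by simp
  qed
  hence "bessel_phi \<alpha> field_differentiable at w" for w
    using holomorphic_on_imp_differentiable_at[of "bessel_phi \<alpha>" "ball 0 (norm w + 1)" w] by simp
  thus ?thesis by (auto simp: holomorphic_on_def field_differentiable_at_within)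
qed

lemma bessel_I_holomorphic:
  assumes \<alpha>: "Re \<alpha> > -1/2"
  shows "bessel_I \<alpha> holomorphic_on {z. Re z > 0}"
proof -
  have "(\<lambda>z. (z / 2) powr \<alpha> * bessel_phi \<alpha> ((z / 2)\<^sup>2)) holomorphic_on {z. Re z > 0}"
    by (intro holomorphic_intros holomorphic_on_compose_gen[OF _ bessel_phi_holomorphic[OF \<alpha>], unfolded o_def])
       (auto elim!: nonpos_Reals_cases simp: complex_eq_iff)
  moreover have "(z / 2) powr \<alpha> * bessel_phi \<alpha> ((z / 2)\<^sup>2) = bessel_I \<alpha> z" if "z \<in> {z. Re z > 0}" for z
    using that by (intro bessel_I_phi[OF \<alpha>, symmetric]) auto
  ultimately show ?thesis by (rule holomorphic_transform)
qed

text \<open>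
  The exponent \<open>m\<close> is \<open>0\<close> in the first formula and \<open>1\<close> in the second; both are treated together until the
  constants are computed. The indicator turns set integrals into integrals over the line.
\<close>
definition bessel_integrand :: "nat \<Rightarrow> complex \<Rightarrow> complex \<Rightarrow> complex \<Rightarrow> real \<Rightarrow> complex" where
  "bessel_integrand m \<alpha> b a x =
     indicator {0<..} x *\<^sub>R (of_real x ^ m * (bessel_I \<alpha> (a * of_real x))\<^sup>2 * (bessel_K \<alpha> (b * of_real x))\<^sup>2)"

text \<open>
  The integrand with real parameters \<open>\<sigma> = Re \<alpha>\<close>, \<open>A = Re a\<close>, \<open>B = Re b\<close>, up to a constant.
\<close>
definition integrand_majorant :: "nat \<Rightarrow> real \<Rightarrow> real \<Rightarrow> real \<Rightarrow> real \<Rightarrow> real" where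
  "integrand_majorant m \<sigma> A B x =
     indicator {0<..} x * (x powr (2 * \<sigma> + m) * (bessel_majorant \<sigma> (A * x))\<^sup>2 * (bessel_K_real \<sigma> (B * x))\<^sup>2)"

definition majorant_const :: "complex \<Rightarrow> real" where
  "majorant_const \<alpha> = exp (\<bar>Im \<alpha>\<bar> * pi) / norm (Gamma (1/2) * Gamma (\<alpha> + 1/2))"

lemma bessel_integrand_measurable [measurable]: "bessel_integrand m \<alpha> b a \<in> borel_measurable borel"
  unfolding bessel_integrand_def bessel_I_def by measurable

lemma norm_bessel_integrand_le:
  assumes \<alpha>: "Re \<alpha> > -1/2" and a: "Re a > 0" and b: "Re b > 0"
  shows "norm (bessel_integrand m \<alpha> b a x) \<le>
           (majorant_const \<alpha> * (norm a / 2) powr Re \<alpha>)\<^sup>2 * integrand_majorant m (Re \<alpha>) (Re a) (Re b) x"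
proof (cases "x > 0")
  case True
  let ?\<sigma> = "Re \<alpha>"
  have nz: "a * of_real x \<noteq> 0" using a True by auto
  have p: "norm ((a * of_real x / 2) powr \<alpha>) \<le> (norm a / 2) powr ?\<sigma> * x powr ?\<sigma> * exp (\<bar>Im \<alpha>\<bar> * pi)"
    using a by (intro norm_half_powr_le True) auto
  have "norm (bessel_I \<alpha> (a * of_real x)) = norm ((a * of_real x / 2) powr \<alpha>) * norm (bessel_phi \<alpha> ((a * of_real x / 2)\<^sup>2))"
    using bessel_I_phi[OF \<alpha> nz] by (simp add: norm_mult)
  also have "\<dots> \<le> ((norm a / 2) powr ?\<sigma> * x powr ?\<sigma> * exp (\<bar>Im \<alpha>\<bar> * pi)) *
      (bessel_majorant ?\<sigma> (Re (a * of_real x)) / norm (Gamma (1/2) * Gamma (\<alpha> + 1/2)))"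
    by (intro mult_mono p norm_bessel_phi_le[OF \<alpha>]) auto
  also have "\<dots> = (majorant_const \<alpha> * (norm a / 2) powr ?\<sigma>) * (x powr ?\<sigma> * bessel_majorant ?\<sigma> (Re a * x))"
    by (simp add: majorant_const_def)
  finally have I: "norm (bessel_I \<alpha> (a * of_real x)) \<le> (majorant_const \<alpha> * (norm a / 2) powr ?\<sigma>) * (x powr ?\<sigma> * bessel_majorant ?\<sigma> (Re a * x))" .
  have K: "norm (bessel_K \<alpha> (b * of_real x)) \<le> bessel_K_real ?\<sigma> (Re b * x)"
    using norm_bessel_K_le[of "b * of_real x" \<alpha>] b True by simp
  have "norm (bessel_integrand m \<alpha> b a x) = x ^ m * (norm (bessel_I \<alpha> (a * of_real x)))\<^sup>2 * (norm (bessel_K \<alpha> (b * of_real x)))\<^sup>2"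
    using True by (simp add: bessel_integrand_def norm_mult norm_power)
  also have "\<dots> \<le> x ^ m * ((majorant_const \<alpha> * (norm a / 2) powr ?\<sigma>) * (x powr ?\<sigma> * bessel_majorant ?\<sigma> (Re a * x)))\<^sup>2 * (bessel_K_real ?\<sigma> (Re b * x))\<^sup>2"
    using True by (intro mult_mono power_mono I K mult_nonneg_nonneg) auto
  also have "x ^ m * ((majorant_const \<alpha> * (norm a / 2) powr ?\<sigma>) * (x powr ?\<sigma> * bessel_majorant ?\<sigma> (Re a * x)))\<^sup>2 =
      (majorant_const \<alpha> * (norm a / 2) powr ?\<sigma>)\<^sup>2 * ((x ^ m * (x powr ?\<sigma>)\<^sup>2) * (bessel_majorant ?\<sigma> (Re a * x))\<^sup>2)"
    by (simp add: power_mult_distrib mult_ac)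
  also have "x ^ m * (x powr ?\<sigma>)\<^sup>2 = x powr (2 * ?\<sigma> + m)"
    by (rule power_mult_powr_square[OF True])
  finally show ?thesis using True by (simp add: integrand_majorant_def mult_ac)
qed (simp add: bessel_integrand_def integrand_majorant_def)

lemma bessel_majorant_measurable [measurable]: "(\<lambda>x. bessel_majorant \<sigma> (A * x)) \<in> borel_measurable borel"
  unfolding bessel_majorant_def cosh_def beta_kernel_def logistic_def by measurable

lemma integrand_majorant_measurable [measurable]: "integrand_majorant m \<sigma> A B \<in> borel_measurable borel"
  unfolding integrand_majorant_def by measurable

lemma integrand_majorant_nonneg: "integrand_majorant m \<sigma> A B x \<ge> 0"
  by (simp add: integrand_majorant_def)

text \<open>
  Both the growth of the majorant of \<open>I\<close> and the gap \<open>B - A\<close> are absorbed into \<open>K_\<sigma>((B - A)x)\<close>. The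
  second condition on \<open>\<sigma>\<close> is the condition for the Mellin integral to converge at \<open>0\<close>; for negative \<open>\<sigma>\<close>
  it reads \<open>\<sigma> > -(m+1)/4\<close>.
\<close>
lemma integrand_majorant_integrable_less:
  assumes \<sigma>: "\<sigma> > -1/2" "\<bar>2 * \<sigma>\<bar> < 2 * \<sigma> + m + 1" and AB: "0 \<le> A" "A < B"
  shows "integrable lborel (integrand_majorant m \<sigma> A B)"
proof -
  define g where "g x = (bessel_majorant \<sigma> 0)\<^sup>2 *
     (indicator {0<..} x * (x powr ((2 * \<sigma> + m + 1) - 1) * (bessel_K_real \<sigma> ((B - A) * x))\<^sup>2))" for x
  have gi: "integrable lborel g"
    unfolding g_def using AB \<sigma> by (intro integrable_mult_right mellin_bessel_K_real_square) auto
  show ?thesis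
  proof (rule Bochner_Integration.integrable_bound[OF gi])
    show "AE x in lborel. norm (integrand_majorant m \<sigma> A B x) \<le> norm (g x)"
    proof (rule AE_I2)
      fix x :: real
      show "norm (integrand_majorant m \<sigma> A B x) \<le> norm (g x)"
      proof (cases "x > 0")
        case True
        have "bessel_majorant \<sigma> (A * x) * bessel_K_real \<sigma> (B * x) \<le> (bessel_majorant \<sigma> 0 * exp (A * x)) * bessel_K_real \<sigma> (B * x)"
          using True AB by (intro mult_right_mono bessel_majorant_exp_bound \<sigma> bessel_K_real_nonneg) auto
        also have "\<dots> = bessel_majorant \<sigma> 0 * (exp (A * x) * bessel_K_real \<sigma> (B * x))" by simp
        also have "\<dots> \<le> bessel_majorant \<sigma> 0 * bessel_K_real \<sigma> (B * x - A * x)"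
          using True AB by (intro mult_left_mono bessel_K_real_exp_absorb bessel_majorant_nonneg) auto
        finally have "bessel_majorant \<sigma> (A * x) * bessel_K_real \<sigma> (B * x) \<le> bessel_majorant \<sigma> 0 * bessel_K_real \<sigma> ((B - A) * x)"
          by (simp add: algebra_simps)
        hence "(bessel_majorant \<sigma> (A * x) * bessel_K_real \<sigma> (B * x))\<^sup>2 \<le> (bessel_majorant \<sigma> 0 * bessel_K_real \<sigma> ((B - A) * x))\<^sup>2"
          by (intro power_mono mult_nonneg_nonneg bessel_majorant_nonneg bessel_K_real_nonneg)
        hence "x powr (2 * \<sigma> + m) * (bessel_majorant \<sigma> (A * x) * bessel_K_real \<sigma> (B * x))\<^sup>2 \<le>
            x powr (2 * \<sigma> + m) * (bessel_majorant \<sigma> 0 * bessel_K_real \<sigma> ((B - A) * x))\<^sup>2"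
          by (intro mult_left_mono) auto
        thus ?thesis using True by (simp add: integrand_majorant_def g_def power_mult_distrib mult_ac)
      qed (simp add: integrand_majorant_def g_def)
    qed
  qed simp
qed

lemma bessel_integrand_integrable:
  assumes "Re \<alpha> > -1/2" "Re a > 0" "Re b > 0"
    and "integrable lborel (integrand_majorant m (Re \<alpha>) (Re a) (Re b))"
  shows "integrable lborel (bessel_integrand m \<alpha> b a)"
proof (rule Bochner_Integration.integrable_bound)
  show "integrable lborel (\<lambda>x. (majorant_const \<alpha> * (norm a / 2) powr Re \<alpha>)\<^sup>2 * integrand_majorant m (Re \<alpha>) (Re a) (Re b) x)"
    using assms(4) by simp
  show "AE x in lborel. norm (bessel_integrand m \<alpha> b a x) \<le>
      norm ((majorant_const \<alpha> * (norm a / 2) powr Re \<alpha>)\<^sup>2 * integrand_majorant m (Re \<alpha>) (Re a) (Re b) x)"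
    using norm_bessel_integrand_le[OF assms(1-3), of m] integrand_majorant_nonneg by (intro AE_I2) auto
qed simp

text \<open>
  The integral of the \<open>k\<close>-th term of the series for the integrand.
\<close>
definition mellin_term :: "nat \<Rightarrow> complex \<Rightarrow> complex \<Rightarrow> complex \<Rightarrow> nat \<Rightarrow> complex" where
  "mellin_term m \<alpha> b a k = (let s = 2 * \<alpha> + 2 * of_nat k + of_nat m + 1 in
     (a / 2) powr (2 * \<alpha>) * bessel_sq_coeff \<alpha> k * ((a / 2)\<^sup>2) ^ k *
     (2 powr s * b powr (- s) / 8 * (Gamma (s / 2 + \<alpha>) * Gamma (s / 2 - \<alpha>) * Gamma (s / 2) ^ 2 / Gamma s)))"

definition series_summand :: "nat \<Rightarrow> complex \<Rightarrow> complex \<Rightarrow> complex \<Rightarrow> nat \<Rightarrow> real \<Rightarrow> complex" where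
  "series_summand m \<alpha> b a k x = (a / 2) powr (2 * \<alpha>) * bessel_sq_coeff \<alpha> k * ((a / 2)\<^sup>2) ^ k *
     (indicator {0<..} x *\<^sub>R (of_real x powr (2 * \<alpha> + 2 * of_nat k + of_nat m + 1 - 1) * (bessel_K \<alpha> (b * of_real x))\<^sup>2))"

lemma series_summand_integral:
  assumes \<alpha>: "\<bar>2 * Re \<alpha>\<bar> < 2 * Re \<alpha> + m + 1" and b: "Re b > 0"
  shows "integrable lborel (series_summand m \<alpha> b a k)"
    and "(LINT x|lborel. series_summand m \<alpha> b a k x) = mellin_term m \<alpha> b a k"
proof -
  define s where "s = 2 * \<alpha> + 2 * of_nat k + of_nat m + 1"
  have s: "\<bar>2 * Re \<alpha>\<bar> < Re s" using \<alpha> by (simp add: s_def)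
  show "integrable lborel (series_summand m \<alpha> b a k)"
    unfolding series_summand_def s_def[symmetric]
    using mellin_bessel_K_square(1)[OF s b] unfolding set_integrable_def by (rule integrable_mult_right)
  show "(LINT x|lborel. series_summand m \<alpha> b a k x) = mellin_term m \<alpha> b a k"
    unfolding series_summand_def mellin_term_def s_def[symmetric] Let_def integral_mult_right_zero
    using mellin_bessel_K_square(2)[OF s b] unfolding set_lebesgue_integral_def by simp
qed

lemma series_summand_eq:
  assumes a: "Re a > 0" and x: "x > 0"
  shows "series_summand m \<alpha> b a k x =
    of_real x ^ m * (((a * of_real x / 2) powr \<alpha>)\<^sup>2 * (bessel_sq_coeff \<alpha> k * ((a * of_real x / 2)\<^sup>2) ^ k)) * (bessel_K \<alpha> (b * of_real x))\<^sup>2"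
proof -
  have nz: "a / 2 \<noteq> 0" using a by auto
  have "((a * of_real x / 2) powr \<alpha>)\<^sup>2 = (a / 2 * of_real x) powr (2 * \<alpha>)"
    by (simp only: power2_eq_square mult_2 powr_add times_divide_eq_left)
  also have "\<dots> = (a / 2) powr (2 * \<alpha>) * of_real x powr (2 * \<alpha>)"
    by (rule powr_mult_of_real[OF x nz])
  finally have 1: "((a * of_real x / 2) powr \<alpha>)\<^sup>2 = (a / 2) powr (2 * \<alpha>) * of_real x powr (2 * \<alpha>)" .
  have pn: "complex_of_real x powr of_nat n = of_real x ^ n" for n
    using x powr_nat'[of "complex_of_real x" n] by simp
  have "complex_of_real x powr (2 * \<alpha> + 2 * of_nat k + of_nat m + 1 - 1) =
      of_real x powr (2 * \<alpha>) * of_real x powr of_nat (2 * k) * of_real x powr of_nat m"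
    by (simp add: powr_add)
  also have "\<dots> = of_real x powr (2 * \<alpha>) * (of_real x ^ m * ((of_real x)\<^sup>2) ^ k)"
    unfolding pn by (simp add: power_mult)
  finally have 2: "complex_of_real x powr (2 * \<alpha> + 2 * of_nat k + of_nat m + 1 - 1) = of_real x powr (2 * \<alpha>) * (of_real x ^ m * ((of_real x)\<^sup>2) ^ k)" .
  have 3: "((a * of_real x / 2)\<^sup>2) ^ k = ((a / 2)\<^sup>2) ^ k * ((of_real x)\<^sup>2) ^ k"
    by (simp add: power_mult_distrib power_divide)
  show ?thesis unfolding series_summand_def 1 2 3 using x by simp
qed

lemma series_summand_sums:
  assumes \<alpha>: "Re \<alpha> > -1/2" and a: "Re a > 0"
  shows "(\<lambda>k. series_summand m \<alpha> b a k x) sums bessel_integrand m \<alpha> b a x"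
proof (cases "x > 0")
  case True
  have nz: "a * of_real x \<noteq> 0" using a True by auto
  have "(\<lambda>k. of_real x ^ m * (((a * of_real x / 2) powr \<alpha>)\<^sup>2 * (bessel_sq_coeff \<alpha> k * ((a * of_real x / 2)\<^sup>2) ^ k)) * (bessel_K \<alpha> (b * of_real x))\<^sup>2) sums
     (of_real x ^ m * (((a * of_real x / 2) powr \<alpha>)\<^sup>2 * (bessel_phi \<alpha> ((a * of_real x / 2)\<^sup>2))\<^sup>2) * (bessel_K \<alpha> (b * of_real x))\<^sup>2)"
    by (intro sums_mult sums_mult2 bessel_phi_square(1)[OF \<alpha>])
  thus ?thesis using True
    by (simp add: series_summand_eq[OF a True] bessel_integrand_def bessel_I_phi[OF \<alpha> nz] power_mult_distrib)
qed (simp add: series_summand_def bessel_integrand_def)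

text \<open>
  The partial sums are dominated by replacing every coefficient by its absolute value, which costs the
  factor \<open>e^{2|a|x}\<close>. It is absorbed by \<open>K_\<sigma>(Re b x)^2\<close> when \<open>|a| < Re b\<close>.
\<close>
lemma termwise_integration:
  assumes \<alpha>: "Re \<alpha> > -1/2" "\<bar>2 * Re \<alpha>\<bar> < 2 * Re \<alpha> + m + 1" and a: "Re a > 0" "norm a < Re b"
  shows "mellin_term m \<alpha> b a sums (LINT x|lborel. bessel_integrand m \<alpha> b a x)"
proof -
  let ?\<sigma> = "Re \<alpha>" and ?B = "Re b"
  have b: "?B > 0" using a norm_ge_zero[of a] by linarith
  define C where "C = (norm (rGamma (\<alpha> + 1)))\<^sup>2 * ((norm a / 2) powr ?\<sigma> * exp (\<bar>Im \<alpha>\<bar> * pi))\<^sup>2"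
  define w where "w x = C * (indicator {0<..} x * (x powr ((2 * ?\<sigma> + m + 1) - 1) * (bessel_K_real ?\<sigma> ((?B - norm a) * x))\<^sup>2))" for x
  have wi: "integrable lborel w" unfolding w_def
    using a \<alpha>(2) by (intro integrable_mult_right mellin_bessel_K_real_square) auto
  have bound: "norm (\<Sum>k<n. series_summand m \<alpha> b a k x) \<le> w x" for n x
  proof (cases "x > 0")
    case True
    define P where "P = (\<Sum>k<n. bessel_sq_coeff \<alpha> k * ((a * of_real x / 2)\<^sup>2) ^ k)"
    have p: "norm ((a * of_real x / 2) powr \<alpha>) \<le> (norm a / 2) powr ?\<sigma> * x powr ?\<sigma> * exp (\<bar>Im \<alpha>\<bar> * pi)"
      using a by (intro norm_half_powr_le True) auto
    have Pb: "norm P \<le> (norm (rGamma (\<alpha> + 1)) * exp (norm a * x))\<^sup>2"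
      using bessel_phi_square(2)[OF \<alpha>(1), of "a * of_real x" n] True by (simp add: P_def norm_mult)
    have K: "norm (bessel_K \<alpha> (b * of_real x)) \<le> bessel_K_real ?\<sigma> (?B * x)"
      using norm_bessel_K_le[of "b * of_real x" \<alpha>] b True by simp
    have ab: "exp (norm a * x) * bessel_K_real ?\<sigma> (?B * x) \<le> bessel_K_real ?\<sigma> ((?B - norm a) * x)"
      using bessel_K_real_exp_absorb[of "norm a * x" "?B * x" ?\<sigma>] True a by (simp add: left_diff_distrib)
    have xp: "x ^ m * (x powr ?\<sigma>)\<^sup>2 = x powr (2 * ?\<sigma> + m)"
      by (rule power_mult_powr_square[OF True])
    have "(\<Sum>k<n. series_summand m \<alpha> b a k x) = of_real x ^ m * (((a * of_real x / 2) powr \<alpha>)\<^sup>2 * P) * (bessel_K \<alpha> (b * of_real x))\<^sup>2"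
      by (simp add: series_summand_eq[OF a(1) True] P_def sum_distrib_left sum_distrib_right)
    hence "norm (\<Sum>k<n. series_summand m \<alpha> b a k x) = x ^ m * ((norm ((a * of_real x / 2) powr \<alpha>))\<^sup>2 * norm P) * (norm (bessel_K \<alpha> (b * of_real x)))\<^sup>2"
      using True by (simp add: norm_mult norm_power)
    also have "\<dots> \<le> x ^ m * (((norm a / 2) powr ?\<sigma> * x powr ?\<sigma> * exp (\<bar>Im \<alpha>\<bar> * pi))\<^sup>2 * (norm (rGamma (\<alpha> + 1)) * exp (norm a * x))\<^sup>2) * (bessel_K_real ?\<sigma> (?B * x))\<^sup>2"
      using True by (intro mult_mono power_mono p Pb K mult_nonneg_nonneg) auto
    also have "\<dots> = C * ((x ^ m * (x powr ?\<sigma>)\<^sup>2) * (exp (norm a * x) * bessel_K_real ?\<sigma> (?B * x))\<^sup>2)"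
      by (simp add: C_def power_mult_distrib mult_ac)
    also have "\<dots> \<le> C * (x powr (2 * ?\<sigma> + m) * (bessel_K_real ?\<sigma> ((?B - norm a) * x))\<^sup>2)"
      unfolding xp
      by (intro mult_left_mono power_mono ab mult_nonneg_nonneg bessel_K_real_nonneg) (auto simp: C_def)
    finally show ?thesis using True by (simp add: w_def)
  qed (simp add: series_summand_def w_def)
  have "(\<lambda>n. LINT x|lborel. (\<Sum>k<n. series_summand m \<alpha> b a k x)) \<longlonglongrightarrow> (LINT x|lborel. bessel_integrand m \<alpha> b a x)"
  proof (rule integral_dominated_convergence[OF _ _ wi])
    show "(\<lambda>x. \<Sum>k<n. series_summand m \<alpha> b a k x) \<in> borel_measurable lborel" for n
      unfolding series_summand_def by measurable
    show "AE x in lborel. (\<lambda>n. \<Sum>k<n. series_summand m \<alpha> b a k x) \<longlonglongrightarrow> bessel_integrand m \<alpha> b a x"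
      using series_summand_sums[OF \<alpha>(1) a(1), of m b] by (intro AE_I2) (simp add: sums_def)
  qed (use bound in auto)
  also have "(\<lambda>n. LINT x|lborel. (\<Sum>k<n. series_summand m \<alpha> b a k x)) = (\<lambda>n. \<Sum>k<n. mellin_term m \<alpha> b a k)"
    using series_summand_integral[OF \<alpha>(2) b] by (subst Bochner_Integration.integral_sum) auto
  finally show ?thesis by (simp add: sums_def)
qed

text \<open>
  Near a point of the strip the real part of the parameter stays below some \<open>A < Re b\<close>, and a single
  majorant with this \<open>A\<close> serves the whole neighbourhood.
\<close>
lemma bessel_integral_holomorphic:
  assumes \<alpha>: "Re \<alpha> > -1/2" "\<bar>2 * Re \<alpha>\<bar> < 2 * Re \<alpha> + m + 1"
  shows "(\<lambda>a. LINT x|lborel. bessel_integrand m \<alpha> b a x) holomorphic_on {a. 0 < Re a \<and> Re a < Re b}"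
proof (rule holomorphic_on_parameter_integral)
  let ?S = "{a. 0 < Re a \<and> Re a < Re b}" and ?\<sigma> = "Re \<alpha>"
  show "open ?S"
    by (intro open_Collect_conj) (auto intro: open_halfspace_Re_gt open_halfspace_Re_lt)
  show "(\<lambda>a. bessel_integrand m \<alpha> b a x) holomorphic_on ?S" for x
  proof (cases "x > 0")
    case True
    have "(\<lambda>a. bessel_I \<alpha> (a * of_real x)) holomorphic_on ?S"
      using True by (intro holomorphic_on_compose_gen[OF _ bessel_I_holomorphic[OF \<alpha>(1)], unfolded o_def] holomorphic_intros) auto
    thus ?thesis unfolding bessel_integrand_def scaleR_conv_of_real by (intro holomorphic_intros)
  qed (simp add: bessel_integrand_def)
  show "bessel_integrand m \<alpha> b a \<in> borel_measurable lborel" for a by simp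
  fix a0 assume "a0 \<in> ?S"
  hence a0: "0 < Re a0" "Re a0 < Re b" by auto
  define r where "r = min (Re a0) (Re b - Re a0) / 2"
  have r: "r > 0" "r < Re a0" "Re a0 + r < Re b" using a0 by (auto simp: r_def min_def field_simps)
  (* The sum covers both signs of the exponent: the power is increasing or decreasing. *)
  define W where "W = (((norm a0 + r) / 2) powr ?\<sigma> + ((Re a0 - r) / 2) powr ?\<sigma>)"
  have w: "Re w > 0" "Re w < Re a0 + r" "(norm w / 2) powr ?\<sigma> \<le> W" if "w \<in> ball a0 r" for w
  proof -
    have d: "norm (w - a0) < r" using that by (simp add: dist_norm norm_minus_commute)
    have "\<bar>Re (w - a0)\<bar> < r" using d abs_Re_le_cmod[of "w - a0"] by linarith
    thus 1: "Re w > 0" "Re w < Re a0 + r" using r by auto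
    have up: "norm w \<le> norm a0 + r" using d norm_triangle_ineq[of "w - a0" a0] by simp
    have lo: "Re a0 - r \<le> norm w" using \<open>\<bar>Re (w - a0)\<bar> < r\<close> complex_Re_le_cmod[of w] by simp
    show "(norm w / 2) powr ?\<sigma> \<le> W"
    proof (cases "?\<sigma> \<ge> 0")
      case True
      hence "(norm w / 2) powr ?\<sigma> \<le> ((norm a0 + r) / 2) powr ?\<sigma>" using up by (intro powr_mono2) auto
      thus ?thesis by (simp add: W_def add_increasing2)
    next
      case False
      hence "(norm w / 2) powr ?\<sigma> \<le> ((Re a0 - r) / 2) powr ?\<sigma>" using lo r by (intro powr_mono2') auto
      thus ?thesis by (simp add: W_def add_increasing)
    qed
  qed
  define g where "g x = (majorant_const \<alpha> * W)\<^sup>2 * integrand_majorant m ?\<sigma> (Re a0 + r) (Re b) x" for x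
  have "integrable lborel g" unfolding g_def
    using r a0 \<alpha> by (intro integrable_mult_right integrand_majorant_integrable_less) auto
  moreover have "norm (bessel_integrand m \<alpha> b w x) \<le> g x" if wb: "w \<in> ball a0 r" for w x
  proof -
    have mc: "majorant_const \<alpha> \<ge> 0" by (simp add: majorant_const_def)
    have mono: "integrand_majorant m ?\<sigma> (Re w) (Re b) x \<le> integrand_majorant m ?\<sigma> (Re a0 + r) (Re b) x"
    proof (cases "x > 0")
      case True
      have "bessel_majorant ?\<sigma> (Re w * x) \<le> bessel_majorant ?\<sigma> ((Re a0 + r) * x)"
        using True w[OF wb] by (intro bessel_majorant_mono \<alpha>) auto
      thus ?thesis using True
        by (auto simp: integrand_majorant_def intro!: mult_right_mono mult_left_mono power_mono bessel_majorant_nonneg)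
    qed (simp add: integrand_majorant_def)
    have "norm (bessel_integrand m \<alpha> b w x) \<le> (majorant_const \<alpha> * (norm w / 2) powr ?\<sigma>)\<^sup>2 * integrand_majorant m ?\<sigma> (Re w) (Re b) x"
      using a0 w[OF wb] by (intro norm_bessel_integrand_le \<alpha>) auto
    also have "\<dots> \<le> g x" unfolding g_def
      using w[OF wb] mc by (intro mult_mono power_mono mono mult_left_mono integrand_majorant_nonneg) auto
    finally show ?thesis .
  qed
  moreover have "ball a0 r \<subseteq> ?S" using w r by force
  ultimately show "\<exists>r>0. ball a0 r \<subseteq> ?S \<and> (\<exists>g. integrable lborel g \<and>
      (\<forall>w\<in>ball a0 r. \<forall>x\<in>space lborel. norm (bessel_integrand m \<alpha> b w x) \<le> g x))"
    using r(1) by blast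
qed

section \<open>Evaluation of the integrals\<close>

lemma Gamma_add_of_nat: "Re u > 0 \<Longrightarrow> Gamma (u + of_nat k) = Gamma u * pochhammer u k"
  using pochhammer_Gamma[OF Re_pos_not_nonpos_Int, of u k] Gamma_nonzero_Re_pos[of u] by simp

text \<open>
  All powers of \<open>a\<close>, \<open>b\<close> and \<open>2\<close> in a term. The principal branches combine without a phase since \<open>a\<close> and
  \<open>b\<close> lie in the right half-plane, where \<open>Ln (a/b) = Ln a - Ln b\<close>.
\<close>
lemma mellin_term_powers:
  assumes a: "Re a > 0" and b: "Re b > 0"
  shows "(a / 2) powr (2 * \<alpha>) * ((a / 2)\<^sup>2) ^ k *
      (2 powr (2 * \<alpha> + 2 * of_nat k + of_nat m + 1) * b powr (- (2 * \<alpha> + 2 * of_nat k + of_nat m + 1))) =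
    2 ^ (m + 1) * ((a / b) powr (2 * \<alpha>) * (a\<^sup>2 / b\<^sup>2) ^ k) / b ^ (m + 1)"
proof -
  have b0: "b \<noteq> 0" using b by auto
  have e: "2 * \<alpha> + 2 * of_nat k + of_nat m + 1 = 2 * \<alpha> + of_nat (2 * k + (m + 1))" by simp
  have two: "(2 :: complex) powr (2 * \<alpha> + of_nat n) = 2 powr (2 * \<alpha>) * 2 ^ n" for n
    using powr_nat'[of "2 :: complex" n] by (simp add: powr_add)
  have bb: "b powr (- (2 * \<alpha> + of_nat n)) = b powr (- (2 * \<alpha>)) / b ^ n" for n
    using powr_nat'[of b n] b0 by (simp add: powr_add powr_diff)
  have a2: "(a / 2) powr (2 * \<alpha>) = a powr (2 * \<alpha>) * 2 powr (- (2 * \<alpha>))"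
    using a by (intro powr_divide_right_half_plane) auto
  have c: "(2 :: complex) powr (- (2 * \<alpha>)) * 2 powr (2 * \<alpha>) = 1" by (simp add: powr_minus)
  have "(a / 2) powr (2 * \<alpha>) * ((a / 2)\<^sup>2) ^ k *
      (2 powr (2 * \<alpha> + of_nat (2 * k + (m + 1))) * b powr (- (2 * \<alpha> + of_nat (2 * k + (m + 1))))) =
    (2 powr (- (2 * \<alpha>)) * 2 powr (2 * \<alpha>)) * (a powr (2 * \<alpha>) * b powr (- (2 * \<alpha>))) *
      (((a / 2)\<^sup>2) ^ k * 2 ^ (2 * k + (m + 1)) / b ^ (2 * k + (m + 1)))"
    unfolding a2 two bb by (simp only: mult_ac times_divide_eq_right times_divide_eq_left)
  also have "((a / 2)\<^sup>2) ^ k * 2 ^ (2 * k + (m + 1)) / b ^ (2 * k + (m + 1)) = (a\<^sup>2 / b\<^sup>2) ^ k * 2 ^ (m + 1) / b ^ (m + 1)"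
    using b0 by (simp add: power_add power_mult power_divide)
  finally show ?thesis unfolding e c powr_divide_right_half_plane[OF a b] by simp
qed

text \<open>
  Legendre's duplication formula at \<open>\<alpha> + 1/2\<close>, together with \<open>\<Gamma>(1/2)^2 = \<pi>\<close>. It is the source of the factor
  \<open>2^{-2\<alpha>}\<close> in the prefactor.
\<close>
lemma Gamma_constants_4F3:
  assumes \<alpha>: "Re \<alpha> > -1/4"
  shows "Gamma (1/2) * Gamma (\<alpha> + 1/2) ^ 2 * Gamma (2 * \<alpha> + 1/2) / (Gamma (\<alpha> + 1) ^ 2 * Gamma (2 * \<alpha> + 1)) =
    of_real pi * 2 powr (- (2 * \<alpha>)) * (Gamma (\<alpha> + 1/2) * Gamma (2 * \<alpha> + 1/2) / Gamma (\<alpha> + 1) ^ 3)"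
proof -
  let ?z = "\<alpha> + 1/2"
  have "Gamma ?z * Gamma (?z + 1/2) = exp ((1 - 2 * ?z) * of_real (ln 2)) * of_real (sqrt pi) * Gamma (2 * ?z)"
    using \<alpha> by (intro Gamma_legendre_duplication Re_pos_not_nonpos_Int) auto
  moreover have "?z + 1/2 = \<alpha> + 1" "2 * ?z = 2 * \<alpha> + 1" by (simp_all add: algebra_simps)
  moreover have "exp ((1 - 2 * ?z) * of_real (ln 2)) = 2 powr (- (2 * \<alpha>))"
    using powr_of_real_exp[of 2 "- (2 * \<alpha>)"] by (simp add: algebra_simps)
  ultimately have L: "Gamma (\<alpha> + 1/2) * Gamma (\<alpha> + 1) = 2 powr (- (2 * \<alpha>)) * of_real (sqrt pi) * Gamma (2 * \<alpha> + 1)"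
    by simp
  have "complex_of_real (sqrt pi) * of_real (sqrt pi) = of_real pi" by (simp flip: of_real_mult)
  moreover have "Gamma (1/2) = complex_of_real (sqrt pi)" by (rule Gamma_one_half_complex)
  ultimately have "Gamma (1/2) * (Gamma (\<alpha> + 1/2) * Gamma (\<alpha> + 1)) = of_real pi * 2 powr (- (2 * \<alpha>)) * Gamma (2 * \<alpha> + 1)"
    unfolding L by (simp add: mult_ac)
  moreover have "Gamma (\<alpha> + 1) \<noteq> 0" "Gamma (2 * \<alpha> + 1) \<noteq> 0" using \<alpha> by (auto intro!: Gamma_nonzero_Re_pos)
  ultimately show ?thesis
    by (simp add: divide_simps power2_eq_square power3_eq_cube)
qed

definition prefactor_4F3 :: "complex \<Rightarrow> complex \<Rightarrow> complex \<Rightarrow> complex" where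
  "prefactor_4F3 \<alpha> b a = of_real pi / (4 * b) * (a / (2 * b)) powr (2 * \<alpha>)
     * (Gamma (\<alpha> + 1/2) * Gamma (2 * \<alpha> + 1/2) / Gamma (\<alpha> + 1) ^ 3)"

definition prefactor_2F1 :: "complex \<Rightarrow> complex \<Rightarrow> complex \<Rightarrow> complex" where
  "prefactor_2F1 \<alpha> b a = (a / b) powr (2 * \<alpha>) / (2 * b\<^sup>2 * (1 + 2 * \<alpha>))"

lemma mellin_term_4F3:
  assumes \<alpha>: "Re \<alpha> > -1/4" and a: "Re a > 0" and b: "Re b > 0"
  shows "mellin_term 0 \<alpha> b a k = prefactor_4F3 \<alpha> b a * (coeff_4F3 \<alpha> k * (a\<^sup>2 / b\<^sup>2) ^ k)"
proof -
  let ?s = "2 * \<alpha> + 2 * of_nat k + of_nat 0 + 1"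
  have b0: "b \<noteq> 0" using b by auto
  have args: "?s / 2 + \<alpha> = (2 * \<alpha> + 1/2) + of_nat k" "?s / 2 - \<alpha> = 1/2 + of_nat k" "?s / 2 = (\<alpha> + 1/2) + of_nat k"
    "\<alpha> + of_nat k + 1 = (\<alpha> + 1) + of_nat k" "2 * \<alpha> + of_nat k + 1 = (2 * \<alpha> + 1) + of_nat k"
    "2 * \<alpha> + 2 * of_nat k + 1 = ?s"
    by (simp_all add: field_simps)
  have G: "Gamma ((2 * \<alpha> + 1/2) + of_nat k) = Gamma (2 * \<alpha> + 1/2) * pochhammer (2 * \<alpha> + 1/2) k"
    "Gamma (1/2 + of_nat k) = Gamma (1/2) * pochhammer (1/2 :: complex) k"
    "Gamma ((\<alpha> + 1/2) + of_nat k) = Gamma (\<alpha> + 1/2) * pochhammer (\<alpha> + 1/2) k"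
    "Gamma ((\<alpha> + 1) + of_nat k) = Gamma (\<alpha> + 1) * pochhammer (\<alpha> + 1) k"
    "Gamma ((2 * \<alpha> + 1) + of_nat k) = Gamma (2 * \<alpha> + 1) * pochhammer (2 * \<alpha> + 1) k"
    using \<alpha> by (auto intro!: Gamma_add_of_nat)
  have s0: "Gamma ?s \<noteq> 0" using \<alpha> by (intro Gamma_nonzero_Re_pos) simp
  have "mellin_term 0 \<alpha> b a k = ((a / 2) powr (2 * \<alpha>) * ((a / 2)\<^sup>2) ^ k * (2 powr ?s * b powr (- ?s))) / 8 *
      (bessel_sq_coeff \<alpha> k * (Gamma (?s / 2 + \<alpha>) * Gamma (?s / 2 - \<alpha>) * Gamma (?s / 2) ^ 2 / Gamma ?s))"
    by (simp add: mellin_term_def Let_def)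
  also have "bessel_sq_coeff \<alpha> k * (Gamma (?s / 2 + \<alpha>) * Gamma (?s / 2 - \<alpha>) * Gamma (?s / 2) ^ 2 / Gamma ?s) =
      Gamma (?s / 2 + \<alpha>) * Gamma (?s / 2 - \<alpha>) * Gamma (?s / 2) ^ 2 /
      (fact k * Gamma (\<alpha> + of_nat k + 1) ^ 2 * Gamma (2 * \<alpha> + of_nat k + 1))"
    unfolding bessel_sq_coeff_def args(6) using s0 by simp
  also have "\<dots> = (Gamma (1/2) * Gamma (\<alpha> + 1/2) ^ 2 * Gamma (2 * \<alpha> + 1/2) / (Gamma (\<alpha> + 1) ^ 2 * Gamma (2 * \<alpha> + 1))) * coeff_4F3 \<alpha> k"
    unfolding args(1,2) unfolding args(3-5) G coeff_4F3_def by (simp add: power2_eq_square mult_ac)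
  also have "\<dots> = (of_real pi * 2 powr (- (2 * \<alpha>)) * (Gamma (\<alpha> + 1/2) * Gamma (2 * \<alpha> + 1/2) / Gamma (\<alpha> + 1) ^ 3)) * coeff_4F3 \<alpha> k"
    by (simp only: Gamma_constants_4F3[OF \<alpha>])
  also have "(a / 2) powr (2 * \<alpha>) * ((a / 2)\<^sup>2) ^ k * (2 powr ?s * b powr (- ?s)) =
      2 * ((a / b) powr (2 * \<alpha>) * (a\<^sup>2 / b\<^sup>2) ^ k) / b"
    using mellin_term_powers[OF a b, of \<alpha> k 0] by simp
  also have "2 * ((a / b) powr (2 * \<alpha>) * (a\<^sup>2 / b\<^sup>2) ^ k) / b / 8 *
      ((of_real pi * 2 powr (- (2 * \<alpha>)) * (Gamma (\<alpha> + 1/2) * Gamma (2 * \<alpha> + 1/2) / Gamma (\<alpha> + 1) ^ 3)) * coeff_4F3 \<alpha> k) =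
      of_real pi / (4 * b) * ((a / b) powr (2 * \<alpha>) * 2 powr (- (2 * \<alpha>))) * (Gamma (\<alpha> + 1/2) * Gamma (2 * \<alpha> + 1/2) / Gamma (\<alpha> + 1) ^ 3) *
      (coeff_4F3 \<alpha> k * (a\<^sup>2 / b\<^sup>2) ^ k)"
    by simp
  also have "(a / b) powr (2 * \<alpha>) * 2 powr (- (2 * \<alpha>)) = (a / (2 * b)) powr (2 * \<alpha>)"
  proof -
    have "(a / (2 * b)) powr (2 * \<alpha>) = a powr (2 * \<alpha>) * (b * of_real 2) powr (- (2 * \<alpha>))"
      using powr_divide_right_half_plane[of a "2 * b" "2 * \<alpha>"] a b by (simp add: mult_ac)
    also have "(b * of_real 2) powr (- (2 * \<alpha>)) = b powr (- (2 * \<alpha>)) * of_real 2 powr (- (2 * \<alpha>))"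
      by (rule powr_mult_of_real) (use b0 in auto)
    finally show ?thesis unfolding powr_divide_right_half_plane[OF a b] by simp
  qed
  finally show ?thesis by (simp add: prefactor_4F3_def)
qed

text \<open>
  Here \<open>s/2 + \<alpha>\<close>, \<open>s/2\<close> and \<open>s/2 - \<alpha>\<close> are the very arguments of the Gamma functions in the denominator
  of \<open>c_k\<close>, so everything cancels except \<open>\<Gamma>(2\<alpha>+2k+1)/\<Gamma>(2\<alpha>+2k+2)\<close>.
\<close>
lemma mellin_term_2F1:
  assumes \<alpha>: "Re \<alpha> > -1/2" and a: "Re a > 0" and b: "Re b > 0"
  shows "mellin_term 1 \<alpha> b a k = prefactor_2F1 \<alpha> b a * ((\<alpha> + 1/2) / (\<alpha> + 1/2 + of_nat k) * (a\<^sup>2 / b\<^sup>2) ^ k)"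
proof -
  let ?s = "2 * \<alpha> + 2 * of_nat k + of_nat 1 + 1" and ?t = "2 * \<alpha> + 2 * of_nat k + 1"
  have args: "?s / 2 + \<alpha> = 2 * \<alpha> + of_nat k + 1" "?s / 2 - \<alpha> = of_nat k + 1" "?s / 2 = \<alpha> + of_nat k + 1" "?s = ?t + of_nat 1"
    by (simp_all add: field_simps)
  have nz: "Gamma ?t \<noteq> 0" "Gamma (2 * \<alpha> + of_nat k + 1) \<noteq> 0" "Gamma (\<alpha> + of_nat k + 1) \<noteq> 0"
    using \<alpha> by (auto intro!: Gamma_nonzero_Re_pos)
  have t: "Gamma (?t + of_nat 1) = Gamma ?t * ?t"
    using Gamma_add_of_nat[of ?t 1] \<alpha> by simp
  have f: "Gamma (of_nat k + 1) = (fact k :: complex)" using Gamma_fact[of k] by (simp add: add_ac)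
  have "mellin_term 1 \<alpha> b a k = ((a / 2) powr (2 * \<alpha>) * ((a / 2)\<^sup>2) ^ k * (2 powr ?s * b powr (- ?s))) / 8 *
      (bessel_sq_coeff \<alpha> k * (Gamma (?s / 2 + \<alpha>) * Gamma (?s / 2 - \<alpha>) * Gamma (?s / 2) ^ 2 / Gamma ?s))"
    by (simp add: mellin_term_def Let_def)
  also have "bessel_sq_coeff \<alpha> k * (Gamma (?s / 2 + \<alpha>) * Gamma (?s / 2 - \<alpha>) * Gamma (?s / 2) ^ 2 / Gamma ?s) = 1 / ?t"
    unfolding args(1,2) unfolding args(3) unfolding args(4) unfolding t f bessel_sq_coeff_def using nz by simp
  also have "(a / 2) powr (2 * \<alpha>) * ((a / 2)\<^sup>2) ^ k * (2 powr ?s * b powr (- ?s)) =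
      4 * ((a / b) powr (2 * \<alpha>) * (a\<^sup>2 / b\<^sup>2) ^ k) / b\<^sup>2"
    using mellin_term_powers[OF a b, of \<alpha> k 1] by (simp add: power2_eq_square)
  also have "4 * ((a / b) powr (2 * \<alpha>) * (a\<^sup>2 / b\<^sup>2) ^ k) / b\<^sup>2 / 8 * (1 / ?t) =
      prefactor_2F1 \<alpha> b a * ((\<alpha> + 1/2) / (\<alpha> + 1/2 + of_nat k) * (a\<^sup>2 / b\<^sup>2) ^ k)"
  proof -
    have "Re (1 + 2 * \<alpha>) \<noteq> 0" using \<alpha> by simp
    hence "1 + 2 * \<alpha> \<noteq> 0" by fastforce
    hence "1 / ?t = (\<alpha> + 1/2) / (\<alpha> + 1/2 + of_nat k) / (1 + 2 * \<alpha>)"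
    proof -
      have "(\<alpha> + 1/2) / (\<alpha> + 1/2 + of_nat k) = (1 + 2 * \<alpha>) / ?t"
        using mult_divide_mult_cancel_left[of 2 "\<alpha> + 1/2" "\<alpha> + 1/2 + of_nat k"] by (simp add: algebra_simps)
      thus ?thesis using \<open>1 + 2 * \<alpha> \<noteq> 0\<close> by simp
    qed
    thus ?thesis by (simp only: prefactor_2F1_def) (simp add: mult_ac)
  qed
  finally show ?thesis .
qed

text \<open>
  If \<open>a^2/b^2 = r \<ge> 1\<close> then \<open>a = \<plusminus>\<surd>r b\<close>. The minus sign contradicts \<open>Re a > 0\<close>, the plus sign forces
  \<open>r = 1\<close>.
\<close>
lemma square_quotient_in_cut_plane:
  assumes "0 < Re a" "Re a \<le> Re b" "a \<noteq> b"
  shows "a\<^sup>2 / b\<^sup>2 \<in> cut_plane"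
proof (rule ccontr)
  assume "a\<^sup>2 / b\<^sup>2 \<notin> cut_plane"
  then obtain r where r: "r \<ge> 1" "a\<^sup>2 / b\<^sup>2 = of_real r" by (auto simp: cut_plane_def)
  have "b \<noteq> 0" using assms by auto
  hence "a\<^sup>2 = (of_real (sqrt r) * b)\<^sup>2" using r by (simp add: field_simps power_mult_distrib flip: of_real_power)
  hence "a = of_real (sqrt r) * b \<or> a = - (of_real (sqrt r) * b)" by (simp only: power2_eq_iff)
  hence "a = of_real (sqrt r) * b"
  proof
    assume "a = - (of_real (sqrt r) * b)"
    hence "Re a = - (sqrt r * Re b)" by simp
    moreover have "sqrt r * Re b \<ge> 0" using r assms by (intro mult_nonneg_nonneg) auto
    ultimately show ?thesis using assms by linarith
  qed
  moreover have "sqrt r = 1"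
  proof (rule ccontr)
    assume "sqrt r \<noteq> 1"
    hence "sqrt r > 1" using r by (smt (verit) real_sqrt_ge_1_iff)
    hence "sqrt r * Re b > 1 * Re b" using assms by (intro mult_strict_right_mono) auto
    moreover have "Re a = sqrt r * Re b" using \<open>a = of_real (sqrt r) * b\<close> by simp
    ultimately show False using assms by linarith
  qed
  ultimately show False using assms by simp
qed

lemma quotient_not_nonpos_Real:
  assumes "0 < Re a" "0 < Re b"
  shows "a / b \<notin> \<real>\<^sub>\<le>\<^sub>0"
proof
  assume "a / b \<in> \<real>\<^sub>\<le>\<^sub>0"
  then obtain r where r: "a / b = of_real r" "r \<le> 0" by (auto elim!: nonpos_Reals_cases)
  have "b \<noteq> 0" using assms by auto
  hence "Re a = r * Re b" using r(1) by (simp add: field_simps)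
  moreover have "r * Re b \<le> 0" using r assms by (intro mult_nonpos_nonneg) auto
  ultimately show False using assms by simp
qed

text \<open>
  The intersection of the strip with the disc of radius \<open>Re b\<close>, on which termwise integration applies, is
  open and nonempty, so the identity theorem carries the evaluation to the whole strip.
\<close>
lemma continuation_in_strip:
  assumes \<alpha>: "Re \<alpha> > -1/2" "\<bar>2 * Re \<alpha>\<bar> < 2 * Re \<alpha> + m + 1"
    and hol: "H holomorphic_on {a. 0 < Re a \<and> Re a < Re b}"
    and series: "\<And>a. 0 < Re a \<Longrightarrow> norm a < Re b \<Longrightarrow> mellin_term m \<alpha> b a sums H a"
    and a: "0 < Re a" "Re a < Re b"
  shows "(LINT x|lborel. bessel_integrand m \<alpha> b a x) = H a"
proof -
  let ?S = "{a. 0 < Re a \<and> Re a < Re b}"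
  have S: "open ?S" "connected ?S"
  proof -
    show "open ?S" by (intro open_Collect_conj) (auto intro: open_halfspace_Re_gt open_halfspace_Re_lt)
    have "?S = {a. 0 < Re a} \<inter> {a. Re a < Re b}" by auto
    thus "connected ?S" by (auto intro!: convex_connected convex_Int convex_halfspace_Re_gt convex_halfspace_Re_lt)
  qed
  have b: "Re b > 0" using a by simp
  have mem: "of_real (Re b / 2) \<in> ?S \<inter> ball 0 (Re b)" using b by simp
  show ?thesis
  proof (rule analytic_continuation_open[where f = "\<lambda>a. LINT x|lborel. bessel_integrand m \<alpha> b a x"])
    show "open (?S \<inter> ball 0 (Re b))" using S(1) by (intro open_Int) auto
    show "(LINT x|lborel. bessel_integrand m \<alpha> b w x) = H w" if "w \<in> ?S \<inter> ball 0 (Re b)" for w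
      using that termwise_integration[OF \<alpha>, of w b] series[of w] by (auto intro: sums_unique2)
    show "?S \<inter> ball 0 (Re b) \<noteq> {}" using mem by blast
  qed (use S a hol bessel_integral_holomorphic[OF \<alpha>] in auto)
qed

lemma holomorphic_on_square_quotient:
  assumes "F holomorphic_on cut_plane"
  shows "(\<lambda>a. F (a\<^sup>2 / b\<^sup>2)) holomorphic_on {a. 0 < Re a \<and> Re a < Re b}"
proof (cases "Re b > 0")
  case True
  hence "b\<^sup>2 \<noteq> 0" by auto
  hence "(\<lambda>a. a\<^sup>2 / b\<^sup>2) holomorphic_on {a. 0 < Re a \<and> Re a < Re b}" by (intro holomorphic_intros) auto
  moreover have "(\<lambda>a. a\<^sup>2 / b\<^sup>2) ` {a. 0 < Re a \<and> Re a < Re b} \<subseteq> cut_plane"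
    by (auto intro!: square_quotient_in_cut_plane)
  ultimately show ?thesis using holomorphic_on_compose_gen[OF _ assms] by (auto simp: o_def)
next
  case False
  hence "{a. 0 < Re a \<and> Re a < Re b} = {}" by auto
  thus ?thesis by (simp only: holomorphic_on_empty)
qed

lemma integral_4F3_strip:
  assumes \<alpha>: "Re \<alpha> > -1/4" and a: "0 < Re a" "Re a < Re b"
  shows "(LINT x|lborel. bessel_integrand 0 \<alpha> b a x) = prefactor_4F3 \<alpha> b a * hypergeom_4F3 \<alpha> (a\<^sup>2 / b\<^sup>2)"
proof (rule continuation_in_strip)
  have b: "Re b > 0" "b \<noteq> 0" using a by auto
  show "(\<lambda>a. prefactor_4F3 \<alpha> b a * hypergeom_4F3 \<alpha> (a\<^sup>2 / b\<^sup>2)) holomorphic_on {a. 0 < Re a \<and> Re a < Re b}"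
  proof (rule holomorphic_on_mult)
    have "a / (2 * b) \<notin> \<real>\<^sub>\<le>\<^sub>0" if "0 < Re a" for a
      using that b by (intro quotient_not_nonpos_Real) auto
    thus "prefactor_4F3 \<alpha> b holomorphic_on {a. 0 < Re a \<and> Re a < Re b}"
      unfolding prefactor_4F3_def using b by (intro holomorphic_intros) auto
    show "(\<lambda>a. hypergeom_4F3 \<alpha> (a\<^sup>2 / b\<^sup>2)) holomorphic_on {a. 0 < Re a \<and> Re a < Re b}"
      by (rule holomorphic_on_square_quotient[OF hypergeom_4F3(1)[OF \<alpha>]])
  qed
  fix a assume a: "0 < Re a" "norm a < Re b"
  have "norm a < norm b" using a complex_Re_le_cmod[of b] by linarith
  hence "norm (a\<^sup>2 / b\<^sup>2) < 1" using b by (simp add: norm_divide norm_power divide_simps power_strict_mono)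
  from sums_mult[OF hypergeom_4F3(2)[OF \<alpha> this], of "prefactor_4F3 \<alpha> b a"]
  show "mellin_term 0 \<alpha> b a sums (prefactor_4F3 \<alpha> b a * hypergeom_4F3 \<alpha> (a\<^sup>2 / b\<^sup>2))"
    unfolding mellin_term_4F3[OF \<alpha> a(1) b(1), symmetric] .
qed (use assms in auto)

lemma integral_2F1_strip:
  assumes \<alpha>: "Re \<alpha> > -1/2" and a: "0 < Re a" "Re a < Re b"
  shows "(LINT x|lborel. bessel_integrand 1 \<alpha> b a x) = prefactor_2F1 \<alpha> b a * hypergeom_2F1 \<alpha> (a\<^sup>2 / b\<^sup>2)"
proof (rule continuation_in_strip)
  have b: "Re b > 0" "b \<noteq> 0" using a by auto
  have "Re (1 + 2 * \<alpha>) \<noteq> 0" using \<alpha> by simp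
  hence nz: "1 + 2 * \<alpha> \<noteq> 0" by fastforce
  show "(\<lambda>a. prefactor_2F1 \<alpha> b a * hypergeom_2F1 \<alpha> (a\<^sup>2 / b\<^sup>2)) holomorphic_on {a. 0 < Re a \<and> Re a < Re b}"
  proof (rule holomorphic_on_mult)
    have "a / b \<notin> \<real>\<^sub>\<le>\<^sub>0" if "0 < Re a" for a
      using that b by (intro quotient_not_nonpos_Real) auto
    thus "prefactor_2F1 \<alpha> b holomorphic_on {a. 0 < Re a \<and> Re a < Re b}"
      unfolding prefactor_2F1_def using b nz by (intro holomorphic_intros) auto
    show "(\<lambda>a. hypergeom_2F1 \<alpha> (a\<^sup>2 / b\<^sup>2)) holomorphic_on {a. 0 < Re a \<and> Re a < Re b}"
      by (rule holomorphic_on_square_quotient[OF hypergeom_2F1(1)[OF \<alpha>]])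
  qed
  fix a assume a: "0 < Re a" "norm a < Re b"
  have "norm a < norm b" using a complex_Re_le_cmod[of b] by linarith
  hence "norm (a\<^sup>2 / b\<^sup>2) < 1" using b by (simp add: norm_divide norm_power divide_simps power_strict_mono)
  from sums_mult[OF hypergeom_2F1(2)[OF \<alpha> this], of "prefactor_2F1 \<alpha> b a"]
  show "mellin_term 1 \<alpha> b a sums (prefactor_2F1 \<alpha> b a * hypergeom_2F1 \<alpha> (a\<^sup>2 / b\<^sup>2))"
    unfolding mellin_term_2F1[OF \<alpha> a(1) b(1), symmetric] .
qed (use assms in auto)

text \<open>
  For real parameters each term is its own absolute value. Thus the integral of the norm of a term is the
  known Mellin value, and absolute convergence can be tested on the coefficients.
\<close>
lemma series_summand_nonneg_real:
  assumes \<sigma>: "\<sigma> > -1/2" and A: "A > 0" and B: "B > 0"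
  shows "series_summand m (of_real \<sigma>) (of_real B) (of_real A) k x =
           of_real (norm (series_summand m (of_real \<sigma>) (of_real B) (of_real A) k x))"
proof (cases "x > 0")
  case True
  define \<gamma> where "\<gamma> = Gamma (2 * \<sigma> + 2 * real k + 1) / (fact k * Gamma (\<sigma> + real k + 1) ^ 2 * Gamma (2 * \<sigma> + real k + 1))"
  define v where "v = (A / 2) powr (2 * \<sigma>) * \<gamma> * ((A / 2)\<^sup>2) ^ k *
    (x powr (2 * \<sigma> + 2 * real k + real m) * (bessel_K_real \<sigma> (B * x))\<^sup>2)"
  have "2 * of_real \<sigma> + 2 * of_nat k + 1 = complex_of_real (2 * \<sigma> + 2 * real k + 1)"
    "of_real \<sigma> + of_nat k + 1 = complex_of_real (\<sigma> + real k + 1)"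
    "2 * of_real \<sigma> + of_nat k + 1 = complex_of_real (2 * \<sigma> + real k + 1)" by simp_all
  hence c: "bessel_sq_coeff (of_real \<sigma>) k = of_real \<gamma>"
    unfolding bessel_sq_coeff_def \<gamma>_def by (simp only: Gamma_complex_of_real) simp
  have K: "bessel_K (of_real \<sigma>) (of_real B * of_real x) = of_real (bessel_K_real \<sigma> (B * x))"
    using bessel_K_of_real[of "B * x" \<sigma>] B True by simp
  have p1: "(of_real A / 2) powr (2 * of_real \<sigma>) = complex_of_real ((A / 2) powr (2 * \<sigma>))"
    using powr_of_real[of "A / 2" "2 * \<sigma>"] A by simp
  have p2: "of_real x powr (2 * of_real \<sigma> + 2 * of_nat k + of_nat m + 1 - 1) =
      complex_of_real (x powr (2 * \<sigma> + 2 * real k + real m))"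
    using powr_of_real[of x "2 * \<sigma> + 2 * real k + real m"] True by simp
  have "series_summand m (of_real \<sigma>) (of_real B) (of_real A) k x = of_real v"
    unfolding series_summand_def c K p1 p2 v_def using True by simp
  moreover have "\<gamma> \<ge> 0" unfolding \<gamma>_def
    using \<sigma> by (intro divide_nonneg_nonneg mult_nonneg_nonneg less_imp_le[OF Gamma_real_pos]) auto
  hence "v \<ge> 0" unfolding v_def by (intro mult_nonneg_nonneg) auto
  ultimately show ?thesis by simp
qed (simp add: series_summand_def)

text \<open>
  At \<open>A = B\<close> the gap used above vanishes. Instead, the integrand with real parameters is a sum of nonnegative
  terms whose integrals are proportional to the coefficients of the 4F3 at argument \<open>1\<close>, and these are
  summable. The majorant is a constant multiple of this integrand.
\<close>
lemma integrand_majorant_integrable_eq: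
  assumes \<sigma>: "\<sigma> > -1/4" and A: "A > 0"
  shows "integrable lborel (integrand_majorant 0 \<sigma> A A)"
proof -
  let ?a = "complex_of_real A" and ?s = "complex_of_real \<sigma>"
  have \<sigma>': "\<sigma> > -1/2" "\<bar>2 * Re ?s\<bar> < 2 * Re ?s + real 0 + 1" "Re ?s > -1/2" "Re ?s > -1/4" "Re ?a > 0" using \<sigma> A by auto
  let ?f = "series_summand 0 ?s ?a ?a"
  have fi: "integrable lborel (?f k)" for k by (rule series_summand_integral(1)[OF \<sigma>'(2,5)])
  have sm: "summable (\<lambda>k. norm (?f k x))" for x
  proof -
    have "summable (\<lambda>k. complex_of_real (norm (?f k x)))"
      using sums_summable[OF series_summand_sums[OF \<sigma>'(3,5), of 0 ?a x]]
      by (simp flip: series_summand_nonneg_real[OF \<sigma>'(1) A A])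
    thus ?thesis by (simp add: summable_complex_of_real)
  qed
  have "complex_of_real (LINT x|lborel. norm (?f k x)) = prefactor_4F3 ?s ?a ?a * coeff_4F3 ?s k" for k
  proof -
    have "complex_of_real (LINT x|lborel. norm (?f k x)) = (LINT x|lborel. complex_of_real (norm (?f k x)))"
      by (rule integral_complex_of_real[symmetric])
    also have "\<dots> = mellin_term 0 ?s ?a ?a k"
      unfolding series_summand_nonneg_real[OF \<sigma>'(1) A A, symmetric] by (rule series_summand_integral(2)[OF \<sigma>'(2,5)])
    also have "\<dots> = prefactor_4F3 ?s ?a ?a * coeff_4F3 ?s k"
      using A mellin_term_4F3[OF \<sigma>'(4,5,5), of k] by simp
    finally show ?thesis .
  qed
  hence "norm (complex_of_real (LINT x|lborel. norm (?f k x))) = norm (prefactor_4F3 ?s ?a ?a) * norm (coeff_4F3 ?s k)" for k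
    by (simp only: norm_mult)
  hence eq: "(LINT x|lborel. norm (?f k x)) = norm (prefactor_4F3 ?s ?a ?a) * norm (coeff_4F3 ?s k)" for k
    by (simp add: integral_nonneg_AE)
  have "summable (\<lambda>k. LINT x|lborel. norm (?f k x))"
    unfolding eq by (intro summable_mult summable_coeff_4F3 \<sigma>')
  from integrable_suminf[OF fi AE_I2[OF sm] this]
  have i: "integrable lborel (bessel_integrand 0 ?s ?a ?a)"
    using series_summand_sums[OF \<sigma>'(3,5), of 0 ?a] by (simp add: sums_iff)
  (* The constant relating I to its majorant. *)
  define D where "D = (A / 2) powr \<sigma> / norm (Gamma (1/2) * Gamma (?s + 1/2))"
  have D: "D > 0" unfolding D_def using A \<sigma>' Gamma_nonzero_Re_pos[of "?s + 1/2"] Gamma_nonzero_Re_pos[of "1/2"] by simp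
  have "norm (bessel_integrand 0 ?s ?a ?a x) = D\<^sup>2 * integrand_majorant 0 \<sigma> A A x" for x
  proof (cases "x > 0")
    case True
    have nz: "?a * of_real x \<noteq> 0" using A True by auto
    have "bessel_majorant \<sigma> (A * x) = norm (complex_of_real (bessel_majorant \<sigma> (A * x)))"
      by (simp add: bessel_majorant_nonneg)
    also have "\<dots> = norm (Gamma (1/2) * Gamma (?s + 1/2)) * norm (bessel_phi ?s ((?a * of_real x / 2)\<^sup>2))"
      unfolding bessel_majorant_eq[OF \<sigma>'(1)] by (simp add: norm_mult)
    finally have phi: "norm (bessel_phi ?s ((?a * of_real x / 2)\<^sup>2)) = bessel_majorant \<sigma> (A * x) / norm (Gamma (1/2) * Gamma (?s + 1/2))"
      using Gamma_nonzero_Re_pos[of "?s + 1/2"] Gamma_nonzero_Re_pos[of "1/2"] \<sigma>' by (simp add: field_simps)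
    have p: "norm ((?a * of_real x / 2) powr ?s) = (A / 2) powr \<sigma> * x powr \<sigma>"
    proof -
      have "?a * of_real x / 2 = of_real (A / 2 * x)" by simp
      hence "norm ((?a * of_real x / 2) powr ?s) = (A / 2 * x) powr \<sigma>"
        using norm_powr_of_real[of "A / 2 * x" ?s] A True by (simp only:) simp
      thus ?thesis by (simp only: powr_mult)
    qed
    have "norm (bessel_I ?s (?a * of_real x)) = D * (x powr \<sigma> * bessel_majorant \<sigma> (A * x))"
      unfolding bessel_I_phi[OF \<sigma>'(3) nz] norm_mult p phi D_def by simp
    moreover have "norm (bessel_K ?s (?a * of_real x)) = bessel_K_real \<sigma> (A * x)"
      using bessel_K_of_real[of "A * x" \<sigma>] A True by (simp add: bessel_K_real_nonneg)
    moreover have "(x powr \<sigma>)\<^sup>2 = x powr (2 * \<sigma> + real 0)" using power_mult_powr_square[OF True, of 0 \<sigma>] by simp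
    ultimately show ?thesis using True
      by (simp add: bessel_integrand_def integrand_majorant_def norm_mult norm_power power_mult_distrib mult_ac)
  qed (simp add: bessel_integrand_def integrand_majorant_def)
  with integrable_norm[OF i] have "integrable lborel (\<lambda>x. D\<^sup>2 * integrand_majorant 0 \<sigma> A A x)" by simp
  from integrable_mult_right[OF this, of "1 / D\<^sup>2"] show ?thesis using D by simp
qed

lemma integrand_majorant_integrable:
  assumes \<sigma>: "\<sigma> > -1/4" and A: "0 < A" "A \<le> B"
  shows "integrable lborel (integrand_majorant 0 \<sigma> A B)"
proof (cases "A = B")
  case True thus ?thesis using integrand_majorant_integrable_eq[OF \<sigma>, of A] A by simp
next
  case False thus ?thesis using \<sigma> A by (intro integrand_majorant_integrable_less) auto
qed

text \<open>
  The boundary line is approached along \<open>r a\<close> with \<open>r\<close> increasing to \<open>1\<close>, which keeps \<open>Re (r a) < Re a\<close> and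
  so keeps the majorant at \<open>a\<close> valid. For \<open>a = b\<close> the argument of the 4F3 tends to \<open>1\<close> radially; otherwise
  it stays in the cut plane.
\<close>
lemma integral_4F3:
  assumes \<alpha>: "Re \<alpha> > -1/4" and a: "0 < Re a" "Re a \<le> Re b"
  shows "(LINT x|lborel. bessel_integrand 0 \<alpha> b a x) = prefactor_4F3 \<alpha> b a * hypergeom_4F3 \<alpha> (a\<^sup>2 / b\<^sup>2)"
proof -
  let ?\<sigma> = "Re \<alpha>"
  have \<alpha>': "?\<sigma> > -1/2" using \<alpha> by simp
  have b: "Re b > 0" "b \<noteq> 0" using a by auto
  (* The offset 2 keeps r n at least 1/2, which bounds the power of r n for negative exponents. *)
  define r where "r n = 1 - 1 / (real n + 2)" for n
  have r: "1/2 \<le> r n" "0 \<le> r n" "r n > 0" "r n < 1" for n by (auto simp: r_def field_simps)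
  have rlim: "r \<longlonglongrightarrow> 1"
  proof -
    have "(\<lambda>n. 1 / (real (n + 2))) \<longlonglongrightarrow> 0" using LIMSEQ_ignore_initial_segment[OF lim_1_over_n[where 'a = real], of 2] by simp
    from tendsto_diff[OF tendsto_const[of 1] this] show ?thesis by (simp add: r_def[abs_def] add.commute)
  qed
  define u where "u n = of_real (r n) * a" for n
  have u: "0 < Re (u n)" "Re (u n) < Re b" "Re (u n) \<le> Re a" "norm (u n) = r n * norm a" for n
  proof -
    have "r n * Re a < 1 * Re a" using r[of n] a by (intro mult_strict_right_mono) auto
    hence "r n * Re a < Re b \<and> r n * Re a \<le> Re a" using a by linarith
    thus "0 < Re (u n)" "Re (u n) < Re b" "Re (u n) \<le> Re a" "norm (u n) = r n * norm a"
      using r[of n] a by (auto simp: u_def norm_mult)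
  qed
  have ulim: "u \<longlonglongrightarrow> a"
  proof -
    have "(\<lambda>n. complex_of_real (r n)) \<longlonglongrightarrow> of_real 1" using rlim by (rule tendsto_of_real)
    from tendsto_mult[OF this tendsto_const[of a]] show ?thesis by (simp add: u_def[abs_def])
  qed
  define M where "M = (1 + (1/2) powr ?\<sigma>) * (norm a / 2) powr ?\<sigma>"
  define g where "g x = (majorant_const \<alpha> * M)\<^sup>2 * integrand_majorant 0 ?\<sigma> (Re a) (Re b) x" for x
  have gi: "integrable lborel g" unfolding g_def
    by (intro integrable_mult_right integrand_majorant_integrable \<alpha> a)
  have bound: "norm (bessel_integrand 0 \<alpha> b (u n) x) \<le> g x" for n x
  proof -
    have mc: "majorant_const \<alpha> \<ge> 0" by (simp add: majorant_const_def)
    have "r n powr ?\<sigma> \<le> 1 + (1/2) powr ?\<sigma>"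
    proof (cases "?\<sigma> \<ge> 0")
      case True
      hence "r n powr ?\<sigma> \<le> 1 powr ?\<sigma>" using r[of n] by (intro powr_mono2) auto
      thus ?thesis by (simp add: add_increasing2)
    next
      case False
      hence "r n powr ?\<sigma> \<le> (1/2) powr ?\<sigma>" using r[of n] by (intro powr_mono2') auto
      thus ?thesis by simp
    qed
    moreover have "(norm (u n) / 2) powr ?\<sigma> = r n powr ?\<sigma> * (norm a / 2) powr ?\<sigma>"
      unfolding u(4) times_divide_eq_right[symmetric] by (rule powr_mult)
    ultimately have M: "(norm (u n) / 2) powr ?\<sigma> \<le> M" by (simp add: M_def mult_right_mono)
    have mono: "integrand_majorant 0 ?\<sigma> (Re (u n)) (Re b) x \<le> integrand_majorant 0 ?\<sigma> (Re a) (Re b) x"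
    proof (cases "x > 0")
      case True
      have "bessel_majorant ?\<sigma> (Re (u n) * x) \<le> bessel_majorant ?\<sigma> (Re a * x)"
        using True u[of n] by (intro bessel_majorant_mono \<alpha>' mult_right_mono mult_nonneg_nonneg) auto
      thus ?thesis using True
        by (auto simp: integrand_majorant_def intro!: mult_right_mono mult_left_mono power_mono bessel_majorant_nonneg)
    qed (simp add: integrand_majorant_def)
    have "norm (bessel_integrand 0 \<alpha> b (u n) x) \<le> (majorant_const \<alpha> * (norm (u n) / 2) powr ?\<sigma>)\<^sup>2 * integrand_majorant 0 ?\<sigma> (Re (u n)) (Re b) x"
      by (intro norm_bessel_integrand_le \<alpha>' u b)
    also have "\<dots> \<le> g x" unfolding g_def
      using mc M by (intro mult_mono power_mono mono mult_left_mono integrand_majorant_nonneg mult_nonneg_nonneg) auto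
    finally show ?thesis .
  qed
  have ptw: "(\<lambda>n. bessel_integrand 0 \<alpha> b (u n) x) \<longlonglongrightarrow> bessel_integrand 0 \<alpha> b a x" for x
  proof (cases "x > 0")
    case True
    have cont: "continuous_on {z. Re z > 0} (bessel_I \<alpha>)"
      using bessel_I_holomorphic[OF \<alpha>'] by (rule holomorphic_on_imp_continuous_on)
    have lim: "(\<lambda>n. u n * of_real x) \<longlonglongrightarrow> a * of_real x" by (intro tendsto_mult ulim tendsto_const)
    have "(\<lambda>n. bessel_I \<alpha> (u n * of_real x)) \<longlonglongrightarrow> bessel_I \<alpha> (a * of_real x)"
      by (rule continuous_on_tendsto_compose[OF cont lim]) (use a u(1) True in auto)
    thus ?thesis unfolding bessel_integrand_def by (intro tendsto_intros)
  qed (simp add: bessel_integrand_def)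
  have lhs: "(\<lambda>n. LINT x|lborel. bessel_integrand 0 \<alpha> b (u n) x) \<longlonglongrightarrow> (LINT x|lborel. bessel_integrand 0 \<alpha> b a x)"
    by (rule integral_dominated_convergence[OF _ _ gi]) (use ptw bound in auto)
  have H: "(\<lambda>n. hypergeom_4F3 \<alpha> ((u n)\<^sup>2 / b\<^sup>2)) \<longlonglongrightarrow> hypergeom_4F3 \<alpha> (a\<^sup>2 / b\<^sup>2)"
  proof (cases "a = b")
    case True
    have "(u n)\<^sup>2 / b\<^sup>2 = of_real ((r n)\<^sup>2)" for n using True b by (simp add: u_def power_mult_distrib)
    moreover have "(\<lambda>n. hypergeom_4F3 \<alpha> (of_real ((r n)\<^sup>2))) \<longlonglongrightarrow> hypergeom_4F3 \<alpha> 1"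
    proof (rule hypergeom_4F3_tendsto_1[OF \<alpha>])
      show "(r n)\<^sup>2 < 1" for n using r[of n] by (intro power_less_one_iff[THEN iffD2]) auto
      show "(\<lambda>n. (r n)\<^sup>2) \<longlonglongrightarrow> 1" using tendsto_power[OF rlim, of 2] by simp
    qed simp
    ultimately show ?thesis using True b by simp
  next
    case False
    show ?thesis
    proof (rule continuous_on_tendsto_compose[OF holomorphic_on_imp_continuous_on[OF hypergeom_4F3(1)[OF \<alpha>]]])
      show "(\<lambda>n. (u n)\<^sup>2 / b\<^sup>2) \<longlonglongrightarrow> a\<^sup>2 / b\<^sup>2" using b by (intro tendsto_intros ulim) auto
      show "a\<^sup>2 / b\<^sup>2 \<in> cut_plane" using False a by (intro square_quotient_in_cut_plane) auto
      show "\<forall>\<^sub>F n in sequentially. (u n)\<^sup>2 / b\<^sup>2 \<in> cut_plane"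
      proof (intro always_eventually allI square_quotient_in_cut_plane)
        fix n show "u n \<noteq> b" using u(2)[of n] by auto
      qed (use u in \<open>auto simp: less_imp_le\<close>)
    qed
  qed
  have P: "(\<lambda>n. prefactor_4F3 \<alpha> b (u n)) \<longlonglongrightarrow> prefactor_4F3 \<alpha> b a"
  proof -
    have "(\<lambda>n. (u n / (2 * b)) powr (2 * \<alpha>)) \<longlonglongrightarrow> (a / (2 * b)) powr (2 * \<alpha>)"
    proof (rule tendsto_powr_complex)
      show "a / (2 * b) \<notin> \<real>\<^sub>\<le>\<^sub>0" using a b by (intro quotient_not_nonpos_Real) auto
      show "(\<lambda>n. u n / (2 * b)) \<longlonglongrightarrow> a / (2 * b)" using b by (intro tendsto_intros ulim) auto
    qed auto
    thus ?thesis unfolding prefactor_4F3_def by (intro tendsto_mult tendsto_const)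
  qed
  have "(\<lambda>n. LINT x|lborel. bessel_integrand 0 \<alpha> b (u n) x) \<longlonglongrightarrow> prefactor_4F3 \<alpha> b a * hypergeom_4F3 \<alpha> (a\<^sup>2 / b\<^sup>2)"
    unfolding integral_4F3_strip[OF \<alpha> u(1,2)] by (intro tendsto_mult P H)
  with lhs show ?thesis by (rule LIMSEQ_unique)
qed

theorem theorem2p9:
  fixes a b \<alpha> :: complex
  shows
    "(0 < Re a \<and> Re a \<le> Re b \<and> - 1/4 < Re \<alpha> \<longrightarrow>
        set_integrable lborel {0<..}
          (\<lambda>x. (bessel_I \<alpha> (a * of_real x))\<^sup>2 * (bessel_K \<alpha> (b * of_real x))\<^sup>2) \<and>
        (LINT x:{0<..}|lborel. (bessel_I \<alpha> (a * of_real x))\<^sup>2 * (bessel_K \<alpha> (b * of_real x))\<^sup>2) =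
          of_real pi / (4 * b) * (a / (2 * b)) powr (2 * \<alpha>)
          * (Gamma (\<alpha> + 1/2) * Gamma (2 * \<alpha> + 1/2) / Gamma (\<alpha> + 1) ^ 3)
          * hypergeom [\<alpha> + 1/2, 2 * \<alpha> + 1/2, \<alpha> + 1/2, 1/2] [\<alpha> + 1, 2 * \<alpha> + 1, \<alpha> + 1] (a\<^sup>2 / b\<^sup>2))
     \<and>
     (0 < Re a \<and> Re a < Re b \<and> - 1/2 < Re \<alpha> \<longrightarrow>
        set_integrable lborel {0<..}
          (\<lambda>x. of_real x * (bessel_I \<alpha> (a * of_real x))\<^sup>2 * (bessel_K \<alpha> (b * of_real x))\<^sup>2) \<and>
        (LINT x:{0<..}|lborel. of_real x * (bessel_I \<alpha> (a * of_real x))\<^sup>2 * (bessel_K \<alpha> (b * of_real x))\<^sup>2) =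
          (a / b) powr (2 * \<alpha>) / (2 * b\<^sup>2 * (1 + 2 * \<alpha>))
          * hypergeom [\<alpha> + 1/2, 1] [\<alpha> + 3/2] (a\<^sup>2 / b\<^sup>2))"
proof (intro conjI impI)
  have zero: "indicator {0<..} x *\<^sub>R ((bessel_I \<alpha> (a * of_real x))\<^sup>2 * (bessel_K \<alpha> (b * of_real x))\<^sup>2) = bessel_integrand 0 \<alpha> b a x"
    and one: "indicator {0<..} x *\<^sub>R (of_real x * (bessel_I \<alpha> (a * of_real x))\<^sup>2 * (bessel_K \<alpha> (b * of_real x))\<^sup>2) = bessel_integrand 1 \<alpha> b a x" for x
    by (simp_all add: bessel_integrand_def)
  {
    assume "0 < Re a \<and> Re a \<le> Re b \<and> - 1/4 < Re \<alpha>"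
    hence *: "0 < Re a" "Re a \<le> Re b" "- 1/4 < Re \<alpha>" by auto
    show "set_integrable lborel {0<..} (\<lambda>x. (bessel_I \<alpha> (a * of_real x))\<^sup>2 * (bessel_K \<alpha> (b * of_real x))\<^sup>2)"
      unfolding set_integrable_def zero
      by (rule bessel_integrand_integrable) (use * integrand_majorant_integrable in auto)
    show "(LINT x:{0<..}|lborel. (bessel_I \<alpha> (a * of_real x))\<^sup>2 * (bessel_K \<alpha> (b * of_real x))\<^sup>2) =
          of_real pi / (4 * b) * (a / (2 * b)) powr (2 * \<alpha>)
          * (Gamma (\<alpha> + 1/2) * Gamma (2 * \<alpha> + 1/2) / Gamma (\<alpha> + 1) ^ 3)
          * hypergeom [\<alpha> + 1/2, 2 * \<alpha> + 1/2, \<alpha> + 1/2, 1/2] [\<alpha> + 1, 2 * \<alpha> + 1, \<alpha> + 1] (a\<^sup>2 / b\<^sup>2)"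
      unfolding set_lebesgue_integral_def zero
      using integral_4F3[OF *(3,1,2)] by (simp only: prefactor_4F3_def)
  next
    assume "0 < Re a \<and> Re a < Re b \<and> - 1/2 < Re \<alpha>"
    hence *: "0 < Re a" "Re a < Re b" "- 1/2 < Re \<alpha>" by auto
    show "set_integrable lborel {0<..} (\<lambda>x. of_real x * (bessel_I \<alpha> (a * of_real x))\<^sup>2 * (bessel_K \<alpha> (b * of_real x))\<^sup>2)"
      unfolding set_integrable_def one
      by (rule bessel_integrand_integrable) (use * integrand_majorant_integrable_less[of "Re \<alpha>" 1 "Re a" "Re b"] in auto)
    show "(LINT x:{0<..}|lborel. of_real x * (bessel_I \<alpha> (a * of_real x))\<^sup>2 * (bessel_K \<alpha> (b * of_real x))\<^sup>2) =
          (a / b) powr (2 * \<alpha>) / (2 * b\<^sup>2 * (1 + 2 * \<alpha>))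
          * hypergeom [\<alpha> + 1/2, 1] [\<alpha> + 3/2] (a\<^sup>2 / b\<^sup>2)"
      unfolding set_lebesgue_integral_def one
      using integral_2F1_strip[OF *(3,1,2)] by (simp only: prefactor_2F1_def)
  }
qed

end
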